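(* Let $\varepsilon>0$ and $0<\gamma<0.1$. (i) For any estimator $\hat Z$ based on $Y$, if $\mathbb E_{f_0}|\hat Z-Z(f_0)|\le\gamma R_z(\varepsilon;f_0)$ for some $f_0\in\mathcal F$, then there exists $f_1\in\mathcal F$ such that $$\mathbb E_{f_1}|\hat Z-Z(f_1)|\ge\frac1{40}\Big(\log\frac1\gamma\Big)^{1/3}R_z(\varepsilon;f_1).$$ (ii) For any estimator $\hat M$ based on $Y$, if $\mathbb E_{f_0}|\hat M-M(f_0)|\le\gamma R_m(\varepsilon;f_0)$ for some $f_0\in\mathcal F$, then there exists $f_1\in\mathcal F$ such that $$\mathbb E_{f_1}|\hat M-M(f_1)|\ge\frac18\Big(\log\frac1\gamma\Big)^{1/3}R_m(\varepsilon;f_1).$$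
   Context: $\mathcal F$ is the collection of convex functions $f:[0,1]\to\mathbb R$ with a unique minimizer $Z(f)=\arg\min_{0\le t\le1}f(t)$; $M(f)=f(Z(f))$ is the minimum value. White noise model: one observes $dY(t)=f(t)\,dt+\varepsilon\,dW(t)$, $0\le t\le 1$, with $W$ a standard Brownian motion and $\varepsilon>0$ the noise level; $\mathbb E_f$ denotes expectation when the drift is $f$. Benchmarks: $$R_z(\varepsilon;f)=\sup_{g\in\mathcal F}\inf_{\hat Z}\max_{h\in\{f,g\}}\mathbb E_h|\hat Z-Z(h)|,\qquad R_m(\varepsilon;f)=\sup_{g\in\mathcal F}\inf_{\hat M}\max_{h\in\{f,g\}}\mathbb E_h|\hat M-M(h)|,$$ the infima being over all estimators based on $Y$. *)

theory Defs
  imports "HOL-Probability.Probability"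
begin

definition convex_class :: "(real \<Rightarrow> real) set" where
  "convex_class = {f. convex_on {0..1} f \<and> (\<exists>!t. is_arg_min f (\<lambda>t. t \<in> {0..1}) t)}"

definition minimizer :: "(real \<Rightarrow> real) \<Rightarrow> real" where
  "minimizer f = arg_min_on f {0..1}"

definition minimum :: "(real \<Rightarrow> real) \<Rightarrow> real" where
  "minimum f = f (minimizer f)"

text \<open>
  Standard Brownian motion with time parameter in \<open>[0,1]\<close>; the values of \<open>W t\<close> for
  \<open>t\<close> outside \<open>[0,1]\<close> are irrelevant.
\<close>

definition standard_brownian_motion :: "'w measure \<Rightarrow> (real \<Rightarrow> 'w \<Rightarrow> real) \<Rightarrow> bool" where
  "standard_brownian_motion P W \<longleftrightarrow>
     prob_space P \<and>
     (\<forall>t\<in>{0..1}. W t \<in> borel_measurable P) \<and>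
     (AE \<omega> in P. W 0 \<omega> = 0) \<and>
     (AE \<omega> in P. continuous_on {0..1} (\<lambda>t. W t \<omega>)) \<and>
     (\<forall>s t. 0 \<le> s \<and> s < t \<and> t \<le> 1 \<longrightarrow>
        distributed P lborel (\<lambda>\<omega>. W t \<omega> - W s \<omega>) (normal_density 0 (sqrt (t - s)))) \<and>
     (\<forall>(n::nat) t. strict_mono_on {..n} t \<and> t ` {..n} \<subseteq> {0..1} \<longrightarrow>
        prob_space.indep_vars P (\<lambda>_. borel) (\<lambda>i \<omega>. W (t (Suc i)) \<omega> - W (t i) \<omega>) {..<n})"

text \<open>
  The observed path: \<open>dY(t) = f(t) dt + \<epsilon> dW(t)\<close> with \<open>Y(0) = 0\<close>, in integrated form. Functions in
  \<open>convex_class\<close> are Lebesgue integrable on \<open>[0,1]\<close>, being convex and bounded there.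
\<close>

definition observation ::
    "(real \<Rightarrow> 'w \<Rightarrow> real) \<Rightarrow> real \<Rightarrow> (real \<Rightarrow> real) \<Rightarrow> 'w \<Rightarrow> real \<Rightarrow> real" where
  "observation W \<epsilon> f \<omega> = (\<lambda>t\<in>{0..1}. (LINT s:{0..t}|lborel. f s) + \<epsilon> * W t \<omega>)"

text \<open>
  Estimators are the real functions of the path that are measurable with respect to the
  \<open>\<sigma>\<close>-algebra generated by the coordinates. Its trace on \<open>C[0,1]\<close> is the Borel \<open>\<sigma>\<close>-algebra of
  the uniform norm, and measurable functions on that trace extend, so nothing is lost by working
  with all paths.
\<close>

definition estimators :: "((real \<Rightarrow> real) \<Rightarrow> real) set" where
  "estimators = borel_measurable (\<Pi>\<^sub>M t\<in>{0..1}. borel)"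

text \<open>
  Expected absolute error for estimating \<open>T f\<close> when the drift is \<open>f\<close>. It is an extended
  nonnegative real, so estimators with infinite risk are not excluded.
\<close>

definition risk ::
    "'w measure \<Rightarrow> (real \<Rightarrow> 'w \<Rightarrow> real) \<Rightarrow> real \<Rightarrow> ((real \<Rightarrow> real) \<Rightarrow> real) \<Rightarrow>
     ((real \<Rightarrow> real) \<Rightarrow> real) \<Rightarrow> (real \<Rightarrow> real) \<Rightarrow> ennreal" where
  "risk P W \<epsilon> T E f = (\<integral>\<^sup>+ \<omega>. ennreal \<bar>E (observation W \<epsilon> f \<omega>) - T f\<bar> \<partial>P)"

definition benchmark ::
    "'w measure \<Rightarrow> (real \<Rightarrow> 'w \<Rightarrow> real) \<Rightarrow> ((real \<Rightarrow> real) \<Rightarrow> real) \<Rightarrow> real \<Rightarrow> (real \<Rightarrow> real) \<Rightarrow> ennreal"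
  where
  "benchmark P W T \<epsilon> f =
     (SUP g\<in>convex_class. INF E\<in>estimators. max (risk P W \<epsilon> T E f) (risk P W \<epsilon> T E g))"

definition R_z ::
    "'w measure \<Rightarrow> (real \<Rightarrow> 'w \<Rightarrow> real) \<Rightarrow> real \<Rightarrow> (real \<Rightarrow> real) \<Rightarrow> ennreal" where
  "R_z P W = benchmark P W minimizer"

definition R_m ::
    "'w measure \<Rightarrow> (real \<Rightarrow> 'w \<Rightarrow> real) \<Rightarrow> real \<Rightarrow> (real \<Rightarrow> real) \<Rightarrow> ennreal" where
  "R_m P W = benchmark P W minimum"

end

theory Submission
  imports Defs
begin

text \<open>
  Let \<open>d = \<parallel>f - g\<parallel>\<^sub>2 / \<epsilon>\<close>. Telling \<open>f\<close> and \<open>g\<close> apart by the likelihood ratio of the increments over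
  a fine grid gives a two-point risk of at most \<open>\<bar>T f - T g\<bar> exp (- d\<^sup>2 / 8) / 2\<close>, which bounds the
  benchmarks from above. Conversely \<open>(E\<^sub>g \<phi>)\<^sup>2 \<le> exp (d\<^sup>2) E\<^sub>f \<phi>\<close> for every statistic \<open>\<phi>\<close> with values in
  \<open>[0,1]\<close>: this is a \<open>\<chi>\<^sup>2\<close> bound for Gaussian shifts on cylinder sets, and it passes to all events by
  approximation, so that Girsanov's theorem is not needed. Hence an estimator with a risk of at most
  \<open>\<gamma> R\<close> at \<open>f\<close> has a risk of at least \<open>\<bar>T f - T g\<bar> (1 - exp (d\<^sup>2 / 2) sqrt (\<gamma> R / \<bar>T f - T g\<bar>))\<close> at \<open>g\<close>,
  which is not small as long as \<open>d\<^sup>2\<close> is a small multiple of \<open>ln (1 / \<gamma>)\<close>.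

  It remains to find \<open>g\<close> at such a distance with a large \<open>\<bar>T f - T g\<bar>\<close> and a small benchmark. For the
  minimum, \<open>g\<close> is \<open>f\<close> with its bottom filled up to a level \<open>D\<close>: the flat bottom makes the benchmark at
  \<open>g\<close> of the order \<open>D / d\<close>. For the minimizer, \<open>g\<close> is the maximum of \<open>f\<close> and a wedge whose tip lies on
  the graph of \<open>f\<close> at a distance \<open>x\<close> from the minimizer: the slope of the wedge makes the benchmark at
  \<open>g\<close> of the order \<open>x / d\<^sup>2\<^sup>/\<^sup>3\<close>.
\<close>

section \<open>Quadratic distances of convex functions\<close>

text \<open>The benchmarks are suprema over the whole class, so bounding them from above needs, for
  every competitor, a lower bound on the quadratic distance in terms of the displacement of the
  minimum or of the minimizer. Convexity provides it: such a displacement forces a difference over a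
  whole stretch.

  With L = ln (1 / \<gamma>), the competitor has d^2 <= L/4 for the minimizer and d^2 <= L/2 for the
  minimum, so exp (d^2) \<gamma> is at most \<gamma>^(3/4) or \<gamma>^(1/2), small enough as
  \<gamma> < 1/10. The exponent 1/3 for the minimizer comes from a wedge of slope k, where a
  displacement by y costs at least k^2 y^3 / 12: the benchmark there is of the order (\<epsilon> /
  k)^(2/3), with k of the order h / x and h^2 x of the order \<epsilon>^2 L. For the minimum, the
  flat bottom gains L^(1/2), which dominates L^(1/3) because L is bounded away from 0.\<close>

abbreviation "unit_lborel \<equiv> restrict_space lborel {0..1::real}"

definition l2_dist_sq :: "(real \<Rightarrow> real) \<Rightarrow> (real \<Rightarrow> real) \<Rightarrow> real" where
  "l2_dist_sq f g = (\<integral>t. (f t - g t)\<^sup>2 \<partial>unit_lborel)"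

text \<open>Members of the convex class may jump at 0 and 1, so continuity cannot serve as the
  common hypothesis. This property holds for all of them, survives arithmetic and
  \<open>max\<close>, and gives integrability on \<open>unit_lborel\<close>.\<close>

definition bounded_measurable :: "(real \<Rightarrow> real) \<Rightarrow> bool" where
  "bounded_measurable f \<longleftrightarrow> f \<in> borel_measurable unit_lborel \<and> (\<exists>B. \<forall>t\<in>{0..1}. \<bar>f t\<bar> \<le> B)"

lemma space_unit [simp]: "space unit_lborel = {0..1}"
  by (simp add: space_restrict_space)

lemma measurable_unit_borel: "f \<in> borel_measurable borel \<Longrightarrow> f \<in> borel_measurable unit_lborel"
  by (simp add: measurable_restrict_space1)

interpretation U: prob_space unit_lborel
  by (rule prob_spaceI) (simp add: emeasure_restrict_space)

lemma integrable_bounded_measurable: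
  assumes "bounded_measurable f" shows "integrable unit_lborel f"
proof -
  obtain B where "f \<in> borel_measurable unit_lborel" "\<forall>t\<in>{0..1}. \<bar>f t\<bar> \<le> B"
    using assms by (auto simp: bounded_measurable_def)
  then show ?thesis by (intro U.integrable_const_bound[where B=B]) auto
qed

lemma bounded_measurable_const: "bounded_measurable (\<lambda>_. c)"
  by (auto simp: bounded_measurable_def)

lemma bounded_measurable_add:
  assumes "bounded_measurable f" "bounded_measurable g"
  shows "bounded_measurable (\<lambda>t. f t + g t)"
proof -
  obtain B C where *: "f \<in> borel_measurable unit_lborel" "\<forall>t\<in>{0..1}. \<bar>f t\<bar> \<le> B"
    "g \<in> borel_measurable unit_lborel" "\<forall>t\<in>{0..1}. \<bar>g t\<bar> \<le> C"
    using assms by (auto simp: bounded_measurable_def)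
  have "\<forall>t\<in>{0..1}. \<bar>f t + g t\<bar> \<le> B + C" using * by (smt (verit))
  then show ?thesis using * by (auto simp: bounded_measurable_def)
qed

lemma bounded_measurable_mult:
  assumes "bounded_measurable f" "bounded_measurable g"
  shows "bounded_measurable (\<lambda>t. f t * g t)"
proof -
  obtain B C where *: "f \<in> borel_measurable unit_lborel" "\<forall>t\<in>{0..1}. \<bar>f t\<bar> \<le> B"
    "g \<in> borel_measurable unit_lborel" "\<forall>t\<in>{0..1}. \<bar>g t\<bar> \<le> C"
    using assms by (auto simp: bounded_measurable_def)
  have "\<forall>t\<in>{0..1}. \<bar>f t * g t\<bar> \<le> B * C"
    using * by (auto simp: abs_mult intro!: mult_mono order.trans[OF abs_ge_zero])
  then show ?thesis using * by (auto simp: bounded_measurable_def)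
qed

lemma bounded_measurable_uminus:
  "bounded_measurable f \<Longrightarrow> bounded_measurable (\<lambda>t. - f t)"
  by (auto simp: bounded_measurable_def)

lemma bounded_measurable_diff:
  assumes "bounded_measurable f" "bounded_measurable g"
  shows "bounded_measurable (\<lambda>t. f t - g t)"
  using bounded_measurable_add[OF assms(1) bounded_measurable_uminus[OF assms(2)]] by simp

lemma bounded_measurable_abs:
  "bounded_measurable f \<Longrightarrow> bounded_measurable (\<lambda>t. \<bar>f t\<bar>)"
  by (auto simp: bounded_measurable_def)

lemma bounded_measurable_max:
  assumes "bounded_measurable f" "bounded_measurable g"
  shows "bounded_measurable (\<lambda>t. max (f t) (g t))"
proof -
  have "(\<lambda>t. max (f t) (g t)) = (\<lambda>t. (f t + g t + \<bar>f t - g t\<bar>) * (1/2))" by auto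
  then show ?thesis
    using assms by (simp only:) (intro bounded_measurable_add bounded_measurable_abs bounded_measurable_diff
        bounded_measurable_mult bounded_measurable_const)
qed

lemma bounded_measurable_power2:
  "bounded_measurable f \<Longrightarrow> bounded_measurable (\<lambda>t. (f t)\<^sup>2)"
  unfolding power2_eq_square by (rule bounded_measurable_mult)

lemma bounded_measurable_indicator:
  assumes "A \<in> sets borel" shows "bounded_measurable (indicator A)"
  using measurable_unit_borel[of "indicator A :: real \<Rightarrow> real"] assms
  by (auto simp: bounded_measurable_def indicator_def intro!: exI[of _ 1])

lemmas bounded_measurable_intros = bounded_measurable_const
  bounded_measurable_add bounded_measurable_mult bounded_measurable_uminus bounded_measurable_diff
  bounded_measurable_abs bounded_measurable_max bounded_measurable_power2

lemma l2_dist_sq_nonneg: "0 \<le> l2_dist_sq f g"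
  by (simp add: l2_dist_sq_def)

lemma integral_indicator_unit:
  assumes "A \<in> sets borel"
  shows "(\<integral>t. indicator A t \<partial>unit_lborel) = measure lborel (A \<inter> {0..1})"
proof -
  have "(\<integral>t. indicator A t \<partial>unit_lborel) = (\<integral>t. indicator (A \<inter> {0..1}) t \<partial>unit_lborel)"
    by (intro Bochner_Integration.integral_cong) (auto simp: indicator_def)
  also have "\<dots> = measure unit_lborel (A \<inter> {0..1})"
    using assms by (simp add: Int_ac)
  also have "\<dots> = measure lborel (A \<inter> {0..1})"
    using assms by (subst measure_restrict_space) auto
  finally show ?thesis .
qed

lemma integral_indicator_unit_le:
  assumes "a \<le> b" "A \<in> sets borel" "A \<subseteq> {a..b}"
  shows "(\<integral>t. indicator A t \<partial>unit_lborel) \<le> b - a"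
proof -
  have "measure lborel (A \<inter> {0..1}) \<le> measure lborel {a..b}"
    using assms by (intro measure_mono_fmeasurable fmeasurableI) auto
  then show ?thesis using integral_indicator_unit[OF assms(2)] assms(1) by simp
qed

text \<open>Convexity gives continuity on the open interval only; the two endpoint values enter as
  separate indicator terms. From above the function is bounded by the larger endpoint value.\<close>

lemma convex_on_unit_bounded_measurable:
  assumes cv: "convex_on {0..1} f" and lb: "\<And>t. t \<in> {0..1} \<Longrightarrow> m \<le> f t"
  shows "bounded_measurable f"
proof -
  have "convex_on {0<..<1} f" by (rule convex_on_subset[OF cv]) auto
  then have cont: "continuous_on {0<..<1} f" by (intro convex_on_continuous) auto
  have "(\<lambda>t. indicator {0<..<1} t *\<^sub>R f t) \<in> borel_measurable borel"
    using borel_measurable_continuous_on_indicator[OF _ cont] by simp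
  then have "(\<lambda>t. indicator {0<..<1} t *\<^sub>R f t + indicator {0} t * f 0 + indicator {1} t * f 1)
      \<in> borel_measurable borel" by measurable
  then have "(\<lambda>t. indicator {0<..<1} t *\<^sub>R f t + indicator {0} t * f 0 + indicator {1} t * f 1)
      \<in> borel_measurable unit_lborel" by (rule measurable_unit_borel)
  moreover have "f t = indicator {0<..<1} t *\<^sub>R f t + indicator {0} t * f 0 + indicator {1} t * f 1"
    if "t \<in> space unit_lborel" for t
    using that by (cases "t = 0"; cases "t = 1") (auto simp: indicator_def)
  ultimately have "f \<in> borel_measurable unit_lborel"
    by (subst measurable_cong[where g="\<lambda>t. indicator {0<..<1} t *\<^sub>R f t + indicator {0} t * f 0 + indicator {1} t * f 1"]) auto
  moreover have "\<bar>f t\<bar> \<le> max \<bar>m\<bar> (max \<bar>f 0\<bar> \<bar>f 1\<bar>)" if "t \<in> {0..1}" for t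
  proof -
    have "f t \<le> max (f 0) (f 1)"
      using convex_on_le_max[of 0 1 f t] cv that by auto
    then show ?thesis using lb[OF that] by linarith
  qed
  ultimately show ?thesis unfolding bounded_measurable_def by blast
qed

section \<open>Convex functions with a unique minimizer\<close>

lemma convex_class_minimizer:
  assumes "f \<in> convex_class"
  shows "convex_on {0..1} f" "minimizer f \<in> {0..1}" "f (minimizer f) = minimum f"
    "\<And>t. t \<in> {0..1} \<Longrightarrow> minimum f \<le> f t"
    "\<And>t. t \<in> {0..1} \<Longrightarrow> t \<noteq> minimizer f \<Longrightarrow> minimum f < f t"
proof -
  have ex: "\<exists>!t. is_arg_min f (\<lambda>t. t \<in> {0..1}) t" using assms by (simp add: convex_class_def)
  show "convex_on {0..1} f" using assms by (simp add: convex_class_def)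
  have *: "is_arg_min f (\<lambda>t. t \<in> {0..1}) (minimizer f)"
    unfolding minimizer_def arg_min_on_def arg_min_def using ex by (metis someI_ex)
  then show "minimizer f \<in> {0..1}" by (simp add: is_arg_min_def)
  show "f (minimizer f) = minimum f" by (simp add: minimum_def)
  show le: "minimum f \<le> f t" if "t \<in> {0..1}" for t
    using * that by (auto simp: is_arg_min_linorder minimum_def)
  show "minimum f < f t" if "t \<in> {0..1}" "t \<noteq> minimizer f" for t
  proof (rule ccontr)
    assume "\<not> minimum f < f t"
    then have "is_arg_min f (\<lambda>t. t \<in> {0..1}) t"
      using that le by (fastforce simp: is_arg_min_linorder)
    then show False using ex * that by blast
  qed
qed

lemma convex_class_bounded_measurable: "f \<in> convex_class \<Longrightarrow> bounded_measurable f"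
  using convex_on_unit_bounded_measurable[of f "minimum f"] convex_class_minimizer[of f] by blast

lemma convex_classI:
  assumes "convex_on {0..1} f" "z \<in> {0..1}" "\<And>t. t \<in> {0..1} \<Longrightarrow> t \<noteq> z \<Longrightarrow> f z < f t"
  shows "f \<in> convex_class" "minimizer f = z" "minimum f = f z"
proof -
  have z: "is_arg_min f (\<lambda>t. t \<in> {0..1}) z"
    using assms(2,3) by (auto simp: is_arg_min_linorder) (metis assms(3) atLeastAtMost_iff less_eq_real_def)
  have u: "t = z" if "is_arg_min f (\<lambda>t. t \<in> {0..1}) t" for t
    using that assms(2) assms(3)[of t] by (force simp: is_arg_min_def)
  show c: "f \<in> convex_class" unfolding convex_class_def using z u assms(1) by blast
  have "is_arg_min f (\<lambda>t. t \<in> {0..1}) (minimizer f)"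
    unfolding minimizer_def arg_min_on_def arg_min_def using z by (rule someI)
  then show "minimizer f = z" by (rule u)
  then show "minimum f = f z" by (simp add: minimum_def)
qed

text \<open>Pair each \<open>t\<close> with its mirror image \<open>p + q - t\<close>. The values of
  \<open>h\<close> there differ by at least \<open>A * \<bar>2 * t - p - q\<bar>\<close>, so their
  squares add up to at least half the square of this, wherever \<open>h\<close> may vanish. For
  \<open>p = 0\<close> and \<open>q = 1\<close>, a linear \<open>h\<close> vanishing at 1/2 gives
  equality.\<close>

lemma integral_sq_ge_of_expanding:
  assumes h: "bounded_measurable h" and pq: "0 \<le> p" "p \<le> q" "q \<le> 1" and A: "0 \<le> A"
    and inc: "\<And>t t'. p \<le> t \<Longrightarrow> t < t' \<Longrightarrow> t' \<le> q \<Longrightarrow> A * (t' - t) \<le> \<bar>h t' - h t\<bar>"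
  shows "A\<^sup>2 * (q - p) ^ 3 / 12 \<le> (\<integral>t. (h t)\<^sup>2 \<partial>unit_lborel)"
proof -
  define r where "r = (\<lambda>t. p + q - t)"
  have int: "integrable unit_lborel (\<lambda>t. (h t)\<^sup>2)"
    using h by (intro integrable_bounded_measurable bounded_measurable_intros)
  have hI: "set_integrable lborel {p..q} (\<lambda>t. (h t)\<^sup>2)"
  proof -
    have "set_integrable lborel {0..1} (\<lambda>t. (h t)\<^sup>2)"
      using int by (simp add: set_integrable_def integrable_restrict_space)
    then show ?thesis by (rule set_integrable_subset) (use pq in auto)
  qed
  define I where "I = (LINT t:{p..q}|lborel. (h t)\<^sup>2)"
  have le: "I \<le> (\<integral>t. (h t)\<^sup>2 \<partial>unit_lborel)"
  proof -
    have "I = (\<integral>t. indicator {p..q} t * (h t)\<^sup>2 \<partial>unit_lborel)"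
      using pq unfolding I_def set_lebesgue_integral_def
      by (subst integral_restrict_space) (auto intro!: Bochner_Integration.integral_cong simp: indicator_def)
    also have "\<dots> \<le> (\<integral>t. (h t)\<^sup>2 \<partial>unit_lborel)"
      using h by (intro integral_mono integrable_bounded_measurable bounded_measurable_intros bounded_measurable_indicator)
        (auto simp: indicator_def)
    finally show ?thesis .
  qed
  have refl: "set_integrable lborel {p..q} (\<lambda>t. (h (r t))\<^sup>2)" "(LINT t:{p..q}|lborel. (h (r t))\<^sup>2) = I"
  proof -
    have eq: "indicator {p..q} (p + q + (-1) * t) *\<^sub>R (h (p + q + (-1) * t))\<^sup>2 = indicator {p..q} t *\<^sub>R (h (r t))\<^sup>2" for t
      by (auto simp: indicator_def r_def)
    have "integrable lborel (\<lambda>t. indicator {p..q} (p + q + (-1) * t) *\<^sub>R (h (p + q + (-1) * t))\<^sup>2)"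
      using hI unfolding set_integrable_def by (subst lborel_integrable_real_affine_iff) auto
    then show "set_integrable lborel {p..q} (\<lambda>t. (h (r t))\<^sup>2)" unfolding set_integrable_def eq .
    show "(LINT t:{p..q}|lborel. (h (r t))\<^sup>2) = I"
      unfolding I_def set_lebesgue_integral_def
      by (subst (2) lborel_integral_real_affine[where c="-1" and t="p+q"]) (auto simp only: eq, simp)
  qed
  have q2: "((\<lambda>t. A\<^sup>2 / 2 * (2 * t - p - q)\<^sup>2) has_integral (A\<^sup>2 * (q - p) ^ 3 / 6)) {p..q}"
  proof -
    have "((\<lambda>t. A\<^sup>2 / 2 * (2 * t - p - q)\<^sup>2) has_integral
        (A\<^sup>2 / 12 * (2 * q - p - q) ^ 3 - A\<^sup>2 / 12 * (2 * p - p - q) ^ 3)) {p..q}"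
      using pq by (intro fundamental_theorem_of_calculus)
        (auto intro!: derivative_eq_intros simp flip: has_real_derivative_iff_has_vector_derivative simp: power2_eq_square)
    moreover have "A\<^sup>2 / 12 * (2 * q - p - q) ^ 3 - A\<^sup>2 / 12 * (2 * p - p - q) ^ 3 = A\<^sup>2 * (q - p) ^ 3 / 6"
      by (simp add: power3_eq_cube algebra_simps)
    ultimately show ?thesis by metis
  qed
  have cI: "set_integrable lborel {p..q} (\<lambda>t. A\<^sup>2 / 2 * (2 * t - p - q)\<^sup>2)"
    by (intro borel_integrable_compact[unfolded set_integrable_def[symmetric]] borel_integrable_atLeastAtMost')
      (auto intro!: continuous_intros)
  have "A\<^sup>2 * (q - p) ^ 3 / 6 = (LINT t:{p..q}|lborel. A\<^sup>2 / 2 * (2 * t - p - q)\<^sup>2)"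
    by (subst set_borel_integral_eq_integral(2)[OF cI]) (rule integral_unique[OF q2, symmetric])
  also have "\<dots> \<le> (LINT t:{p..q}|lborel. (h t)\<^sup>2 + (h (r t))\<^sup>2)"
  proof (intro set_integral_mono cI set_integral_add hI refl)
    fix t assume t: "t \<in> {p..q}"
    have "A * \<bar>2 * t - p - q\<bar> \<le> \<bar>h t - h (r t)\<bar>"
    proof (cases "t < r t")
      case True
      then have "\<bar>2 * t - p - q\<bar> = r t - t" by (simp add: r_def)
      moreover have "A * (r t - t) \<le> \<bar>h (r t) - h t\<bar>"
        using inc[of t "r t"] t True by (simp add: r_def)
      ultimately show ?thesis by (simp add: abs_minus_commute)
    next
      case False
      show ?thesis
      proof (cases "t = r t")
        case True then have "2 * t - p - q = 0" by (simp add: r_def)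
        then show ?thesis by simp
      next
        case False
        with \<open>\<not> t < r t\<close> have "\<bar>2 * t - p - q\<bar> = t - r t" by (simp add: r_def)
        moreover have "A * (t - r t) \<le> \<bar>h t - h (r t)\<bar>"
          using inc[of "r t" t] t False \<open>\<not> t < r t\<close> by (simp add: r_def)
        ultimately show ?thesis by simp
      qed
    qed
    then have "(A * \<bar>2 * t - p - q\<bar>)\<^sup>2 \<le> \<bar>h t - h (r t)\<bar>\<^sup>2" by (intro power_mono) (auto simp: A)
    then have "A\<^sup>2 * (2 * t - p - q)\<^sup>2 \<le> (h t - h (r t))\<^sup>2" by (simp add: power_mult_distrib)
    also have "\<dots> \<le> 2 * ((h t)\<^sup>2 + (h (r t))\<^sup>2)"
      using zero_le_power2[of "h t + h (r t)"] by (simp add: power2_eq_square algebra_simps)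
    finally show "A\<^sup>2 / 2 * (2 * t - p - q)\<^sup>2 \<le> (h t)\<^sup>2 + (h (r t))\<^sup>2" by simp
  qed
  also have "\<dots> = 2 * I" using set_integral_add(2)[OF hI refl(1)] refl(2) by (simp add: I_def)
  finally show ?thesis using le by simp
qed

text \<open>
  By convexity, the stretch on which \<open>v\<close> sinks from \<open>1\<close> to \<open>-1\<close> is at most \<open>8/7\<close> times as long as the
  stretch from there to the minimum \<open>-11/4\<close>: what can be saved by staying close to a nonnegative
  function on the former is lost on the latter.
\<close>

lemma convex_descent:
  fixes v :: "real \<Rightarrow> real"
  assumes cv: "convex_on {a..b} v" and ab: "a \<le> b" and vb: "v b = - (11/4)"
  obtains q where "a \<le> q" "q \<le> b"
    "\<And>t. a \<le> t \<Longrightarrow> t < q - 8/7 * (b - q) \<Longrightarrow> 1 \<le> v t"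
    "\<And>t. q < t \<Longrightarrow> t \<le> b \<Longrightarrow> v t \<le> -1"
    "\<And>t. (q + b) / 2 < t \<Longrightarrow> t \<le> b \<Longrightarrow> v t \<le> - (15/8)"
proof -
  define Q where "Q = {t \<in> {a..b}. v t \<le> -1}"
  define q where "q = Inf Q"
  have bQ: "b \<in> Q" using ab vb by (auto simp: Q_def)
  have bdd: "bdd_below Q" by (rule bdd_belowI[of _ a]) (auto simp: Q_def)
  have aq: "a \<le> q" unfolding q_def by (rule cInf_greatest) (use bQ in \<open>auto simp: Q_def\<close>)
  have qb: "q \<le> b" unfolding q_def by (rule cInf_lower[OF bQ bdd])
  have above: "-1 < v t" if "a \<le> t" "t < q" for t
  proof (rule ccontr)
    assume "\<not> -1 < v t"
    then have "t \<in> Q" using that qb by (auto simp: Q_def)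
    then show False using cInf_lower[OF _ bdd, of t] that by (simp add: q_def)
  qed
  have chord: "(b - t) * v s \<le> (b - s) * v t + (s - t) * v b" if "a \<le> t" "t < s" "s \<le> b" for s t
  proof -
    define l where "l = (s - t) / (b - t)"
    have l: "0 \<le> l" "l \<le> 1" using that by (auto simp: l_def)
    have "l * (b - t) = s - t" using that by (simp add: l_def)
    then have "(1 - l) *\<^sub>R t + l *\<^sub>R b = s" by (simp add: algebra_simps)
    then have "v s \<le> (1 - l) * v t + l * v b"
      using convex_onD[OF cv l(1) l(2), of t b] that by auto
    then have "(b - t) * v s \<le> (b - t) * ((1 - l) * v t + l * v b)"
      using that by (intro mult_left_mono) auto
    also have "\<dots> = (b - s) * v t + (s - t) * v b"
    proof -
      have "(b - t) * l = s - t" "(b - t) * (1 - l) = b - s"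
        using that by (auto simp: l_def field_simps)
      then show ?thesis by (metis (no_types, lifting) distrib_left mult.assoc)
    qed
    finally show ?thesis .
  qed
  have below: "v t \<le> -1" if "q < t" "t \<le> b" for t
  proof -
    obtain s where s: "s \<in> Q" "s < t"
      using \<open>q < t\<close> bQ bdd cInf_less_iff[of Q t] unfolding q_def by blast
    have "(b - s) * v t \<le> (b - t) * v s + (t - s) * v b"
      using s that by (intro chord) (auto simp: Q_def)
    also have "\<dots> \<le> (b - t) * (-1) + (t - s) * (-1)"
      using s that vb by (intro add_mono mult_left_mono) (auto simp: Q_def)
    also have "\<dots> = (b - s) * (-1)" by (simp add: algebra_simps)
    finally show ?thesis using s that mult_le_cancel_left_pos[of "b - s" "v t" "-1"] by simp
  qed
  show ?thesis
  proof (rule that[OF aq qb _ below])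
    \<comment> \<open>Going left from \<open>b\<close>, a chord rises by 7/4 over the length
      \<open>b - q\<close>. Convexity keeps this slope, so the rise of 2 from -1 to 1 takes at most
      2 / (7/4) = 8/7 of that length. As \<open>q\<close> is an infimum, the chord is taken through
      \<open>s < q\<close>, and then \<open>s\<close> tends to \<open>q\<close>.\<close>
    fix t assume t: "a \<le> t" "t < q - 8/7 * (b - q)"
    have "0 \<le> 8/7 * (b - q)" using qb by simp
    then have tq: "t < q" using t by linarith
    have lower: "(b - s) * v t \<ge> (s - t) * (11/4) - (b - t)" if s: "t < s" "s < q" for s
    proof -
      have "(b - t) * (-1) \<le> (b - t) * v s"
        using above[of s] s t qb by (intro mult_left_mono) auto
      also have "\<dots> \<le> (b - s) * v t + (s - t) * v b" using s t qb by (intro chord) auto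
      finally show ?thesis by (simp add: vb)
    qed
    have "(q - t) * (11/4) - (b - t) \<le> (b - q) * v t"
    proof (rule tendsto_le)
      show "((\<lambda>s. (b - s) * v t) \<longlongrightarrow> (b - q) * v t) (at_left q)"
        "((\<lambda>s. (s - t) * (11/4) - (b - t)) \<longlongrightarrow> (q - t) * (11/4) - (b - t)) (at_left q)"
        by (intro tendsto_intros)+
      show "\<forall>\<^sub>F s in at_left q. (s - t) * (11/4) - (b - t) \<le> (b - s) * v t"
        unfolding eventually_at_left[OF tq] using tq lower by (intro exI[of _ t]) auto
    qed simp
    moreover have "b - q < (q - t) * (11/4) - (b - t)" using t by (simp add: field_simps)
    ultimately have *: "b - q < (b - q) * v t" by linarith
    then have "b - q \<noteq> 0" by auto
    then have "0 < b - q" using qb by linarith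
    then show "1 \<le> v t" using * mult_le_cancel_left_pos[of "b - q" 1 "v t"] by simp
  next
    fix t assume t: "(q + b) / 2 < t" "t \<le> b"
    \<comment> \<open>\<open>t\<close> is the midpoint of \<open>s\<close> and \<open>b\<close>, and
      -15/8 is the mean of -1 and -11/4.\<close>
    define s where "s = 2 * t - b"
    have s: "q < s" "s \<le> b" "t = (s + b) / 2" using t by (auto simp: s_def)
    show "v t \<le> - (15/8)"
    proof (cases "s = b")
      case True then show ?thesis using s vb by simp
    next
      case False
      have "(b - s) * v t \<le> (b - t) * v s + (t - s) * v b"
        using s False aq by (intro chord) auto
      also have "\<dots> \<le> (b - t) * (-1) + (t - s) * (-(11/4))"
        using s below[of s] vb by (intro add_mono mult_left_mono) auto
      also have "\<dots> = (b - s) * (- (15/8))" unfolding s(3) by (simp add: field_simps)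
      finally have "(b - s) * v t \<le> (b - s) * (- (15/8))" .
      then show ?thesis using s(2) False by (subst (asm) mult_le_cancel_left_pos) auto
    qed
  qed
qed

text \<open>The squared \<open>L\<^sup>2\<close> cost of raising the minimum of \<open>f\<close> by \<open>x\<close>.\<close>

definition fill :: "(real \<Rightarrow> real) \<Rightarrow> real \<Rightarrow> real" where
  "fill f x = (\<integral>t. (max 0 (minimum f + x - f t))\<^sup>2 \<partial>unit_lborel)"

section \<open>Comparing the cost of filling with the quadratic distance\<close>

lemma convex_on_affine_real:
  fixes g :: "real \<Rightarrow> real"
  assumes "convex_on S g" "0 \<le> c"
  shows "convex_on S (\<lambda>t. (g t - m) * c)"
proof -
  have cS: "convex S" using assms(1) by (rule convex_on_imp_convex)
  have "convex_on S (\<lambda>t. c * (g t + - m))"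
    using assms cS by (intro convex_on_cmul convex_on_add) (auto simp: convex_on_const)
  then show ?thesis by (simp add: mult.commute)
qed

lemma convex_on_reflect:
  fixes g :: "real \<Rightarrow> real"
  assumes cv: "convex_on {a..b} g"
  shows "convex_on {-b..-a} (\<lambda>t. g (- t))"
proof (rule convex_onI)
  fix t x y :: real assume *: "0 < t" "t < 1" "x \<in> {-b..-a}" "y \<in> {-b..-a}"
  have "g ((1 - t) *\<^sub>R (-x) + t *\<^sub>R (-y)) \<le> (1 - t) * g (-x) + t * g (-y)"
    using * by (intro convex_onD[OF cv]) auto
  then show "g (- ((1 - t) *\<^sub>R x + t *\<^sub>R y)) \<le> (1 - t) * g (- x) + t * g (- y)"
    by (simp add: algebra_simps)
qed simp

text \<open>Wherever \<open>v\<close> is outside (-1, 1), its distance from \<open>u \<ge> 0\<close>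
  is at least \<open>1 - u\<close>. On the stretches \<open>?B1\<close> and \<open>?B2\<close>,
  where \<open>v\<close> may pass between 1 and -1, at most 1 is lost pointwise. This is repaid on
  \<open>?G1\<close> and \<open>?G2\<close> next to \<open>Z\<close>, where
  \<open>v \<le> - (15/8)\<close> leaves a surplus. The depth 11/4 is large enough for this
  balance.\<close>

lemma fill_le_l2_dist_sq_normalized:
  assumes u: "bounded_measurable u" "\<And>t. t \<in> {0..1} \<Longrightarrow> 0 \<le> u t"
    and v: "convex_on {0..1} v" "bounded_measurable v" and Z: "Z \<in> {0..1}" "v Z = - (11/4)"
  shows "(\<integral>t. (max 0 (1 - u t))\<^sup>2 \<partial>unit_lborel) \<le> (\<integral>t. (u t - v t)\<^sup>2 \<partial>unit_lborel)"
proof -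
  have "convex_on {0..Z} v" by (rule convex_on_subset[OF v(1)]) (use Z in auto)
  then obtain q where q: "0 \<le> q" "q \<le> Z"
    "\<And>t. 0 \<le> t \<Longrightarrow> t < q - 8/7 * (Z - q) \<Longrightarrow> 1 \<le> v t"
    "\<And>t. q < t \<Longrightarrow> t \<le> Z \<Longrightarrow> v t \<le> -1"
    "\<And>t. (q + Z) / 2 < t \<Longrightarrow> t \<le> Z \<Longrightarrow> v t \<le> - (15/8)"
    using Z by (elim convex_descent) auto
  have "convex_on {Z..1} v" by (rule convex_on_subset[OF v(1)]) (use Z in auto)
  then have "convex_on {-1..-Z} (\<lambda>t. v (- t))" by (rule convex_on_reflect)
  then obtain p' where p': "-1 \<le> p'" "p' \<le> -Z"
    "\<And>t. -1 \<le> t \<Longrightarrow> t < p' - 8/7 * (-Z - p') \<Longrightarrow> 1 \<le> v (-t)"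
    "\<And>t. p' < t \<Longrightarrow> t \<le> -Z \<Longrightarrow> v (-t) \<le> -1"
    "\<And>t. (p' + -Z) / 2 < t \<Longrightarrow> t \<le> -Z \<Longrightarrow> v (-t) \<le> - (15/8)"
    using Z by (elim convex_descent) auto
  define p where "p = - p'"
  have p3: "1 \<le> v t" if "t \<le> 1" "t > p + 8/7 * (p - Z)" for t
  proof -
    have "- t < p' - 8/7 * (- Z - p')" using that by (simp add: p_def) argo
    then show ?thesis using p'(3)[of "-t"] that by simp
  qed
  have p: "p \<le> 1" "Z \<le> p"
    "\<And>t. t \<le> 1 \<Longrightarrow> t > p + 8/7 * (p - Z) \<Longrightarrow> 1 \<le> v t"
    "\<And>t. t < p \<Longrightarrow> Z \<le> t \<Longrightarrow> v t \<le> -1"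
    "\<And>t. t < (p + Z) / 2 \<Longrightarrow> Z \<le> t \<Longrightarrow> v t \<le> - (15/8)"
    using p'(1,2) p3 p'(4)[of "-t" for t] p'(5)[of "-t" for t]
    by (auto simp: p_def)
  let ?B1 = "{q - 8/7 * (Z - q)..q}" and ?B2 = "{p..p + 8/7 * (p - Z)}"
  let ?G1 = "{(q + Z) / 2<..<Z}" and ?G2 = "{Z<..<(p + Z) / 2}"
  \<comment> \<open>The least surplus \<open>(u + 15/8)\<^sup>2 - (max 0 (1 - u))\<^sup>2\<close>
    over \<open>u \<ge> 0\<close>, attained at \<open>u = 0\<close>.\<close>
  define c where "c = (15/8)\<^sup>2 - (1::real)"
  have c0: "0 \<le> c" by (simp add: c_def power2_eq_square)
  have pw: "(max 0 (1 - u t))\<^sup>2 + c * (indicator ?G1 t + indicator ?G2 t)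
      \<le> (u t - v t)\<^sup>2 + (indicator ?B1 t + indicator ?B2 t)" if t: "t \<in> {0..1}" for t
  proof -
    have u0: "0 \<le> u t" using u t by auto
    consider "t \<in> ?G1 \<union> ?G2" | "t \<notin> ?G1 \<union> ?G2" "t \<in> ?B1 \<union> ?B2"
      | "t \<notin> ?G1 \<union> ?G2" "t \<notin> ?B1 \<union> ?B2" by blast
    then show ?thesis
    proof cases
      case 1
      then have v1: "v t \<le> - (15/8)" using q(5) p(5) by auto
      have "indicator ?G1 t + indicator ?G2 t \<le> (1::real)" by (auto simp: indicator_def)
      then have "c * (indicator ?G1 t + indicator ?G2 t) \<le> c" using c0 by (simp add: mult_left_le)
      moreover have "(max 0 (1 - u t))\<^sup>2 + c \<le> (u t + 15/8)\<^sup>2"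
      proof (cases "u t \<le> 1")
        case True then show ?thesis using u0 by (simp add: c_def power2_eq_square algebra_simps)
      next
        case False
        then show ?thesis using u0 by (simp add: c_def power2_eq_square algebra_simps max_def)
      qed
      moreover have "(u t + 15/8)\<^sup>2 \<le> (u t - v t)\<^sup>2" using v1 u0 by (intro power_mono) auto
      moreover have "0 \<le> indicator ?B1 t + (indicator ?B2 t :: real)" by simp
      ultimately show ?thesis by linarith
    next
      case 2
      then have "1 \<le> indicator ?B1 t + (indicator ?B2 t :: real)" by (auto simp: indicator_def)
      moreover have "(max 0 (1 - u t))\<^sup>2 \<le> 1\<^sup>2" using u0 by (intro power_mono) auto
      moreover have "indicator ?G1 t + indicator ?G2 t = (0::real)" using 2 by (auto simp: indicator_def)
      ultimately show ?thesis by simp (smt (verit) zero_le_power2)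
    next
      case 3
      have "v t \<le> -1 \<or> 1 \<le> v t"
      proof (cases "t \<le> Z")
        case True
        then show ?thesis using 3 t q(3)[of t] q(4)[of t] by force
      next
        case False
        then show ?thesis using 3 t p(3)[of t] p(4)[of t] by force
      qed
      then have "max 0 (1 - u t) \<le> \<bar>u t - v t\<bar>" using u0 by auto
      then have "(max 0 (1 - u t))\<^sup>2 \<le> \<bar>u t - v t\<bar>\<^sup>2" by (intro power_mono) auto
      moreover have "indicator ?G1 t + indicator ?G2 t = (0::real)" using 3 by (auto simp: indicator_def)
      moreover have "indicator ?B1 t + indicator ?B2 t = (0::real)" using 3 by (auto simp: indicator_def)
      ultimately show ?thesis by simp
    qed
  qed
  note bm = bounded_measurable_intros u(1) v(2) bounded_measurable_indicator
  note ii = integrable_bounded_measurable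
  have le: "(\<integral>t. (max 0 (1 - u t))\<^sup>2 + c * (indicator ?G1 t + indicator ?G2 t) \<partial>unit_lborel)
      \<le> (\<integral>t. (u t - v t)\<^sup>2 + (indicator ?B1 t + indicator ?B2 t) \<partial>unit_lborel)"
    by (intro integral_mono ii bm) (use pw in auto)
  have e1: "(\<integral>t. (max 0 (1 - u t))\<^sup>2 + c * (indicator ?G1 t + indicator ?G2 t) \<partial>unit_lborel)
     = (\<integral>t. (max 0 (1 - u t))\<^sup>2 \<partial>unit_lborel)
      + c * ((\<integral>t. indicator ?G1 t \<partial>unit_lborel) + (\<integral>t. indicator ?G2 t \<partial>unit_lborel))"
    by (subst Bochner_Integration.integral_add Bochner_Integration.integral_mult_right_zero;
        (intro ii bm)?; simp?)+
  have e2: "(\<integral>t. (u t - v t)\<^sup>2 + (indicator ?B1 t + indicator ?B2 t) \<partial>unit_lborel)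
     = (\<integral>t. (u t - v t)\<^sup>2 \<partial>unit_lborel)
      + ((\<integral>t. indicator ?B1 t \<partial>unit_lborel) + (\<integral>t. indicator ?B2 t \<partial>unit_lborel))"
    by (subst Bochner_Integration.integral_add; (intro ii bm)?; simp?)+
  have g1: "(\<integral>t. indicator ?G1 t \<partial>unit_lborel) = (Z - q) / 2"
  proof -
    have "?G1 \<inter> {0..1} = ?G1" using q Z by auto
    then show ?thesis using q by (subst integral_indicator_unit) (auto simp: field_simps)
  qed
  have g2: "(\<integral>t. indicator ?G2 t \<partial>unit_lborel) = (p - Z) / 2"
  proof -
    have "?G2 \<inter> {0..1} = ?G2" using p Z by auto
    then show ?thesis using p by (subst integral_indicator_unit) (auto simp: field_simps)
  qed
  have b1: "(\<integral>t. indicator ?B1 t \<partial>unit_lborel) \<le> q - (q - 8/7 * (Z - q))"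
    using q by (intro integral_indicator_unit_le) auto
  have b2: "(\<integral>t. indicator ?B2 t \<partial>unit_lborel) \<le> (p + 8/7 * (p - Z)) - p"
    using p by (intro integral_indicator_unit_le) auto
  \<comment> \<open>\<open>c / 2 = 161/128\<close> exceeds 8/7: on each side, the half of the
    descent next to \<open>Z\<close> repays the crossing.\<close>
  have cc: "8/7 * (Z - q) \<le> c * ((Z - q) / 2)" "8/7 * (p - Z) \<le> c * ((p - Z) / 2)"
    using q p by (auto simp: c_def power2_eq_square)
  show ?thesis using le[unfolded e1 e2 g1 g2, unfolded distrib_left] b1 b2 cc by linarith
qed

text \<open>As \<open>f\<close> lies above its minimum, multiplying the level by \<open>r\<close>
  multiplies each deficit by at least \<open>r\<close>. This quadratic growth turns a bound on
  \<open>fill f m\<close> into a bound on \<open>m\<close> that is linear in the distance.\<close>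

lemma fill_scale:
  assumes f: "f \<in> convex_class" and "1 \<le> r" "0 \<le> x"
  shows "r\<^sup>2 * fill f x \<le> fill f (r * x)"
proof -
  note bm = bounded_measurable_intros convex_class_bounded_measurable[OF f]
  have "r\<^sup>2 * fill f x = (\<integral>t. (r * max 0 (minimum f + x - f t))\<^sup>2 \<partial>unit_lborel)"
    by (simp add: fill_def power_mult_distrib)
  also have "\<dots> \<le> fill f (r * x)" unfolding fill_def
  proof (intro integral_mono integrable_bounded_measurable bm power_mono)
    fix t assume "t \<in> space unit_lborel"
    then have "minimum f \<le> f t" using convex_class_minimizer(4)[OF f] by simp
    then have "0 \<le> (r - 1) * (f t - minimum f)" using assms by auto
    then show "r * max 0 (minimum f + x - f t) \<le> max 0 (minimum f + r * x - f t)"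
      using assms by (auto simp: max_def algebra_simps)
    show "0 \<le> r * max 0 (minimum f + x - f t)" using assms by simp
  qed
  finally show ?thesis .
qed

lemma fill_mono:
  assumes f: "f \<in> convex_class" and "x \<le> y"
  shows "fill f x \<le> fill f y"
  unfolding fill_def using assms(2) convex_class_bounded_measurable[OF f]
  by (intro integral_mono integrable_bounded_measurable bounded_measurable_intros power_mono) auto

text \<open>If \<open>g\<close> has the higher minimum, it lies above that level everywhere, and the
  bound holds with factor 1. If \<open>g\<close> dips below the minimum of \<open>f\<close>, the two
  graphs may cross, and the factor 4/11 is the price: the dip is 11/4 times the level to which
  \<open>f\<close> is filled.\<close>

lemma fill_le_l2_dist_sq:
  assumes f: "f \<in> convex_class" and g: "g \<in> convex_class"
  shows "fill f (4/11 * \<bar>minimum f - minimum g\<bar>) \<le> l2_dist_sq f g"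
proof (cases "minimum g < minimum f")
  case True
  define x where "x = 4/11 * (minimum f - minimum g)"
  have x: "0 < x" using True by (simp add: x_def)
  define u where "u = (\<lambda>t. (f t - minimum f) * (1/x))"
  define v where "v = (\<lambda>t. (g t - minimum f) * (1/x))"
  note bm = bounded_measurable_intros convex_class_bounded_measurable[OF f]
    convex_class_bounded_measurable[OF g]
  have "(\<integral>t. (max 0 (1 - u t))\<^sup>2 \<partial>unit_lborel) \<le> (\<integral>t. (u t - v t)\<^sup>2 \<partial>unit_lborel)"
  proof (rule fill_le_l2_dist_sq_normalized[where Z="minimizer g"])
    show "bounded_measurable u" "bounded_measurable v" unfolding u_def v_def by (intro bm)+
    show "convex_on {0..1} v" unfolding v_def
      using x convex_class_minimizer[OF g] by (intro convex_on_affine_real) auto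
    show "v (minimizer g) = - (11/4)"
      using x convex_class_minimizer(3)[OF g] by (simp add: v_def x_def field_simps)
    show "minimizer g \<in> {0..1}" using convex_class_minimizer[OF g] by simp
    show "0 \<le> u t" if "t \<in> {0..1}" for t
      using x convex_class_minimizer(4)[OF f that] by (simp add: u_def)
  qed
  then have "x\<^sup>2 * (\<integral>t. (max 0 (1 - u t))\<^sup>2 \<partial>unit_lborel) \<le> x\<^sup>2 * (\<integral>t. (u t - v t)\<^sup>2 \<partial>unit_lborel)"
    by (intro mult_left_mono) auto
  also have "x\<^sup>2 * (\<integral>t. (max 0 (1 - u t))\<^sup>2 \<partial>unit_lborel) = (\<integral>t. (x * max 0 (1 - u t))\<^sup>2 \<partial>unit_lborel)"
    by (simp add: power_mult_distrib)
  also have "\<dots> = fill f x"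
  proof -
    have "x * (1 - u t) = minimum f + x - f t" for t
      using x by (simp add: u_def algebra_simps)
    then have "x * max 0 (1 - u t) = max 0 (minimum f + x - f t)" for t
      using x by (simp add: max_mult_distrib_left)
    then show ?thesis by (simp add: fill_def)
  qed
  also have "x\<^sup>2 * (\<integral>t. (u t - v t)\<^sup>2 \<partial>unit_lborel) = (\<integral>t. (x * (u t - v t))\<^sup>2 \<partial>unit_lborel)"
    by (simp add: power_mult_distrib)
  also have "\<dots> = l2_dist_sq f g"
  proof -
    have "x * (u t - v t) = f t - g t" for t
      using x by (simp add: u_def v_def field_simps)
    then show ?thesis by (simp add: l2_dist_sq_def)
  qed
  finally show ?thesis using True by (simp add: x_def)
next
  case False
  have "fill f (4/11 * \<bar>minimum f - minimum g\<bar>) \<le> fill f (minimum g - minimum f)"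
    using False by (intro fill_mono f) auto
  also have "\<dots> \<le> l2_dist_sq f g"
    unfolding fill_def l2_dist_sq_def
  proof (intro integral_mono integrable_bounded_measurable bounded_measurable_intros
      convex_class_bounded_measurable f g)
    fix t assume "t \<in> space unit_lborel"
    then have "minimum g \<le> g t" using convex_class_minimizer(4)[OF g] by simp
    then have "max 0 (minimum f + (minimum g - minimum f) - f t) \<le> \<bar>f t - g t\<bar>" by auto
    then have "(max 0 (minimum f + (minimum g - minimum f) - f t))\<^sup>2 \<le> \<bar>f t - g t\<bar>\<^sup>2"
      by (intro power_mono) auto
    then show "(max 0 (minimum f + (minimum g - minimum f) - f t))\<^sup>2 \<le> (f t - g t)\<^sup>2" by simp
  qed
  finally show ?thesis .
qed

lemma exists_fill_eq:
  assumes f: "f \<in> convex_class" and v: "0 < v"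
  shows "\<exists>x>0. fill f x = v"
proof -
  let ?m = "minimum f"
  note bm = bounded_measurable_intros convex_class_bounded_measurable[OF f]
  note ii = integrable_bounded_measurable
  have lip: "fill f y - fill f x \<le> 2 * y * (y - x)" if "0 \<le> x" "x \<le> y" for x y
  proof -
    have "fill f y - fill f x = (\<integral>t. (max 0 (?m + y - f t))\<^sup>2 - (max 0 (?m + x - f t))\<^sup>2 \<partial>unit_lborel)"
      unfolding fill_def by (intro Bochner_Integration.integral_diff[symmetric] ii bm)
    also have "\<dots> \<le> (\<integral>t. 2 * y * (y - x) \<partial>unit_lborel)"
    proof (intro integral_mono ii bm)
      fix t assume "t \<in> space unit_lborel"
      then have mt: "?m \<le> f t" using convex_class_minimizer(4)[OF f] by simp
      let ?b = "max 0 (?m + y - f t)" and ?a = "max 0 (?m + x - f t)"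
      have "?b\<^sup>2 - ?a\<^sup>2 = (?b + ?a) * (?b - ?a)" by (simp add: power2_eq_square algebra_simps)
      also have "\<dots> \<le> (2 * y) * (y - x)" using that mt by (intro mult_mono) auto
      finally show "?b\<^sup>2 - ?a\<^sup>2 \<le> 2 * y * (y - x)" by simp
    qed
    finally show ?thesis using U.prob_space by simp
  qed
  obtain B where B: "\<forall>t\<in>{0..1}. \<bar>f t\<bar> \<le> B"
    using convex_class_bounded_measurable[OF f] by (auto simp: bounded_measurable_def)
  \<comment> \<open>At this level each deficit is at least \<open>sqrt v\<close>, so the
    intermediate value theorem applies between 0 and \<open>Y\<close>.\<close>
  define Y where "Y = 2 * B + sqrt v"
  have mB: "?m \<ge> - B" using B convex_class_minimizer(2,3)[OF f] by (auto simp: abs_le_iff dest!: bspec[of _ _ "minimizer f"])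
  have B0: "0 \<le> B" using bspec[OF B, of 0] by auto
  have Y0: "0 \<le> Y" using B0 v by (simp add: Y_def)
  have "v = (\<integral>t. (sqrt v)\<^sup>2 \<partial>unit_lborel)" using v U.prob_space by simp
  also have "\<dots> \<le> fill f Y" unfolding fill_def
  proof (intro integral_mono ii bm power_mono)
    fix t assume "t \<in> space unit_lborel"
    then have "f t \<le> B" using B by (auto simp: abs_le_iff)
    then show "sqrt v \<le> max 0 (?m + Y - f t)" using mB by (simp add: Y_def)
  qed (use v in auto)
  finally have top: "v \<le> fill f Y" .
  have "fill f 0 \<le> (\<integral>t. 0 \<partial>unit_lborel)" unfolding fill_def
  proof (intro integral_mono ii bm)
    fix t assume "t \<in> space unit_lborel"
    then show "(max 0 (?m + 0 - f t))\<^sup>2 \<le> 0" using convex_class_minimizer(4)[OF f, of t] by auto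
  qed
  then have bot: "fill f 0 \<le> 0" by simp
  have "(2 * Y)-lipschitz_on {0..Y} (fill f)"
  proof (rule lipschitz_onI)
    fix x y assume xy: "x \<in> {0..Y}" "y \<in> {0..Y}"
    have *: "\<bar>fill f a - fill f b\<bar> \<le> 2 * Y * \<bar>a - b\<bar>" if "0 \<le> a" "a \<le> b" "b \<le> Y" for a b
    proof -
      have "fill f a \<le> fill f b" using that by (intro fill_mono f)
      moreover have "2 * b * (b - a) \<le> 2 * Y * (b - a)" using that by (intro mult_right_mono) auto
      ultimately show ?thesis using lip[of a b] that by simp
    qed
    show "dist (fill f x) (fill f y) \<le> 2 * Y * dist x y"
      using *[of x y] *[of y x] xy by (cases "x \<le> y") (auto simp: dist_real_def abs_minus_commute)
  qed (use Y0 in auto)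
  then have "continuous_on {0..Y} (fill f)" by (rule lipschitz_on_continuous_on)
  then obtain x where x: "0 \<le> x" "x \<le> Y" "fill f x = v"
    using IVT'[of "fill f" 0 v Y] top bot v Y0 by auto
  then have "x \<noteq> 0" using bot v by auto
  then show ?thesis using x by (intro exI[of _ x]) auto
qed

section \<open>A chi-square inequality and Gaussian tails\<close>

text \<open>The square of \<open>\<phi>\<close> on the right-hand side is what makes the inequality stable under products.\<close>

definition chi_bound :: "'a measure \<Rightarrow> 'a measure \<Rightarrow> ennreal \<Rightarrow> bool" where
  "chi_bound M N C \<longleftrightarrow> (\<forall>\<phi>\<in>borel_measurable M. (\<integral>\<^sup>+x. \<phi> x \<partial>N)\<^sup>2 \<le> C * (\<integral>\<^sup>+x. (\<phi> x)\<^sup>2 \<partial>M))"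

text \<open>Cauchy-Schwarz for \<open>\<phi> * q\<close> as the product of
  \<open>\<phi> * sqrt p\<close> and \<open>q / sqrt p\<close>. Completing the square shows that
  \<open>q\<^sup>2 / p\<close> is \<open>exp ((b - a)\<^sup>2 / \<sigma>\<^sup>2)\<close> times the
  normal density centred at \<open>2 * b - a\<close>, which has mass 1.\<close>

lemma chi_bound_normal:
  assumes s: "0 < \<sigma>"
  shows "chi_bound (density lborel (normal_density a \<sigma>)) (density lborel (normal_density b \<sigma>))
    (ennreal (exp ((b - a)\<^sup>2 / \<sigma>\<^sup>2)))"
  unfolding chi_bound_def
proof
  fix \<phi> :: "real \<Rightarrow> ennreal"
  assume "\<phi> \<in> borel_measurable (density lborel (normal_density a \<sigma>))"
  then have [measurable]: "\<phi> \<in> borel_measurable borel" by simp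
  define p where "p = normal_density a \<sigma>"
  define q where "q = normal_density b \<sigma>"
  have pos: "0 < p x" "0 < q x" for x
    using s by (auto simp: p_def q_def normal_density_pos)
  have [measurable]: "p \<in> borel_measurable borel" "q \<in> borel_measurable borel"
    by (auto simp: p_def q_def)
  have ratio: "(q x / sqrt (p x))\<^sup>2 = exp ((b - a)\<^sup>2 / \<sigma>\<^sup>2) * normal_density (2 * b - a) \<sigma> x" for x
  proof -
    define k where "k = 1 / sqrt (2 * pi * \<sigma>\<^sup>2)"
    have k: "k \<noteq> 0" using s by (simp add: k_def)
    have "(q x / sqrt (p x))\<^sup>2 = (q x)\<^sup>2 / p x" using pos[of x] by (simp add: power_divide)
    also have "\<dots> = k * (exp (-(x - b)\<^sup>2 / (2 * \<sigma>\<^sup>2)) * exp (-(x - b)\<^sup>2 / (2 * \<sigma>\<^sup>2)) / exp (-(x - a)\<^sup>2 / (2 * \<sigma>\<^sup>2)))"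
      using k unfolding p_def q_def normal_density_def k_def[symmetric]
      by (simp add: power2_eq_square)
    also have "exp (-(x - b)\<^sup>2 / (2 * \<sigma>\<^sup>2)) * exp (-(x - b)\<^sup>2 / (2 * \<sigma>\<^sup>2)) / exp (-(x - a)\<^sup>2 / (2 * \<sigma>\<^sup>2))
      = exp ((b - a)\<^sup>2 / \<sigma>\<^sup>2) * exp (-(x - (2 * b - a))\<^sup>2 / (2 * \<sigma>\<^sup>2))"
      unfolding exp_add[symmetric] exp_diff[symmetric]
      using s by (intro arg_cong[where f=exp]) (simp add: field_simps power2_eq_square)
    finally show ?thesis by (simp add: normal_density_def k_def)
  qed
  have "(\<integral>\<^sup>+x. \<phi> x \<partial>density lborel q) = (\<integral>\<^sup>+x. ennreal (q x) * \<phi> x \<partial>lborel)"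
    by (subst nn_integral_density) auto
  also have "\<dots> = (\<integral>\<^sup>+x. (\<phi> x * ennreal (sqrt (p x))) * ennreal (q x / sqrt (p x)) \<partial>lborel)"
  proof (intro nn_integral_cong)
    fix x
    have "ennreal (sqrt (p x)) * ennreal (q x / sqrt (p x)) = ennreal (q x)"
      using pos[of x] by (simp flip: ennreal_mult)
    then show "ennreal (q x) * \<phi> x = (\<phi> x * ennreal (sqrt (p x))) * ennreal (q x / sqrt (p x))"
      by (metis mult.assoc mult.commute)
  qed
  finally have "(\<integral>\<^sup>+x. \<phi> x \<partial>density lborel q)\<^sup>2
    \<le> (\<integral>\<^sup>+x. (\<phi> x * ennreal (sqrt (p x)))\<^sup>2 \<partial>lborel) * (\<integral>\<^sup>+x. (ennreal (q x / sqrt (p x)))\<^sup>2 \<partial>lborel)"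
    by (simp only:) (rule Cauchy_Schwarz_nn_integral; measurable)
  also have "(\<integral>\<^sup>+x. (\<phi> x * ennreal (sqrt (p x)))\<^sup>2 \<partial>lborel) = (\<integral>\<^sup>+x. (\<phi> x)\<^sup>2 \<partial>density lborel p)"
  proof -
    have "(\<phi> x * ennreal (sqrt (p x)))\<^sup>2 = ennreal (p x) * (\<phi> x)\<^sup>2" for x
      using pos[of x] by (simp add: power_mult_distrib ennreal_power mult.commute)
    then show ?thesis by (subst nn_integral_density) auto
  qed
  also have "(\<integral>\<^sup>+x. (ennreal (q x / sqrt (p x)))\<^sup>2 \<partial>lborel)
     = ennreal (exp ((b - a)\<^sup>2 / \<sigma>\<^sup>2)) * (\<integral>\<^sup>+x. normal_density (2 * b - a) \<sigma> x \<partial>lborel)"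
  proof -
    have "(ennreal (q x / sqrt (p x)))\<^sup>2 = ennreal (exp ((b - a)\<^sup>2 / \<sigma>\<^sup>2)) * ennreal (normal_density (2 * b - a) \<sigma> x)" for x
      using pos[of x] ratio[of x] by (simp add: ennreal_power flip: ennreal_mult)
    then show ?thesis by (simp add: nn_integral_cmult)
  qed
  also have "(\<integral>\<^sup>+x. normal_density (2 * b - a) \<sigma> x \<partial>lborel) = 1"
    using s by (subst nn_integral_eq_integral) auto
  finally show "(\<integral>\<^sup>+x. \<phi> x \<partial>density lborel (normal_density b \<sigma>))\<^sup>2
    \<le> ennreal (exp ((b - a)\<^sup>2 / \<sigma>\<^sup>2)) * (\<integral>\<^sup>+x. (\<phi> x)\<^sup>2 \<partial>density lborel (normal_density a \<sigma>))"
    by (simp add: p_def q_def mult.commute)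
qed

text \<open>The induction hypothesis, applied to the integral over the new coordinate, leaves the
  square of that integral under the remaining one: exactly the form that the bound for the new
  coordinate accepts.\<close>

lemma chi_bound_PiM:
  assumes fin: "finite I"
    and M: "\<And>i. prob_space (M i)" and N: "\<And>i. prob_space (N i)"
    and sets: "\<And>i. sets (M i) = sets (N i)"
    and chi: "\<And>i. i \<in> I \<Longrightarrow> chi_bound (M i) (N i) (C i)"
  shows "chi_bound (PiM I M) (PiM I N) (\<Prod>i\<in>I. C i)"
  using fin chi
proof (induction I)
  case empty
  then show ?case by (auto simp: chi_bound_def PiM_empty nn_integral_count_space_finite)
next
  case (insert i I)
  interpret M: product_sigma_finite M
    by (simp add: product_sigma_finite_def prob_space_imp_sigma_finite[OF M])
  interpret N: product_sigma_finite N
    by (simp add: product_sigma_finite_def prob_space_imp_sigma_finite[OF N])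
  have chiI: "chi_bound (PiM I M) (PiM I N) (\<Prod>i\<in>I. C i)" using insert by auto
  have chii: "chi_bound (M i) (N i) (C i)" using insert by auto
  have sP: "sets (PiM J M) = sets (PiM J N)" for J by (rule sets_PiM_cong) (auto simp: sets)
  show ?case unfolding chi_bound_def
  proof
    fix \<phi> :: "_ \<Rightarrow> ennreal" assume [measurable]: "\<phi> \<in> borel_measurable (PiM (insert i I) M)"
    then have \<phi>N: "\<phi> \<in> borel_measurable (PiM (insert i I) N)"
      using measurable_cong_sets[OF sP refl] by blast
    have [measurable]: "(\<lambda>x. \<integral>\<^sup>+y. \<phi> (x(i := y)) \<partial>N i) \<in> borel_measurable (PiM I N)"
      using \<phi>N by measurable
    then have [measurable]: "(\<lambda>x. \<integral>\<^sup>+y. \<phi> (x(i := y)) \<partial>N i) \<in> borel_measurable (PiM I M)"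
      using measurable_cong_sets[OF sP refl] by blast
    have "(\<integral>\<^sup>+x. \<phi> x \<partial>PiM (insert i I) N)\<^sup>2 = (\<integral>\<^sup>+x. (\<integral>\<^sup>+y. \<phi> (x(i := y)) \<partial>N i) \<partial>PiM I N)\<^sup>2"
      using insert \<phi>N by (subst N.product_nn_integral_insert) auto
    also have "\<dots> \<le> (\<Prod>i\<in>I. C i) * (\<integral>\<^sup>+x. (\<integral>\<^sup>+y. \<phi> (x(i := y)) \<partial>N i)\<^sup>2 \<partial>PiM I M)"
      using chiI unfolding chi_bound_def by (rule bspec) measurable
    also have "(\<integral>\<^sup>+x. (\<integral>\<^sup>+y. \<phi> (x(i := y)) \<partial>N i)\<^sup>2 \<partial>PiM I M)
        \<le> (\<integral>\<^sup>+x. C i * (\<integral>\<^sup>+y. (\<phi> (x(i := y)))\<^sup>2 \<partial>M i) \<partial>PiM I M)"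
    proof (intro nn_integral_mono)
      fix x assume "x \<in> space (PiM I M)"
      then have "(\<lambda>y. \<phi> (x(i := y))) \<in> borel_measurable (M i)" by measurable
      then show "(\<integral>\<^sup>+y. \<phi> (x(i := y)) \<partial>N i)\<^sup>2 \<le> C i * (\<integral>\<^sup>+y. (\<phi> (x(i := y)))\<^sup>2 \<partial>M i)"
        using chii unfolding chi_bound_def by blast
    qed
    also have "(\<integral>\<^sup>+x. C i * (\<integral>\<^sup>+y. (\<phi> (x(i := y)))\<^sup>2 \<partial>M i) \<partial>PiM I M)
       = C i * (\<integral>\<^sup>+x. (\<integral>\<^sup>+y. (\<phi> (x(i := y)))\<^sup>2 \<partial>M i) \<partial>PiM I M)"
      by (intro nn_integral_cmult) measurable
    also have "(\<integral>\<^sup>+x. (\<integral>\<^sup>+y. (\<phi> (x(i := y)))\<^sup>2 \<partial>M i) \<partial>PiM I M) = (\<integral>\<^sup>+x. (\<phi> x)\<^sup>2 \<partial>PiM (insert i I) M)"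
      using insert by (subst M.product_nn_integral_insert) auto
    finally show "(\<integral>\<^sup>+x. \<phi> x \<partial>PiM (insert i I) N)\<^sup>2
      \<le> (\<Prod>i\<in>insert i I. C i) * (\<integral>\<^sup>+x. (\<phi> x)\<^sup>2 \<partial>PiM (insert i I) M)"
      using insert by (simp add: mult_left_mono mult.assoc mult.left_commute)
  qed
qed

text \<open>The sets that can be approximated under both measures at once form a \<sigma>-algebra:
  complements keep the symmetric difference, and a countable union is cut off after \<open>n\<close>
  sets, with one \<open>n\<close> for both measures, before each of these is approximated.\<close>

lemma measurable_approx_by_algebra:
  assumes G: "algebra \<Omega> G" and sets: "sets M = sigma_sets \<Omega> G" "sets N = sigma_sets \<Omega> G"
    and fin: "finite_measure M" "finite_measure N"
    and A: "A \<in> sigma_sets \<Omega> G" and e: "0 < e"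
  shows "\<exists>B\<in>G. measure M (sym_diff A B) < e \<and> measure N (sym_diff A B) < e"
  using A e
proof (induction arbitrary: e rule: sigma_sets.induct)
  case (Basic a)
  then show ?case by (intro bexI[of _ a]) auto
next
  case Empty
  interpret algebra \<Omega> G by fact
  show ?case using Empty by (intro bexI[of _ "{}"]) auto
next
  case (Compl a)
  then obtain B where B: "B \<in> G" "measure M (sym_diff a B) < e" "measure N (sym_diff a B) < e"
    by blast
  interpret algebra \<Omega> G by fact
  have "a \<subseteq> \<Omega>" "B \<subseteq> \<Omega>"
    using sigma_sets_into_sp[OF space_closed Compl(1)] B(1) space_closed by auto
  then have "sym_diff (\<Omega> - a) (\<Omega> - B) = sym_diff a B" by auto
  then show ?case using B algebra.compl_sets[OF G B(1)] by (intro bexI[of _ "\<Omega> - B"]) auto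
next
  case (Union a)
  interpret M: finite_measure M by fact
  interpret N: finite_measure N by fact
  let ?U = "\<Union>i. a i"
  have aM: "a i \<in> sets M" "a i \<in> sets N" for i using Union(1) sets by auto
  have tail: "(\<lambda>n. measure L (\<Union>i<n. a i)) \<longlonglongrightarrow> measure L ?U"
    if L: "finite_measure L" "sets L = sigma_sets \<Omega> G" for L :: "'a measure"
  proof -
    interpret L: finite_measure L by fact
    have "(\<lambda>n. measure L (\<Union>i<n. a i)) \<longlonglongrightarrow> measure L (\<Union>n. \<Union>i<n. a i)"
      by (rule L.finite_Lim_measure_incseq) (use Union(1) L in \<open>auto simp: incseq_def intro!: sets.finite_UN, force\<close>)
    moreover have "(\<Union>n. \<Union>i<n. a i) = ?U" by auto
    ultimately show ?thesis by simp
  qed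
  have "\<forall>\<^sub>F n in sequentially. measure M ?U - e / 2 < measure M (\<Union>i<n. a i)"
    using tail[OF fin(1) sets(1)] Union.prems by (intro order_tendstoD) auto
  moreover have "\<forall>\<^sub>F n in sequentially. measure N ?U - e / 2 < measure N (\<Union>i<n. a i)"
    using tail[OF fin(2) sets(2)] Union.prems by (intro order_tendstoD) auto
  ultimately have "\<forall>\<^sub>F n in sequentially. measure M ?U - e / 2 < measure M (\<Union>i<n. a i) \<and>
      measure N ?U - e / 2 < measure N (\<Union>i<n. a i)" by eventually_elim auto
  then obtain n where n: "measure M ?U - e / 2 < measure M (\<Union>i<n. a i)"
      "measure N ?U - e / 2 < measure N (\<Union>i<n. a i)"
    by (auto dest: eventually_happens)
  \<comment> \<open>The denominator has \<open>n + 1\<close> because \<open>n\<close> may be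
    0.\<close>
  define d where "d = e / (2 * (real n + 1))"
  have d: "0 < d" "real n * d \<le> e / 2" using Union.prems by (auto simp: d_def field_simps)
  have "\<forall>i. \<exists>B\<in>G. measure M (sym_diff (a i) B) < d \<and> measure N (sym_diff (a i) B) < d"
    using Union(2) d(1) by blast
  then obtain B where B: "\<And>i. B i \<in> G" "\<And>i. measure M (sym_diff (a i) (B i)) < d"
    "\<And>i. measure N (sym_diff (a i) (B i)) < d" by metis
  let ?B = "\<Union>i<n. B i"
  have BG: "?B \<in> G"
    using ring_of_sets.finite_UN[of \<Omega> G "{..<n}" B] B(1) algebra.axioms(1)[OF G] by auto
  have bound: "measure L (sym_diff ?U ?B) < e"
    if L: "finite_measure L" "sets L = sigma_sets \<Omega> G" "measure L ?U - e / 2 < measure L (\<Union>i<n. a i)"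
      "\<And>i. measure L (sym_diff (a i) (B i)) < d" for L :: "'a measure"
  proof -
    interpret L: finite_measure L by fact
    have s[measurable]: "a i \<in> sets L" "B i \<in> sets L" for i
      using Union(1) L(2) B(1) by auto
    have "measure L (sym_diff ?U ?B) \<le> measure L ((?U - (\<Union>i<n. a i)) \<union> (\<Union>i<n. sym_diff (a i) (B i)))"
      by (intro L.finite_measure_mono) auto
    also have "\<dots> \<le> measure L (?U - (\<Union>i<n. a i)) + measure L (\<Union>i<n. sym_diff (a i) (B i))"
      by (intro measure_Un_le) auto
    also have "measure L (\<Union>i<n. sym_diff (a i) (B i)) \<le> (\<Sum>i<n. measure L (sym_diff (a i) (B i)))"
      by (intro L.finite_measure_subadditive_finite) auto
    also have "\<dots> \<le> (\<Sum>i<n. d)" using L(4) by (intro sum_mono) (auto intro: less_imp_le)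
    also have "\<dots> \<le> e / 2" using d(2) by simp
    also have "measure L (?U - (\<Union>i<n. a i)) = measure L ?U - measure L (\<Union>i<n. a i)"
      by (intro L.finite_measure_Diff) auto
    finally show ?thesis using L(3) by linarith
  qed
  show ?case
    using bound[OF fin(1) sets(1) n(1) B(2)] bound[OF fin(2) sets(2) n(2) B(3)] BG by blast
qed

lemma measurable_approx_by_cylinder:
  assumes M: "prob_space M" and N: "prob_space N"
    and sets: "sets M = sets (PiM I S)" "sets N = sets (PiM I S)"
    and A: "A \<in> sets (PiM I S)" and e: "0 < e"
  obtains J B where "finite J" "J \<subseteq> I" "B \<in> sets (PiM J S)"
    "measure M (sym_diff A (prod_emb I S J B)) < e" "measure N (sym_diff A (prod_emb I S J B)) < e"
proof -
  interpret M: prob_space M by fact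
  interpret N: prob_space N by fact
  have mM: "(\<lambda>x. restrict x J) \<in> measurable M (PiM J S)" if "J \<subseteq> I" for J
    using measurable_restrict_subset[OF that] measurable_cong_sets[OF sets(1) refl] by blast
  \<comment> \<open>The marginals of \<open>M\<close> give access to the cylinder algebra
    \<open>generator\<close>, which itself involves only \<open>I\<close> and
    \<open>S\<close>.\<close>
  interpret projective_family I "\<lambda>J. distr M (PiM J S) (\<lambda>x. restrict x J)" S
  proof (rule projective_family.intro)
    fix J H assume *: "J \<subseteq> H" "finite H" "H \<subseteq> I"
    then show "distr M (PiM J S) (\<lambda>x. restrict x J)
      = distr (distr M (PiM H S) (\<lambda>x. restrict x H)) (PiM J S) (\<lambda>f. restrict f J)"
      by (subst distr_distr) (auto simp: comp_def restrict_restrict Int_absorb1 intro!: mM measurable_restrict_subset)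
  next
    fix J assume "finite J" "J \<subseteq> I"
    then show "prob_space (distr M (PiM J S) (\<lambda>x. restrict x J))"
      by (intro M.prob_space_distr mM)
  qed
  have gen: "sets M = sigma_sets (space (PiM I S)) generator" "sets N = sigma_sets (space (PiM I S)) generator"
    using sets sets_PiM_generator by auto
  have "\<exists>B\<in>generator. measure M (sym_diff A B) < e \<and> measure N (sym_diff A B) < e"
    using A by (intro measurable_approx_by_algebra[OF algebra_generator gen M.finite_measure_axioms N.finite_measure_axioms _ e])
      (simp add: sets_PiM_generator)
  then show ?thesis using that by (auto elim!: generator.cases)
qed

text \<open>The bound for events passes to \<open>\<phi>\<close> through its level sets:
  \<open>\<psi>\<close> averages the indicators of \<open>k \<le> n * \<phi>\<close>, the square of
  an average is at most the average of the squares, and \<open>\<psi>\<close> lies at most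
  \<open>1 / n\<close> below \<open>\<phi>\<close>.\<close>

lemma sq_le_of_layers:
  fixes C :: real
  assumes M: "prob_space M" and N: "prob_space N" and sets: "sets N = sets M"
    and C: "0 \<le> C"
    and bound: "\<And>A. A \<in> sets M \<Longrightarrow> (measure N A)\<^sup>2 \<le> C * measure M A"
    and [measurable]: "\<phi> \<in> borel_measurable M" and range: "\<And>x. x \<in> space M \<Longrightarrow> 0 \<le> \<phi> x \<and> \<phi> x \<le> 1"
  shows "(\<integral>x. \<phi> x \<partial>N)\<^sup>2 \<le> C * (\<integral>x. \<phi> x \<partial>M)"
proof -
  interpret M: prob_space M by fact
  interpret N: prob_space N by fact
  have sp: "space N = space M" using sets by (rule sets_eq_imp_space_eq)
  have [measurable]: "\<phi> \<in> borel_measurable N" using measurable_cong_sets[OF sets refl] assms(6) by blast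
  have iM: "integrable M \<phi>" and iN: "integrable N \<phi>"
    using range by (auto intro!: M.integrable_const_bound[where B=1] N.integrable_const_bound[where B=1] simp: sp)
  have step: "((\<integral>x. \<phi> x \<partial>N) - 1 / real n)\<^sup>2 \<le> C * (\<integral>x. \<phi> x \<partial>M) \<or> (\<integral>x. \<phi> x \<partial>N) < 1 / real n"
    if n: "0 < n" for n :: nat
  proof -
    define A where "A = (\<lambda>k. {x \<in> space M. real k \<le> real n * \<phi> x})"
    have A: "A k \<in> sets M" "A k \<in> sets N" for k by (auto simp: A_def sets)
    define \<psi> where "\<psi> = (\<lambda>x. (\<Sum>k\<in>{1..n}. indicator (A k) x) / real n)"
    have pw: "\<psi> x \<le> \<phi> x" "\<phi> x - 1 / real n \<le> \<psi> x" if x: "x \<in> space M" for x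
    proof -
      let ?y = "real n * \<phi> x"
      have y: "0 \<le> ?y" "?y \<le> real n" using range[OF x] by (auto simp: mult_left_le)
      have "{k \<in> {1..n}. real k \<le> ?y} = {1..nat \<lfloor>?y\<rfloor>}"
        using y by (auto simp: le_nat_floor nat_le_iff floor_le_iff le_nat_iff le_floor_iff)
      then have "(\<Sum>k\<in>{1..n}. indicator (A k) x) = real (nat \<lfloor>?y\<rfloor>)"
        using x by (simp add: A_def indicator_def sum.If_cases Int_def cong: conj_cong)
      then have \<psi>: "\<psi> x = real (nat \<lfloor>?y\<rfloor>) / real n" by (simp add: \<psi>_def)
      have "real (nat \<lfloor>?y\<rfloor>) \<le> ?y" "?y - 1 \<le> real (nat \<lfloor>?y\<rfloor>)" using y by linarith+
      moreover have "\<phi> x = ?y / real n" "\<phi> x - 1 / real n = (?y - 1) / real n"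
        using n by (auto simp: field_simps)
      ultimately show "\<psi> x \<le> \<phi> x" "\<phi> x - 1 / real n \<le> \<psi> x"
        unfolding \<psi> by (metis divide_right_mono of_nat_0_le_iff)+
    qed
    have iA: "(\<integral>x. \<psi> x \<partial>L) = (\<Sum>k\<in>{1..n}. measure L (A k)) / real n" "integrable L \<psi>"
      if "finite_measure L" "\<And>k. A k \<in> sets L" for L
    proof -
      interpret L: finite_measure L by fact
      have "integrable L (indicator (A k) :: _ \<Rightarrow> real)" for k using that by (simp add: L.emeasure_finite less_top[symmetric])
      then show "(\<integral>x. \<psi> x \<partial>L) = (\<Sum>k\<in>{1..n}. measure L (A k)) / real n" "integrable L \<psi>"
        using that(2)[THEN sets.sets_into_space] by (simp_all add: \<psi>_def Int_absorb1 Int_absorb2)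
    qed
    note iAM = iA[OF M.finite_measure_axioms A(1)] and iAN = iA[OF N.finite_measure_axioms A(2)]
    have "(\<integral>x. \<psi> x \<partial>N)\<^sup>2 = (\<Sum>k\<in>{1..n}. measure N (A k))\<^sup>2 / (real n)\<^sup>2"
      by (simp add: iAN power_divide)
    also have "\<dots> \<le> ((\<Sum>k\<in>{1..n}. (measure N (A k))\<^sup>2) * real n) / (real n)\<^sup>2"
      using sum_squared_le_sum_of_squares[of "\<lambda>k. measure N (A k)" "{1..n}"] by (intro divide_right_mono) auto
    also have "\<dots> \<le> ((\<Sum>k\<in>{1..n}. C * measure M (A k)) * real n) / (real n)\<^sup>2"
      by (intro divide_right_mono mult_right_mono sum_mono bound A) auto
    also have "\<dots> = C * (\<integral>x. \<psi> x \<partial>M)"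
      using n by (simp add: iAM sum_distrib_left[symmetric] power2_eq_square)
    also have "\<dots> \<le> C * (\<integral>x. \<phi> x \<partial>M)"
      by (intro mult_left_mono integral_mono iAM iM pw C)
    finally have *: "(\<integral>x. \<psi> x \<partial>N)\<^sup>2 \<le> C * (\<integral>x. \<phi> x \<partial>M)" .
    have "(\<integral>x. \<phi> x - 1 / real n \<partial>N) \<le> (\<integral>x. \<psi> x \<partial>N)"
      using iN by (intro integral_mono iAN) (auto simp: pw sp)
    then have le: "(\<integral>x. \<phi> x \<partial>N) - 1 / real n \<le> (\<integral>x. \<psi> x \<partial>N)"
      using iN by (simp add: N.prob_space)
    show ?thesis
    \<comment> \<open>Squaring the lower bound needs it to be nonnegative; the other case disappears
      for large \<open>n\<close> unless the integral is 0.\<close>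
    proof (cases "(\<integral>x. \<phi> x \<partial>N) < 1 / real n")
      case False
      then have "((\<integral>x. \<phi> x \<partial>N) - 1 / real n)\<^sup>2 \<le> (\<integral>x. \<psi> x \<partial>N)\<^sup>2" using le by (intro power_mono) auto
      then show ?thesis using * by simp
    qed simp
  qed
  have nn: "0 \<le> (\<integral>x. \<phi> x \<partial>N)" "0 \<le> (\<integral>x. \<phi> x \<partial>M)" using range sp by (auto intro!: integral_nonneg_AE)
  show ?thesis
  proof (cases "(\<integral>x. \<phi> x \<partial>N) = 0")
    case True
    then show ?thesis using nn C by simp
  next
    case False
    have lim: "(\<lambda>n. 1 / real n) \<longlonglongrightarrow> 0" by (rule lim_1_over_n)
    have "\<forall>\<^sub>F n in sequentially. 1 / real n < (\<integral>x. \<phi> x \<partial>N)"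
      using order_tendstoD(2)[OF lim, of "\<integral>x. \<phi> x \<partial>N"] False nn by auto
    then have ev: "\<forall>\<^sub>F n in sequentially. ((\<integral>x. \<phi> x \<partial>N) - 1 / real n)\<^sup>2 \<le> C * (\<integral>x. \<phi> x \<partial>M)"
      using eventually_gt_at_top[of 0]
    proof eventually_elim
      case (elim n)
      then show ?case using step[of n] by linarith
    qed
    have "(\<lambda>n. ((\<integral>x. \<phi> x \<partial>N) - 1 / real n)\<^sup>2) \<longlonglongrightarrow> ((\<integral>x. \<phi> x \<partial>N) - 0)\<^sup>2"
      by (intro tendsto_intros lim)
    from tendsto_upperbound[OF this ev] show ?thesis by simp
  qed
qed

text \<open>Shifting the tail by \<open>x\<close> onto the half-line below the mean gains the
  exponential factor, since the cross term \<open>2 * x * (\<mu> - v)\<close> is nonnegative there.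
  The half-line has mass 1/2, which is the 1/2 of the two-point risk.\<close>

lemma (in prob_space) normal_lower_tail:
  assumes D: "distributed M lborel X (normal_density \<mu> \<sigma>)" and s: "0 < \<sigma>" and x: "0 \<le> x"
  shows "prob {\<omega>\<in>space M. X \<omega> \<le> \<mu> - x} \<le> 1/2 * exp (- x\<^sup>2 / (2 * \<sigma>\<^sup>2))"
proof -
  let ?n = "normal_density \<mu> \<sigma>"
  have half: "(\<integral>\<^sup>+v. ennreal (?n v) * indicator {..\<mu>} v \<partial>lborel) = ennreal (1/2)"
  proof -
    let ?I = "\<integral>\<^sup>+v. ennreal (?n v) * indicator {..\<mu>} v \<partial>lborel"
    have "?I = (\<integral>\<^sup>+v. ennreal (?n (2 * \<mu> + (-1) * v)) * indicator {..\<mu>} (2 * \<mu> + (-1) * v) \<partial>lborel)"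
      by (subst nn_integral_real_affine[where c="-1" and t="2*\<mu>"]) auto
    also have "\<dots> = (\<integral>\<^sup>+v. ennreal (?n v) * indicator {\<mu>..} v \<partial>lborel)"
    proof -
      have "?n (2 * \<mu> + (-1) * v) = ?n v" for v
        by (simp add: normal_density_def power2_eq_square algebra_simps)
      moreover have "indicator {..\<mu>} (2 * \<mu> + (-1) * v) = (indicator {\<mu>..} v :: ennreal)" for v
        by (auto simp: indicator_def)
      ultimately show ?thesis by simp
    qed
    finally have eq: "?I = (\<integral>\<^sup>+v. ennreal (?n v) * indicator {\<mu>..} v \<partial>lborel)" .
    have "?I + ?I = ?I + (\<integral>\<^sup>+v. ennreal (?n v) * indicator {\<mu>..} v \<partial>lborel)" by (simp only: eq[symmetric])
    also have "\<dots> = (\<integral>\<^sup>+v. ennreal (?n v) * indicator {..\<mu>} v + ennreal (?n v) * indicator {\<mu>..} v \<partial>lborel)"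
      by (rule nn_integral_add[symmetric]) auto
    also have "\<dots> = (\<integral>\<^sup>+v. ennreal (?n v) \<partial>lborel)"
    proof (rule nn_integral_cong_AE)
      show "AE v in lborel. ennreal (?n v) * indicator {..\<mu>} v + ennreal (?n v) * indicator {\<mu>..} v = ennreal (?n v)"
        using AE_lborel_singleton[of \<mu>] by eventually_elim (auto simp: indicator_def)
    qed
    also have "\<dots> = 1" using s by (subst nn_integral_eq_integral) auto
    finally have two: "?I + ?I = 1" .
    then have "?I \<noteq> \<top>" by (metis ennreal_add_eq_top ennreal_one_neq_top)
    then obtain r where r: "?I = ennreal r" "0 \<le> r" by (cases ?I) auto
    have "ennreal (r + r) = ennreal 1"
      using two[unfolded r(1)] r(2) by (subst ennreal_plus) auto
    then have "r + r = 1" using r(2) by (subst (asm) ennreal_inj) auto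
    then have "r = 1/2" by simp
    then show ?thesis by (simp only: r(1))
  qed
  have "emeasure M (X -` {..\<mu> - x} \<inter> space M) = (\<integral>\<^sup>+v. ennreal (?n v) * indicator {..\<mu> - x} v \<partial>lborel)"
    by (rule distributed_emeasure[OF D]) auto
  also have "\<dots> = (\<integral>\<^sup>+v. ennreal (?n (- x + 1 * v)) * indicator {..\<mu> - x} (- x + 1 * v) \<partial>lborel)"
    by (subst nn_integral_real_affine[where c=1 and t="-x"]) auto
  also have "\<dots> \<le> (\<integral>\<^sup>+v. ennreal (exp (- x\<^sup>2 / (2 * \<sigma>\<^sup>2))) * (ennreal (?n v) * indicator {..\<mu>} v) \<partial>lborel)"
  proof (intro nn_integral_mono)
    fix v
    show "ennreal (?n (- x + 1 * v)) * indicator {..\<mu> - x} (- x + 1 * v)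
      \<le> ennreal (exp (- x\<^sup>2 / (2 * \<sigma>\<^sup>2))) * (ennreal (?n v) * indicator {..\<mu>} v)"
    proof (cases "v \<le> \<mu>")
      case True
      then have "0 \<le> 2 * x * (\<mu> - v)" using x by auto
      then have "(v - \<mu>)\<^sup>2 + x\<^sup>2 \<le> (- x + 1 * v - \<mu>)\<^sup>2" by (simp add: power2_eq_square algebra_simps)
      then have "- (- x + 1 * v - \<mu>)\<^sup>2 / (2 * \<sigma>\<^sup>2) \<le> (- x\<^sup>2 - (v - \<mu>)\<^sup>2) / (2 * \<sigma>\<^sup>2)"
        by (intro divide_right_mono) auto
      then have "exp (- (- x + 1 * v - \<mu>)\<^sup>2 / (2 * \<sigma>\<^sup>2)) \<le> exp (- x\<^sup>2 / (2 * \<sigma>\<^sup>2)) * exp (- (v - \<mu>)\<^sup>2 / (2 * \<sigma>\<^sup>2))"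
        unfolding exp_add[symmetric] exp_le_cancel_iff by (simp add: add_divide_distrib diff_divide_distrib)
      then have "1 / sqrt (2 * pi * \<sigma>\<^sup>2) * exp (- (- x + 1 * v - \<mu>)\<^sup>2 / (2 * \<sigma>\<^sup>2))
        \<le> 1 / sqrt (2 * pi * \<sigma>\<^sup>2) * (exp (- x\<^sup>2 / (2 * \<sigma>\<^sup>2)) * exp (- (v - \<mu>)\<^sup>2 / (2 * \<sigma>\<^sup>2)))"
        by (intro mult_left_mono) auto
      then have "?n (- x + 1 * v) \<le> exp (- x\<^sup>2 / (2 * \<sigma>\<^sup>2)) * ?n v"
        by (simp add: normal_density_def mult.left_commute)
      then have "ennreal (?n (- x + 1 * v)) \<le> ennreal (exp (- x\<^sup>2 / (2 * \<sigma>\<^sup>2))) * ennreal (?n v)"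
        by (subst ennreal_mult[symmetric]) auto
      then show ?thesis using True by simp
    qed (auto simp: indicator_def)
  qed
  also have "\<dots> = ennreal (exp (- x\<^sup>2 / (2 * \<sigma>\<^sup>2))) * ennreal (1/2)"
    unfolding half[symmetric] by (rule nn_integral_cmult) auto
  also have "\<dots> = ennreal (1/2 * exp (- x\<^sup>2 / (2 * \<sigma>\<^sup>2)))"
    by (subst ennreal_mult[symmetric]) (auto simp: mult.commute)
  finally have "ennreal (prob (X -` {..\<mu> - x} \<inter> space M)) \<le> ennreal (1/2 * exp (- x\<^sup>2 / (2 * \<sigma>\<^sup>2)))"
    by (simp add: emeasure_eq_measure)
  moreover have "X -` {..\<mu> - x} \<inter> space M = {\<omega>\<in>space M. X \<omega> \<le> \<mu> - x}" by auto
  ultimately show ?thesis by simp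
qed

section \<open>Increments of the observed path\<close>

definition drift :: "(real \<Rightarrow> real) \<Rightarrow> real \<Rightarrow> real" where
  "drift f t = (LINT s:{0..t}|lborel. f s)"

lemma drift_eq:
  assumes "0 \<le> t" "t \<le> 1"
  shows "drift f t = (\<integral>s. indicator {0..t} s * f s \<partial>unit_lborel)"
  using assms unfolding drift_def set_lebesgue_integral_def
  by (subst integral_restrict_space) (auto intro!: Bochner_Integration.integral_cong simp: indicator_def)

lemma drift_increment:
  assumes "bounded_measurable f" "0 \<le> s" "s \<le> t" "t \<le> 1"
  shows "drift f t - drift f s = (\<integral>x. indicator {s<..t} x * f x \<partial>unit_lborel)"
proof -
  have "drift f t - drift f s = (\<integral>x. indicator {0..t} x * f x - indicator {0..s} x * f x \<partial>unit_lborel)"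
    using assms by (subst Bochner_Integration.integral_diff)
      (auto simp: drift_eq intro!: integrable_bounded_measurable bounded_measurable_intros bounded_measurable_indicator)
  also have "\<dots> = (\<integral>x. indicator {s<..t} x * f x \<partial>unit_lborel)"
    using assms by (intro Bochner_Integration.integral_cong) (auto simp: indicator_def)
  finally show ?thesis .
qed

lemma drift_diff:
  assumes "bounded_measurable f" "bounded_measurable g" "0 \<le> t" "t \<le> 1"
  shows "drift (\<lambda>t. f t - g t) t = drift f t - drift g t"
  using assms by (simp add: drift_eq right_diff_distrib)
    (intro Bochner_Integration.integral_diff integrable_bounded_measurable bounded_measurable_intros bounded_measurable_indicator; simp)

lemma drift_0: "drift f 0 = 0"
proof -
  have "AE s in lborel. indicator {0..0} s *\<^sub>R f s = 0"
    using AE_lborel_singleton[of 0] by eventually_elim auto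
  then show ?thesis unfolding drift_def set_lebesgue_integral_def by (rule integral_eq_zero_AE)
qed

lemma power2_sum_orthogonal:
  fixes a :: "'a \<Rightarrow> real"
  assumes "finite I" "\<And>i j. i \<in> I \<Longrightarrow> j \<in> I \<Longrightarrow> i \<noteq> j \<Longrightarrow> a i * a j = 0"
  shows "(\<Sum>i\<in>I. a i)\<^sup>2 = (\<Sum>i\<in>I. (a i)\<^sup>2)"
  using assms
proof (induction I)
  case (insert x F)
  then have "a x * (\<Sum>i\<in>F. a i) = 0" by (subst sum_distrib_left) (intro sum.neutral ballI, metis insertCI)
  then show ?case using insert by (simp add: power2_sum)
qed simp

text \<open>The cells are disjoint, so squaring the step function produces no mixed terms, and the
  integral of \<open>h\<close> over a cell is an increment of its drift.\<close>

lemma integral_step_residual: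
  fixes t :: "nat \<Rightarrow> real"
  assumes h: "bounded_measurable h" and t: "strict_mono_on {..n} t" "t ` {..n} \<subseteq> {0..1}"
  shows "(\<integral>x. (h x - (\<Sum>i<n. c i * indicator {t i<..t (Suc i)} x))\<^sup>2 \<partial>unit_lborel)
    = (\<integral>x. (h x)\<^sup>2 \<partial>unit_lborel) - 2 * (\<Sum>i<n. c i * (drift h (t (Suc i)) - drift h (t i)))
      + (\<Sum>i<n. (c i)\<^sup>2 * (t (Suc i) - t i))"
proof -
  let ?I = "\<lambda>i x. indicator {t i<..t (Suc i)} x :: real"
  have t01: "0 \<le> t i" "t i \<le> 1" if "i \<le> n" for i using t(2) that by auto
  have mono: "t i < t j" if "i < j" "j \<le> n" for i j using t(1) that by (auto simp: strict_mono_on_def)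
  have mono': "t i \<le> t j" if "i \<le> j" "j \<le> n" for i j using mono[of i j] that by (cases "i = j") auto
  have orth: "(c i * ?I i x) * (c j * ?I j x) = 0" if "i < n" "j < n" "i \<noteq> j" for i j x
    using mono'[of "Suc i" j] mono'[of "Suc j" i] that by (cases "i < j") (auto simp: indicator_def)
  have eq: "(h x - (\<Sum>i<n. c i * ?I i x))\<^sup>2
    = (h x)\<^sup>2 - 2 * (\<Sum>i<n. c i * (?I i x * h x)) + (\<Sum>i<n. (c i)\<^sup>2 * ?I i x)" for x
  proof -
    have "(\<Sum>i<n. c i * ?I i x)\<^sup>2 = (\<Sum>i<n. (c i * ?I i x)\<^sup>2)"
      using orth by (intro power2_sum_orthogonal) auto
    also have "\<dots> = (\<Sum>i<n. (c i)\<^sup>2 * ?I i x)"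
      by (intro sum.cong) (auto simp: power_mult_distrib indicator_def)
    finally have "(\<Sum>i<n. c i * ?I i x)\<^sup>2 = (\<Sum>i<n. (c i)\<^sup>2 * ?I i x)" .
    moreover have "h x * (\<Sum>i<n. c i * ?I i x) = (\<Sum>i<n. c i * (?I i x * h x))"
      by (subst sum_distrib_left) (intro sum.cong refl, simp only: mult_ac)
    ultimately show ?thesis by (simp add: power2_diff algebra_simps)
  qed
  have bmI: "bounded_measurable (?I i)" for i by (rule bounded_measurable_indicator) simp
  have i0: "integrable unit_lborel (\<lambda>x. (h x)\<^sup>2)"
    and i1: "integrable unit_lborel (\<lambda>x. c i * (?I i x * h x))"
    and i2: "integrable unit_lborel (\<lambda>x. (c i)\<^sup>2 * ?I i x)" for i
    by (intro integrable_bounded_measurable bounded_measurable_intros h bmI)+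
  have "(\<integral>x. (h x - (\<Sum>i<n. c i * ?I i x))\<^sup>2 \<partial>unit_lborel)
    = (\<integral>x. (h x)\<^sup>2 \<partial>unit_lborel) - 2 * (\<Sum>i<n. c i * (\<integral>x. ?I i x * h x \<partial>unit_lborel))
      + (\<Sum>i<n. (c i)\<^sup>2 * (\<integral>x. ?I i x \<partial>unit_lborel))"
  proof -
    define B where "B = (\<lambda>x. \<Sum>i<n. c i * (?I i x * h x))"
    define D where "D = (\<lambda>x. \<Sum>i<n. (c i)\<^sup>2 * ?I i x)"
    have iBD: "integrable unit_lborel B" "integrable unit_lborel D"
      unfolding B_def D_def by (intro Bochner_Integration.integrable_sum i1 i2)+
    have "(\<integral>x. B x \<partial>unit_lborel) = (\<Sum>i<n. c i * (\<integral>x. ?I i x * h x \<partial>unit_lborel))"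
      unfolding B_def by (subst Bochner_Integration.integral_sum[OF i1]) (simp only: integral_mult_right_zero)
    moreover have "(\<integral>x. D x \<partial>unit_lborel) = (\<Sum>i<n. (c i)\<^sup>2 * (\<integral>x. ?I i x \<partial>unit_lborel))"
      unfolding D_def by (subst Bochner_Integration.integral_sum[OF i2]) (simp only: integral_mult_right_zero)
    moreover have "(\<integral>x. (h x)\<^sup>2 - 2 * B x + D x \<partial>unit_lborel)
      = (\<integral>x. (h x)\<^sup>2 \<partial>unit_lborel) - 2 * (\<integral>x. B x \<partial>unit_lborel) + (\<integral>x. D x \<partial>unit_lborel)"
      using i0 iBD by simp
    moreover have "(\<lambda>x. (h x - (\<Sum>i<n. c i * ?I i x))\<^sup>2) = (\<lambda>x. (h x)\<^sup>2 - 2 * B x + D x)"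
      unfolding eq B_def D_def by (rule refl)
    ultimately show ?thesis by (simp only:)
  qed
  also have "(\<Sum>i<n. c i * (\<integral>x. ?I i x * h x \<partial>unit_lborel)) = (\<Sum>i<n. c i * (drift h (t (Suc i)) - drift h (t i)))"
    using t01 mono' by (intro sum.cong refl, subst drift_increment[OF h]) auto
  also have "(\<Sum>i<n. (c i)\<^sup>2 * (\<integral>x. ?I i x \<partial>unit_lborel)) = (\<Sum>i<n. (c i)\<^sup>2 * (t (Suc i) - t i))"
  proof (intro sum.cong refl)
    fix i assume "i \<in> {..<n}"
    then have i: "0 \<le> t i" "t (Suc i) \<le> 1" "t i \<le> t (Suc i)" using t01 mono' by auto
    then have "{t i<..t (Suc i)} \<inter> {0..1} = {t i<..t (Suc i)}" by auto
    then have "(\<integral>x. ?I i x \<partial>unit_lborel) = t (Suc i) - t i"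
      using i by (subst integral_indicator_unit) auto
    then show "(c i)\<^sup>2 * (\<integral>x. ?I i x \<partial>unit_lborel) = (c i)\<^sup>2 * (t (Suc i) - t i)" by simp
  qed
  finally show ?thesis .
qed

text \<open>The sum is the squared norm of the projection of \<open>h\<close> onto the step
  functions of the grid. Any step function bounds it from below through its residual; the cell
  averages \<open>a\<close> give the projection itself, hence the upper bound.\<close>

lemma sum_drift_increments_le:
  fixes t :: "nat \<Rightarrow> real"
  assumes h: "bounded_measurable h" and t: "strict_mono_on {..n} t" "t ` {..n} \<subseteq> {0..1}"
  shows "(\<integral>x. (h x)\<^sup>2 \<partial>unit_lborel)
     - (\<integral>x. (h x - (\<Sum>i<n. c i * indicator {t i<..t (Suc i)} x))\<^sup>2 \<partial>unit_lborel)
     \<le> (\<Sum>i<n. (drift h (t (Suc i)) - drift h (t i))\<^sup>2 / (t (Suc i) - t i))"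
    "(\<Sum>i<n. (drift h (t (Suc i)) - drift h (t i))\<^sup>2 / (t (Suc i) - t i)) \<le> (\<integral>x. (h x)\<^sup>2 \<partial>unit_lborel)"
proof -
  let ?D = "\<lambda>i. drift h (t (Suc i)) - drift h (t i)" and ?d = "\<lambda>i. t (Suc i) - t i"
  have d: "0 < ?d i" if "i < n" for i using t(1) that by (auto simp: strict_mono_on_def)
  have "2 * (\<Sum>i<n. c i * ?D i) - (\<Sum>i<n. (c i)\<^sup>2 * ?d i) \<le> (\<Sum>i<n. (?D i)\<^sup>2 / ?d i)"
    unfolding sum_distrib_left sum_subtractf[symmetric]
  proof (intro sum_mono)
    fix i assume "i \<in> {..<n}"
    then have di: "0 < ?d i" using d by simp
    have "0 \<le> (?D i - c i * ?d i)\<^sup>2 / ?d i" using di by simp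
    also have "\<dots> = (?D i)\<^sup>2 / ?d i - (2 * (c i * ?D i) - (c i)\<^sup>2 * ?d i)"
      using di by (simp add: power2_diff diff_divide_distrib add_divide_distrib)
        (simp add: power2_eq_square mult_ac)
    finally show "2 * (c i * ?D i) - (c i)\<^sup>2 * ?d i \<le> (?D i)\<^sup>2 / ?d i" by simp
  qed
  then show "(\<integral>x. (h x)\<^sup>2 \<partial>unit_lborel)
     - (\<integral>x. (h x - (\<Sum>i<n. c i * indicator {t i<..t (Suc i)} x))\<^sup>2 \<partial>unit_lborel)
     \<le> (\<Sum>i<n. (?D i)\<^sup>2 / ?d i)"
    using integral_step_residual[OF h t, of c] by simp
  define a where "a = (\<lambda>i. ?D i / ?d i)"
  have "0 \<le> (\<integral>x. (h x - (\<Sum>i<n. a i * indicator {t i<..t (Suc i)} x))\<^sup>2 \<partial>unit_lborel)" by simp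
  also have "\<dots> = (\<integral>x. (h x)\<^sup>2 \<partial>unit_lborel) - 2 * (\<Sum>i<n. a i * ?D i) + (\<Sum>i<n. (a i)\<^sup>2 * ?d i)"
    by (rule integral_step_residual[OF h t])
  also have "(\<Sum>i<n. a i * ?D i) = (\<Sum>i<n. (?D i)\<^sup>2 / ?d i)"
    by (simp add: a_def power2_eq_square)
  also have "(\<Sum>i<n. (a i)\<^sup>2 * ?d i) = (\<Sum>i<n. (?D i)\<^sup>2 / ?d i)"
    using d by (intro sum.cong) (auto simp: a_def power2_eq_square)
  finally show "(\<Sum>i<n. (?D i)\<^sup>2 / ?d i) \<le> (\<integral>x. (h x)\<^sup>2 \<partial>unit_lborel)" by simp
qed

section \<open>The white noise model on finite grids\<close>

locale white_noise =
  fixes P :: "'w measure" and W :: "real \<Rightarrow> 'w \<Rightarrow> real" and \<epsilon> :: real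
  assumes bm: "standard_brownian_motion P W" and eps: "0 < \<epsilon>"
begin

sublocale prob_space P using bm by (simp add: standard_brownian_motion_def)

lemma measurable_W: "t \<in> {0..1} \<Longrightarrow> W t \<in> borel_measurable P"
  using bm by (simp add: standard_brownian_motion_def)

lemma observation_eq: "t \<in> {0..1} \<Longrightarrow> observation W \<epsilon> f \<omega> t = drift f t + \<epsilon> * W t \<omega>"
  by (simp add: observation_def drift_def)

lemma measurable_observation: "observation W \<epsilon> f \<in> measurable P (\<Pi>\<^sub>M t\<in>{0..1}. borel)"
  unfolding observation_def using measurable_W by (intro measurable_restrict) auto

lemma observation_0: "AE \<omega> in P. observation W \<epsilon> f \<omega> 0 = 0"
proof -
  have "AE \<omega> in P. W 0 \<omega> = 0" using bm by (simp add: standard_brownian_motion_def)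
  then show ?thesis by eventually_elim (simp add: observation_eq drift_0)
qed

definition increment :: "(real \<Rightarrow> real) \<Rightarrow> (nat \<Rightarrow> real) \<Rightarrow> nat \<Rightarrow> 'w \<Rightarrow> real" where
  "increment f t i \<omega> = observation W \<epsilon> f \<omega> (t (Suc i)) - observation W \<epsilon> f \<omega> (t i)"

lemma increment_eq:
  assumes "t ` {..n} \<subseteq> {0..1}" "i < n"
  shows "increment f t i = (\<lambda>\<omega>. (drift f (t (Suc i)) - drift f (t i)) + \<epsilon> * (W (t (Suc i)) \<omega> - W (t i) \<omega>))"
proof -
  have "t i \<in> {0..1}" "t (Suc i) \<in> {0..1}" using assms unfolding image_subset_iff by auto
  then show ?thesis by (simp add: increment_def fun_eq_iff observation_eq algebra_simps)
qed

lemma distributed_increment: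
  assumes t: "strict_mono_on {..n} t" "t ` {..n} \<subseteq> {0..1}" and i: "i < n"
  shows "distributed P lborel (increment f t i)
    (normal_density (drift f (t (Suc i)) - drift f (t i)) (\<epsilon> * sqrt (t (Suc i) - t i)))"
proof -
  have m: "0 \<le> t i" "t i < t (Suc i)" "t (Suc i) \<le> 1"
    using t i by (auto simp: strict_mono_on_def image_subset_iff)
  have "distributed P lborel (\<lambda>\<omega>. W (t (Suc i)) \<omega> - W (t i) \<omega>) (normal_density 0 (sqrt (t (Suc i) - t i)))"
    using bm m by (simp add: standard_brownian_motion_def)
  from normal_density_affine[OF this, of \<epsilon> "drift f (t (Suc i)) - drift f (t i)"] show ?thesis
    using m eps by (simp add: increment_eq[OF t(2) i])
qed

lemma indep_increments:
  assumes t: "strict_mono_on {..n} t" "t ` {..n} \<subseteq> {0..1}"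
  shows "indep_vars (\<lambda>_. borel) (increment f t) {..<n}"
proof -
  have "indep_vars (\<lambda>_. borel) (\<lambda>i \<omega>. W (t (Suc i)) \<omega> - W (t i) \<omega>) {..<n}"
    using bm t by (simp add: standard_brownian_motion_def)
  then have "indep_vars (\<lambda>_. borel)
    (\<lambda>i \<omega>. (\<lambda>i x. (drift f (t (Suc i)) - drift f (t i)) + \<epsilon> * x) i (W (t (Suc i)) \<omega> - W (t i) \<omega>)) {..<n}"
    by (rule indep_vars_compose2) auto
  then show ?thesis by (subst indep_vars_cong[OF refl increment_eq[OF t(2)] refl]) auto
qed

lemma distr_increments:
  assumes t: "strict_mono_on {..n} t" "t ` {..n} \<subseteq> {0..1}" and n: "0 < n"
    and s: "\<And>i. i < n \<Longrightarrow> \<sigma> i = \<epsilon> * sqrt (t (Suc i) - t i)"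
  shows "distr P (\<Pi>\<^sub>M i\<in>{..<n}. borel) (\<lambda>\<omega>. \<lambda>i\<in>{..<n}. increment f t i \<omega>)
    = (\<Pi>\<^sub>M i\<in>{..<n}. density lborel (normal_density (drift f (t (Suc i)) - drift f (t i)) (\<sigma> i)))"
proof -
  have D: "distributed P lborel (increment f t i)
    (normal_density (drift f (t (Suc i)) - drift f (t i)) (\<epsilon> * sqrt (t (Suc i) - t i)))" if "i < n" for i
    using distributed_increment[OF t that] .
  have rv: "random_variable borel (increment f t i)" if "i \<in> {..<n}" for i
    using distributed_measurable[OF D, of i] that by simp
  have "distr P (\<Pi>\<^sub>M i\<in>{..<n}. borel) (\<lambda>\<omega>. \<lambda>i\<in>{..<n}. increment f t i \<omega>)
     = (\<Pi>\<^sub>M i\<in>{..<n}. distr P borel (increment f t i))"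
    using indep_vars_iff_distr_eq_PiM'[where I="{..<n}" and M'="\<lambda>_. borel" and X="increment f t"] n rv indep_increments[OF t]
    by auto
  also have "\<dots> = (\<Pi>\<^sub>M i\<in>{..<n}. density lborel (normal_density (drift f (t (Suc i)) - drift f (t i)) (\<sigma> i)))"
  proof (intro PiM_cong refl)
    fix i assume i: "i \<in> {..<n}"
    have "distr P borel (increment f t i) = distr P lborel (increment f t i)" by (rule distr_cong) auto
    also have "\<dots> = density lborel (normal_density (drift f (t (Suc i)) - drift f (t i)) (\<sigma> i))"
      using distributed_distr_eq_density[OF D, of i] i s by simp
    finally show "distr P borel (increment f t i)
      = density lborel (normal_density (drift f (t (Suc i)) - drift f (t i)) (\<sigma> i))" .
  qed
  finally show ?thesis .
qed

text \<open>The path at finitely many times is almost surely a function of independent Gaussian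
  increments, whose variances do not depend on the drift. The exponents of the factors add up to the
  squared norm of a projection of \<open>f - g\<close>, divided by
  \<open>\<epsilon>\<^sup>2\<close>, and so stay below the full norm.\<close>

lemma chi_bound_finite_coordinates:
  assumes f: "bounded_measurable f" and g: "bounded_measurable g"
    and J: "finite J" "J \<subseteq> {0..1}"
    and \<psi>: "\<psi> \<in> borel_measurable (\<Pi>\<^sub>M t\<in>J. borel)"
  shows "(\<integral>\<^sup>+\<omega>. \<psi> (restrict (observation W \<epsilon> g \<omega>) J) \<partial>P)\<^sup>2
    \<le> ennreal (exp (l2_dist_sq f g / \<epsilon>\<^sup>2)) * (\<integral>\<^sup>+\<omega>. (\<psi> (restrict (observation W \<epsilon> f \<omega>) J))\<^sup>2 \<partial>P)"
proof -
  \<comment> \<open>From the point 0 on, the increments add up to the path; with 1 as well, the grid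
    has at least one cell.\<close>
  define K where "K = J \<union> {0, 1}"
  have K: "finite K" "K \<subseteq> {0..1}" using J by (auto simp: K_def)
  define xs where "xs = sorted_list_of_set K"
  define t where "t = (\<lambda>i. xs ! i)"
  define n where "n = length xs - 1"
  have set: "set xs = K" using K by (simp add: xs_def)
  have len: "length xs = card K" by (simp add: xs_def)
  have "card {0, 1::real} \<le> card K" using K by (intro card_mono) (auto simp: K_def)
  then have n: "0 < n" "length xs = Suc n" by (auto simp: n_def len)
  have "sorted_wrt (<) xs" by (simp add: xs_def)
  then have smono: "strict_mono_on {..n} t"
    using n(2) by (auto simp: strict_mono_on_def t_def sorted_wrt_iff_nth_less)
  have img: "t ` {..n} = K"
    using set n(2) by (force simp: t_def set_conv_nth image_iff less_Suc_eq_le)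
  note t = smono order.trans[OF eq_refl[OF img] K(2)]
  have t0: "t 0 = 0"
  proof -
    have "0 \<in> t ` {..n}" unfolding img by (simp add: K_def)
    then obtain i where i: "i \<le> n" "t i = 0" by auto
    have "0 \<le> t 0" using t(2) by auto
    moreover have "t 0 < t i" if "i \<noteq> 0" using strict_mono_onD[OF smono, of 0 i] i that by auto
    ultimately show ?thesis using i by (cases "i = 0") auto
  qed
  have "\<exists>k\<le>n. t k = j" if "j \<in> J" for j
  proof -
    have "j \<in> t ` {..n}" unfolding img using that by (simp add: K_def)
    then show ?thesis by auto
  qed
  then obtain k where k: "\<And>j. j \<in> J \<Longrightarrow> k j \<le> n" "\<And>j. j \<in> J \<Longrightarrow> t (k j) = j" by metis
  \<comment> \<open>\<open>G\<close> recovers the path at \<open>j\<close> as the sum of the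
    increments before \<open>j\<close>, because the path starts at 0 almost surely.\<close>
  define G where "G = (\<lambda>x. \<lambda>j\<in>J. \<Sum>i<k j. x i :: real)"
  have G[measurable]: "G \<in> measurable (\<Pi>\<^sub>M i\<in>{..<n}. borel) (\<Pi>\<^sub>M t\<in>J. borel)"
    unfolding G_def
  proof (intro measurable_restrict borel_measurable_sum)
    fix j i assume "j \<in> J" "i \<in> {..<k j}"
    then have "i \<in> {..<n}" using k(1)[of j] by auto
    then show "(\<lambda>x. x i) \<in> borel_measurable (\<Pi>\<^sub>M i\<in>{..<n}. borel)" by measurable
  qed
  note [measurable] = \<psi>
  define m where "m = (\<lambda>f i. drift f (t (Suc i)) - drift f (t i))"
  \<comment> \<open>The value 1 beyond the grid makes every normal law a probability measure, also
    at indices outside the product.\<close>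
  define \<sigma> where "\<sigma> = (\<lambda>i. if i < n then \<epsilon> * sqrt (t (Suc i) - t i) else 1)"
  have dt: "0 < t (Suc i) - t i" if "i < n" for i using smono that by (auto simp: strict_mono_on_def)
  then have \<sigma>: "0 < \<sigma> i" for i using eps by (simp add: \<sigma>_def)
  have law: "(\<integral>\<^sup>+\<omega>. \<xi> (restrict (observation W \<epsilon> f \<omega>) J) \<partial>P)
     = (\<integral>\<^sup>+x. \<xi> (G x) \<partial>(\<Pi>\<^sub>M i\<in>{..<n}. density lborel (normal_density (m f i) (\<sigma> i))))"
    if [measurable]: "\<xi> \<in> borel_measurable (\<Pi>\<^sub>M t\<in>J. borel)" for f and \<xi> :: "_ \<Rightarrow> ennreal"
  proof -
    have rv: "increment f t i \<in> borel_measurable P" if "i \<in> {..<n}" for i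
      using distributed_measurable[OF distributed_increment[OF t, of i]] that by simp
    have "AE \<omega> in P. restrict (observation W \<epsilon> f \<omega>) J = G (\<lambda>i\<in>{..<n}. increment f t i \<omega>)"
      using observation_0[of f]
    proof eventually_elim
      case (elim \<omega>)
      show ?case
      proof
        fix j
        show "restrict (observation W \<epsilon> f \<omega>) J j = G (\<lambda>i\<in>{..<n}. increment f t i \<omega>) j"
        proof (cases "j \<in> J")
          case True
          have "(\<Sum>i<k j. (\<lambda>i\<in>{..<n}. increment f t i \<omega>) i) = (\<Sum>i<k j. increment f t i \<omega>)"
            using k(1)[OF True] by (intro sum.cong) auto
          also have "\<dots> = observation W \<epsilon> f \<omega> (t (k j)) - observation W \<epsilon> f \<omega> (t 0)"
            unfolding increment_def by (rule sum_lessThan_telescope)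
          finally show ?thesis using True elim k(2)[OF True] t0 by (simp add: G_def)
        qed (simp add: G_def)
      qed
    qed
    then have "AE \<omega> in P. \<xi> (restrict (observation W \<epsilon> f \<omega>) J) = \<xi> (G (\<lambda>i\<in>{..<n}. increment f t i \<omega>))"
      by eventually_elim simp
    then have "(\<integral>\<^sup>+\<omega>. \<xi> (restrict (observation W \<epsilon> f \<omega>) J) \<partial>P)
      = (\<integral>\<^sup>+\<omega>. \<xi> (G (\<lambda>i\<in>{..<n}. increment f t i \<omega>)) \<partial>P)"
      by (rule nn_integral_cong_AE)
    also have "\<dots> = (\<integral>\<^sup>+x. \<xi> (G x) \<partial>distr P (\<Pi>\<^sub>M i\<in>{..<n}. borel) (\<lambda>\<omega>. \<lambda>i\<in>{..<n}. increment f t i \<omega>))"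
      using rv by (subst nn_integral_distr) (auto intro!: measurable_restrict)
    also have "distr P (\<Pi>\<^sub>M i\<in>{..<n}. borel) (\<lambda>\<omega>. \<lambda>i\<in>{..<n}. increment f t i \<omega>)
      = (\<Pi>\<^sub>M i\<in>{..<n}. density lborel (normal_density (m f i) (\<sigma> i)))"
      unfolding m_def by (rule distr_increments[OF t n(1)]) (simp add: \<sigma>_def)
    finally show ?thesis .
  qed
  have chi: "chi_bound (\<Pi>\<^sub>M i\<in>{..<n}. density lborel (normal_density (m f i) (\<sigma> i)))
    (\<Pi>\<^sub>M i\<in>{..<n}. density lborel (normal_density (m g i) (\<sigma> i)))
    (\<Prod>i<n. ennreal (exp ((m g i - m f i)\<^sup>2 / (\<sigma> i)\<^sup>2)))"
    using \<sigma> by (intro chi_bound_PiM chi_bound_normal prob_space_normal_density) auto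
  have "sets (\<Pi>\<^sub>M i\<in>{..<n}. density lborel (normal_density (m f i) (\<sigma> i))) = sets (\<Pi>\<^sub>M i\<in>{..<n}. (borel :: real measure))"
    by (intro sets_PiM_cong) auto
  then have "(\<lambda>x. \<psi> (G x)) \<in> borel_measurable (\<Pi>\<^sub>M i\<in>{..<n}. density lborel (normal_density (m f i) (\<sigma> i)))"
    by (subst measurable_cong_sets[OF _ refl]) measurable
  then have "(\<integral>\<^sup>+\<omega>. \<psi> (restrict (observation W \<epsilon> g \<omega>) J) \<partial>P)\<^sup>2
    \<le> (\<Prod>i<n. ennreal (exp ((m g i - m f i)\<^sup>2 / (\<sigma> i)\<^sup>2))) * (\<integral>\<^sup>+\<omega>. (\<psi> (restrict (observation W \<epsilon> f \<omega>) J))\<^sup>2 \<partial>P)"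
    using chi unfolding law[OF \<psi>] chi_bound_def by (subst law) auto
  also have "(\<Prod>i<n. ennreal (exp ((m g i - m f i)\<^sup>2 / (\<sigma> i)\<^sup>2))) = ennreal (exp (\<Sum>i<n. (m g i - m f i)\<^sup>2 / (\<sigma> i)\<^sup>2))"
    by (simp add: prod_ennreal exp_sum)
  also have "\<dots> \<le> ennreal (exp (l2_dist_sq f g / \<epsilon>\<^sup>2))"
  proof -
    let ?h = "\<lambda>x. f x - g x"
    have h: "bounded_measurable ?h" by (intro bounded_measurable_intros f g)
    have "(m g i - m f i)\<^sup>2 / (\<sigma> i)\<^sup>2 = (m ?h i)\<^sup>2 / (t (Suc i) - t i) / \<epsilon>\<^sup>2" if "i < n" for i
    proof -
      have "t i \<in> t ` {..n}" "t (Suc i) \<in> t ` {..n}" using that by auto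
      then have "0 \<le> t i" "t i \<le> 1" "0 \<le> t (Suc i)" "t (Suc i) \<le> 1" using t(2) by force+
      then have "m ?h i = - (m g i - m f i)" by (simp add: m_def drift_diff f g)
      moreover have "(\<sigma> i)\<^sup>2 = (t (Suc i) - t i) * \<epsilon>\<^sup>2"
        using that dt[OF that] by (simp add: \<sigma>_def power_mult_distrib)
      ultimately show ?thesis by (simp only: power2_minus divide_divide_eq_left)
    qed
    then have "(\<Sum>i<n. (m g i - m f i)\<^sup>2 / (\<sigma> i)\<^sup>2) = (\<Sum>i<n. (m ?h i)\<^sup>2 / (t (Suc i) - t i)) / \<epsilon>\<^sup>2"
      by (simp add: sum_divide_distrib)
    also have "\<dots> \<le> l2_dist_sq f g / \<epsilon>\<^sup>2"
      using sum_drift_increments_le(2)[OF h t] unfolding l2_dist_sq_def m_def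
      by (intro divide_right_mono) auto
    finally show ?thesis by (intro ennreal_leI) simp
  qed
  finally show ?thesis by (simp only: mult_right_mono zero_le)
qed

section \<open>Change of drift on path space\<close>

definition path_law :: "(real \<Rightarrow> real) \<Rightarrow> (real \<Rightarrow> real) measure" where
  "path_law f = distr P (\<Pi>\<^sub>M t\<in>{0..1}. borel) (observation W \<epsilon> f)"

lemma prob_space_path_law: "prob_space (path_law f)"
  unfolding path_law_def by (rule prob_space_distr[OF measurable_observation])

lemma sets_path_law: "sets (path_law f) = sets (\<Pi>\<^sub>M t\<in>{0..1}. borel)"
  by (simp add: path_law_def)

lemma path_law_cylinder:
  assumes f: "bounded_measurable f" and g: "bounded_measurable g"
    and J: "finite J" "J \<subseteq> {0..1}" and B: "B \<in> sets (\<Pi>\<^sub>M t\<in>J. borel)"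
  shows "(measure (path_law g) (prod_emb {0..1} (\<lambda>_. borel) J B))\<^sup>2
    \<le> exp (l2_dist_sq f g / \<epsilon>\<^sup>2) * measure (path_law f) (prod_emb {0..1} (\<lambda>_. borel) J B)"
proof -
  let ?E = "prod_emb {0..1} (\<lambda>_. borel) J B :: (real \<Rightarrow> real) set"
  have E: "?E \<in> sets (\<Pi>\<^sub>M t\<in>{0..1}. borel)" using J B by (intro measurable_prod_emb)
  have eq: "(\<integral>\<^sup>+\<omega>. indicator B (restrict (observation W \<epsilon> f \<omega>) J) \<partial>P) = ennreal (measure (path_law f) ?E)" for f
  proof -
    interpret L: prob_space "path_law f" by (rule prob_space_path_law)
    have "(\<integral>\<^sup>+\<omega>. indicator B (restrict (observation W \<epsilon> f \<omega>) J) \<partial>P) = (\<integral>\<^sup>+\<omega>. indicator ?E (observation W \<epsilon> f \<omega>) \<partial>P)"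
    proof (intro nn_integral_cong)
      fix \<omega>
      have "observation W \<epsilon> f \<omega> \<in> extensional {0..1}" by (simp add: observation_def)
      then show "indicator B (restrict (observation W \<epsilon> f \<omega>) J) = (indicator ?E (observation W \<epsilon> f \<omega>) :: ennreal)"
        by (auto simp: indicator_def prod_emb_def PiE_def)
    qed
    also have "\<dots> = (\<integral>\<^sup>+y. indicator ?E y \<partial>path_law f)"
      unfolding path_law_def using E by (subst nn_integral_distr[OF measurable_observation]) auto
    also have "\<dots> = emeasure (path_law f) ?E" using E by (simp add: sets_path_law)
    finally show ?thesis by (simp add: L.emeasure_eq_measure)
  qed
  have "(\<integral>\<^sup>+\<omega>. indicator B (restrict (observation W \<epsilon> g \<omega>) J) \<partial>P)\<^sup>2
    \<le> ennreal (exp (l2_dist_sq f g / \<epsilon>\<^sup>2)) * (\<integral>\<^sup>+\<omega>. (indicator B (restrict (observation W \<epsilon> f \<omega>) J))\<^sup>2 \<partial>P)"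
    using B by (intro chi_bound_finite_coordinates f g J) auto
  also have "(\<lambda>\<omega>. (indicator B (restrict (observation W \<epsilon> f \<omega>) J))\<^sup>2) = (\<lambda>\<omega>. indicator B (restrict (observation W \<epsilon> f \<omega>) J) :: ennreal)"
    by (auto simp: indicator_def)
  finally show ?thesis unfolding eq by (simp add: ennreal_power flip: ennreal_mult)
qed

text \<open>This is why the approximation has to work under both laws at once: replacing
  \<open>A\<close> by a cylinder costs at most \<open>2 * e\<close> in the square on the left and
  \<open>C * e\<close> on the right.\<close>

lemma path_law_set:
  assumes f: "bounded_measurable f" and g: "bounded_measurable g"
    and A: "A \<in> sets (\<Pi>\<^sub>M t\<in>{0..1}. borel)"
  shows "(measure (path_law g) A)\<^sup>2 \<le> exp (l2_dist_sq f g / \<epsilon>\<^sup>2) * measure (path_law f) A"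
proof -
  interpret F: prob_space "path_law f" by (rule prob_space_path_law)
  interpret G: prob_space "path_law g" by (rule prob_space_path_law)
  define C where "C = exp (l2_dist_sq f g / \<epsilon>\<^sup>2)"
  have C: "0 \<le> C" by (simp add: C_def)
  have approx: "(measure (path_law g) A)\<^sup>2 \<le> C * measure (path_law f) A + (2 + C) * e" if e: "0 < e" for e
  proof -
    obtain J B where J: "finite J" "J \<subseteq> {0..1}" and B: "B \<in> sets (\<Pi>\<^sub>M t\<in>J. borel)"
      and d: "measure (path_law f) (sym_diff A (prod_emb {0..1} (\<lambda>_. borel) J B)) < e"
        "measure (path_law g) (sym_diff A (prod_emb {0..1} (\<lambda>_. borel) J B)) < e"
      using measurable_approx_by_cylinder[OF F.prob_space_axioms G.prob_space_axioms sets_path_law sets_path_law A e]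
      by metis
    let ?E = "prod_emb {0..1} (\<lambda>_. borel) J B :: (real \<Rightarrow> real) set"
    have E: "?E \<in> sets (\<Pi>\<^sub>M t\<in>{0..1}. borel)" using J B by (intro measurable_prod_emb)
    have close: "measure L X \<le> measure L Y + measure L (sym_diff X Y)"
      if "prob_space L" "X \<in> sets L" "Y \<in> sets L" for L and X Y :: "(real \<Rightarrow> real) set"
    proof -
      interpret L: prob_space L by fact
      have "measure L X \<le> measure L (Y \<union> sym_diff X Y)" using that by (intro L.finite_measure_mono) auto
      also have "\<dots> \<le> measure L Y + measure L (sym_diff X Y)" using that by (intro measure_Un_le) auto
      finally show ?thesis .
    qed
    let ?a = "measure (path_law g) A" and ?b = "measure (path_law g) ?E"
    have ab: "?a \<le> ?b + e"
      using close[OF G.prob_space_axioms, of A ?E] A E d(2) by (simp add: sets_path_law)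
    have "measure (path_law f) ?E \<le> measure (path_law f) A + e"
      using close[OF F.prob_space_axioms, of ?E A] A E d(1) by (simp add: sets_path_law Un_commute)
    then have Cb: "C * measure (path_law f) ?E \<le> C * (measure (path_law f) A + e)"
      using C by (rule mult_left_mono)
    have "?a\<^sup>2 - ?b\<^sup>2 = (?a + ?b) * (?a - ?b)" by (simp add: power2_eq_square algebra_simps)
    also have "\<dots> \<le> (?a + ?b) * e" using ab by (intro mult_left_mono) auto
    also have "\<dots> \<le> 2 * e"
    proof (rule mult_right_mono)
      have "?a \<le> 1" "?b \<le> 1" by (rule G.prob_le_1)+
      then show "?a + ?b \<le> 2" by linarith
    qed (use e in simp)
    finally have "?a\<^sup>2 \<le> ?b\<^sup>2 + 2 * e" by simp
    also have "?b\<^sup>2 \<le> C * measure (path_law f) ?E"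
      unfolding C_def by (rule path_law_cylinder[OF f g J B])
    finally show ?thesis using Cb by (simp add: algebra_simps)
  qed
  have "(measure (path_law g) A)\<^sup>2 \<le> C * measure (path_law f) A + e" if "0 < e" for e
    using approx[of "e / (2 + C)"] that C by simp
  then show ?thesis unfolding C_def by (rule field_le_epsilon)
qed

lemma risk_path_law:
  assumes "E \<in> estimators"
  shows "risk P W \<epsilon> T E f = (\<integral>\<^sup>+y. ennreal \<bar>E y - T f\<bar> \<partial>path_law f)"
proof -
  have [measurable]: "E \<in> borel_measurable (\<Pi>\<^sub>M t\<in>{0..1}. borel)" using assms by (simp add: estimators_def)
  show ?thesis unfolding risk_def path_law_def
    by (subst nn_integral_distr[OF measurable_observation]) auto
qed

text \<open>The error against \<open>T f\<close>, divided by the gap \<open>\<delta>\<close> and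
  truncated at 1, is a statistic with values in [0,1] and mean at most \<open>r / \<delta>\<close>
  under \<open>f\<close>. The change of drift bounds its mean under \<open>g\<close> by
  \<open>\<rho>\<close>. Whatever is missing there from the full gap is error against
  \<open>T g\<close>, by the triangle inequality.\<close>

lemma two_point_lower_bound:
  assumes f: "bounded_measurable f" and g: "bounded_measurable g" and E: "E \<in> estimators"
    and ne: "T g \<noteq> T f" and r: "risk P W \<epsilon> T E f \<le> ennreal r" "0 \<le> r"
    and \<rho>: "0 \<le> \<rho>" "exp (l2_dist_sq f g / \<epsilon>\<^sup>2) * r \<le> \<rho>\<^sup>2 * \<bar>T g - T f\<bar>"
  shows "ennreal (\<bar>T g - T f\<bar> * (1 - \<rho>)) \<le> risk P W \<epsilon> T E g"
proof -
  define \<delta> where "\<delta> = \<bar>T g - T f\<bar>"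
  have \<delta>: "0 < \<delta>" using ne by (simp add: \<delta>_def)
  interpret F: prob_space "path_law f" by (rule prob_space_path_law)
  interpret G: prob_space "path_law g" by (rule prob_space_path_law)
  have [measurable]: "E \<in> borel_measurable (\<Pi>\<^sub>M t\<in>{0..1}. borel)" using E by (simp add: estimators_def)
  define \<phi> where "\<phi> = (\<lambda>y. min 1 (\<bar>E y - T f\<bar> / \<delta>))"
  have m: "\<phi> \<in> borel_measurable (\<Pi>\<^sub>M t\<in>{0..1}. borel)" unfolding \<phi>_def by measurable
  have m': "\<phi> \<in> borel_measurable (path_law h)" for h
    using m measurable_cong_sets[OF sets_path_law refl] by blast
  have range: "0 \<le> \<phi> y" "\<phi> y \<le> 1" for y using \<delta> by (auto simp: \<phi>_def)
  have iF: "integrable (path_law f) \<phi>" by (rule F.integrable_const_bound[where B=1]) (use range m' in auto)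
  have iG: "integrable (path_law g) \<phi>" by (rule G.integrable_const_bound[where B=1]) (use range m' in auto)
  let ?C = "exp (l2_dist_sq f g / \<epsilon>\<^sup>2)"
  have sq: "(\<integral>y. \<phi> y \<partial>path_law g)\<^sup>2 \<le> ?C * (\<integral>y. \<phi> y \<partial>path_law f)"
    by (rule sq_le_of_layers[OF F.prob_space_axioms G.prob_space_axioms])
      (auto simp: sets_path_law path_law_set[OF f g] range m')
  have "ennreal (\<delta> * (\<integral>y. \<phi> y \<partial>path_law f)) = (\<integral>\<^sup>+y. ennreal (\<delta> * \<phi> y) \<partial>path_law f)"
    using iF \<delta> range by (subst nn_integral_eq_integral) auto
  also have "\<dots> \<le> risk P W \<epsilon> T E f"
    unfolding risk_path_law[OF E]
    using \<delta> by (intro nn_integral_mono ennreal_leI) (auto simp: \<phi>_def min_def field_simps)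
  also have "\<dots> \<le> ennreal r" by (rule r)
  finally have "\<delta> * (\<integral>y. \<phi> y \<partial>path_law f) \<le> r" using r(2) by simp
  then have "?C * (\<delta> * (\<integral>y. \<phi> y \<partial>path_law f)) \<le> ?C * r" by (intro mult_left_mono) auto
  also have "\<dots> \<le> \<rho>\<^sup>2 * \<delta>" using \<rho> by (simp add: \<delta>_def)
  finally have "\<delta> * (?C * (\<integral>y. \<phi> y \<partial>path_law f)) \<le> \<delta> * \<rho>\<^sup>2" by (simp add: mult_ac)
  then have "?C * (\<integral>y. \<phi> y \<partial>path_law f) \<le> \<rho>\<^sup>2" using \<delta> by simp
  then have le: "(\<integral>y. \<phi> y \<partial>path_law g) \<le> \<rho>" using sq \<rho>(1) by (meson order.trans power2_le_imp_le)
  have "ennreal (\<delta> * (1 - \<rho>)) \<le> ennreal (\<delta> * (1 - (\<integral>y. \<phi> y \<partial>path_law g)))"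
    using le \<delta> by (intro ennreal_leI) auto
  also have "\<delta> * (1 - (\<integral>y. \<phi> y \<partial>path_law g)) = (\<integral>y. \<delta> * (1 - \<phi> y) \<partial>path_law g)"
    using iG by (simp add: G.prob_space)
  also have "ennreal \<dots> = (\<integral>\<^sup>+y. ennreal (\<delta> * (1 - \<phi> y)) \<partial>path_law g)"
    using iG \<delta> range by (subst nn_integral_eq_integral) auto
  also have "\<dots> \<le> risk P W \<epsilon> T E g"
    unfolding risk_path_law[OF E]
  proof (intro nn_integral_mono ennreal_leI)
    fix y
    have "\<delta> * (1 - \<phi> y) = max 0 (\<delta> - \<bar>E y - T f\<bar>)" using \<delta> by (auto simp: \<phi>_def min_def max_def field_simps)
    then show "\<delta> * (1 - \<phi> y) \<le> \<bar>E y - T g\<bar>" by (auto simp: \<delta>_def)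
  qed
  finally show ?thesis by (simp add: \<delta>_def)
qed

end

section \<open>Two-point problems\<close>

lemma bounded_measurable_bound:
  assumes "bounded_measurable h"
  obtains B where "0 \<le> B" "\<And>x. x \<in> {0..1} \<Longrightarrow> \<bar>h x\<bar> \<le> B"
proof -
  obtain B where "\<forall>x\<in>{0..1}. \<bar>h x\<bar> \<le> B" using assms by (auto simp: bounded_measurable_def)
  moreover from this have "0 \<le> B" by (metis abs_ge_zero atLeastAtMost_iff order.trans order_refl zero_le_one)
  ultimately show ?thesis using that by blast
qed

text \<open>Dominated convergence: the step function takes the value of \<open>h\<close> at the
  right end of the cell, and this end tends to the point itself. The endpoints 0 and 1, where
  \<open>h\<close> need not be continuous, form a null set.\<close>

lemma integral_uniform_step_residual_tendsto_0:
  assumes h: "bounded_measurable h" and cont: "continuous_on {0<..<1} h"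
  shows "(\<lambda>n. \<integral>x. (h x - (\<Sum>i<n. h (real (Suc i) / real n) *
      indicator {real i / real n<..real (Suc i) / real n} x))\<^sup>2 \<partial>unit_lborel) \<longlonglongrightarrow> 0"
proof -
  obtain B where B0: "0 \<le> B" and B: "\<And>x. x \<in> {0..1} \<Longrightarrow> \<bar>h x\<bar> \<le> B"
    using bounded_measurable_bound[OF h] by blast
  define s where "s = (\<lambda>n x. \<Sum>i<n. h (real (Suc i) / real n) *
      indicator {real i / real n<..real (Suc i) / real n} x)"
  \<comment> \<open>The cells are open on the left, so the right end of the cell containing
    \<open>x\<close> is given by the ceiling of \<open>real n * x\<close>.\<close>
  have s: "s n x = h (real (nat \<lceil>real n * x\<rceil>) / real n)" "real (nat \<lceil>real n * x\<rceil>) \<le> real n"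
    if x: "0 < x" "x < 1" and n: "0 < n" for n x
  proof -
    define k where "k = nat \<lceil>real n * x\<rceil>"
    have nx: "0 < real n * x" "real n * x \<le> real n" using x n by (auto simp: mult_le_cancel_left1)
    then have k: "0 < k" "real k - 1 < real n * x" "real n * x \<le> real k"
      unfolding k_def by linarith+
    have "k \<le> n" using nx(2) unfolding k_def by (simp add: nat_le_iff ceiling_le_iff)
    then show "real (nat \<lceil>real n * x\<rceil>) \<le> real n" by (simp add: k_def)
    have ind: "indicator {real i / real n<..real (Suc i) / real n} x = (if i = k - 1 then 1 else (0::real))" for i
    proof -
      have "x \<in> {real i / real n<..real (Suc i) / real n} \<longleftrightarrow> real i < real n * x \<and> real n * x \<le> real (Suc i)"
        using n by (auto simp: field_simps)
      also have "\<dots> \<longleftrightarrow> i = k - 1"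
      proof
        assume *: "real i < real n * x \<and> real n * x \<le> real (Suc i)"
        then have "real i < real k" "real k < real (Suc i) + 1" using k by linarith+
        then show "i = k - 1" by linarith
      next
        assume "i = k - 1"
        then have "real i = real k - 1" using k(1) by (simp add: of_nat_diff)
        then show "real i < real n * x \<and> real n * x \<le> real (Suc i)" using k by simp
      qed
      finally show ?thesis by (simp add: indicator_def)
    qed
    have "s n x = (\<Sum>i<n. if i = k - 1 then h (real (Suc i) / real n) else 0)"
      unfolding s_def ind by (intro sum.cong) auto
    also have "\<dots> = h (real k / real n)" using k(1) \<open>k \<le> n\<close> by (subst sum.delta) auto
    finally show "s n x = h (real (nat \<lceil>real n * x\<rceil>) / real n)" by (simp add: k_def)
  qed
  have bms: "bounded_measurable (s n)" for n
  proof -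
    have "bounded_measurable (\<lambda>x. \<Sum>i<m. h (real (Suc i) / real n) * indicator {real i / real n<..real (Suc i) / real n} x)" for m
    proof (induction m)
      case 0 then show ?case by (simp add: bounded_measurable_const)
    next
      case (Suc m)
      then show ?case unfolding sum.lessThan_Suc
        by (intro bounded_measurable_intros bounded_measurable_indicator) auto
    qed
    then show ?thesis unfolding s_def .
  qed
  have AE01: "AE x in unit_lborel. 0 < x \<and> x < 1"
  proof -
    have "AE x in lborel. x \<in> {0..1} \<longrightarrow> 0 < x \<and> x < (1::real)"
      using AE_lborel_singleton[of 0] AE_lborel_singleton[of 1] by eventually_elim auto
    then show ?thesis by (subst AE_restrict_space_iff) auto
  qed
  have "(\<lambda>n. \<integral>x. (h x - s n x)\<^sup>2 \<partial>unit_lborel) \<longlonglongrightarrow> (\<integral>x. 0 \<partial>unit_lborel)"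
  proof (rule integral_dominated_convergence[where w="\<lambda>_. (2 * B)\<^sup>2"])
    show "(\<lambda>x. (h x - s n x)\<^sup>2) \<in> borel_measurable unit_lborel" for n
      using bounded_measurable_power2[OF bounded_measurable_diff[OF h bms[of n]]] by (simp add: bounded_measurable_def)
    show "AE x in unit_lborel. (\<lambda>n. (h x - s n x)\<^sup>2) \<longlonglongrightarrow> 0"
      using AE01
    proof eventually_elim
      case (elim x)
      have "(\<lambda>n. real (nat \<lceil>real n * x\<rceil>) / real n) \<longlonglongrightarrow> x"
      proof (rule tendsto_sandwich)
        show "\<forall>\<^sub>F n in sequentially. x \<le> real (nat \<lceil>real n * x\<rceil>) / real n"
          using eventually_gt_at_top[of 0]
        proof eventually_elim
          case (elim n)
          have "real n * x \<le> real (nat \<lceil>real n * x\<rceil>)" by linarith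
          then show ?case using elim by (simp add: field_simps)
        qed
        show "\<forall>\<^sub>F n in sequentially. real (nat \<lceil>real n * x\<rceil>) / real n \<le> x + 1 / real n"
          using eventually_gt_at_top[of 0]
        proof eventually_elim
          case (elim n)
          have "0 \<le> real n * x" using \<open>0 < x \<and> x < 1\<close> by simp
          then have "real (nat \<lceil>real n * x\<rceil>) \<le> real n * x + 1" by linarith
          then have "real (nat \<lceil>real n * x\<rceil>) / real n \<le> (real n * x + 1) / real n" by (intro divide_right_mono) auto
          also have "\<dots> = x + 1 / real n" using elim by (simp add: add_divide_distrib)
          finally show ?case .
        qed
        show "(\<lambda>n. x + 1 / real n) \<longlonglongrightarrow> x" using tendsto_add[OF tendsto_const lim_1_over_n, of x] by simp
      qed simp
      moreover have "isCont h x" using cont elim by (simp add: continuous_on_eq_continuous_at)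
      ultimately have "(\<lambda>n. h (real (nat \<lceil>real n * x\<rceil>) / real n)) \<longlonglongrightarrow> h x"
        by (rule isCont_tendsto_compose[rotated])
      moreover have "\<forall>\<^sub>F n in sequentially. h (real (nat \<lceil>real n * x\<rceil>) / real n) = s n x"
        using eventually_gt_at_top[of 0] by eventually_elim (use s elim in auto)
      ultimately have "(\<lambda>n. s n x) \<longlonglongrightarrow> h x" by (rule Lim_transform_eventually)
      then have "(\<lambda>n. (h x - s n x)\<^sup>2) \<longlonglongrightarrow> (h x - h x)\<^sup>2" by (intro tendsto_intros)
      then show ?case by simp
    qed
    show "AE x in unit_lborel. norm ((h x - s n x)\<^sup>2) \<le> (2 * B)\<^sup>2" for n
      using AE01
    proof eventually_elim
      case (elim x)
      have "\<bar>s n x\<bar> \<le> B"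
      proof (cases "n = 0")
        case True then show ?thesis using B0 by (simp add: s_def)
      next
        case False
        then obtain k :: nat where "s n x = h (real k / real n)" "real k \<le> real n"
          using s[of x n] elim by blast
        then show ?thesis using False by (auto intro!: B)
      qed
      moreover have "\<bar>h x\<bar> \<le> B" using elim by (intro B) auto
      ultimately have "\<bar>h x - s n x\<bar> \<le> 2 * B" by linarith
      then have "\<bar>h x - s n x\<bar>\<^sup>2 \<le> (2 * B)\<^sup>2" by (intro power_mono) auto
      then show ?case by simp
    qed
  qed auto
  then show ?thesis by (simp add: s_def)
qed

section \<open>Testing between two drifts\<close>

context white_noise
begin

lemma distributed_contrast:
  assumes t: "strict_mono_on {..n} t" "t ` {..n} \<subseteq> {0..1}"
    and v: "v = (\<Sum>i<n. (c i)\<^sup>2 * (t (Suc i) - t i))" "0 < v"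
  shows "distributed P lborel (\<lambda>\<omega>. \<Sum>i<n. c i * increment f t i \<omega>)
    (normal_density (\<Sum>i<n. c i * (drift f (t (Suc i)) - drift f (t i))) (\<epsilon> * sqrt v))"
proof -
  \<comment> \<open>Terms with coefficient 0 are degenerate and have no normal density, so they are
    removed before independent normal variables are summed.\<close>
  define I where "I = {i. i < n \<and> c i \<noteq> 0}"
  have I: "finite I" "I \<subseteq> {..<n}" by (auto simp: I_def)
  have dt: "0 < t (Suc i) - t i" if "i < n" for i using t(1) that by (auto simp: strict_mono_on_def)
  have "I \<noteq> {}"
  proof
    assume "I = {}"
    then have "c i = 0" if "i < n" for i using that by (auto simp: I_def)
    then show False using v by simp
  qed
  let ?s = "\<lambda>i. \<bar>c i\<bar> * (\<epsilon> * sqrt (t (Suc i) - t i))"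
  have ind: "indep_vars (\<lambda>_. borel) (\<lambda>i \<omega>. c i * increment f t i \<omega>) I"
    by (rule indep_vars_compose2[OF indep_vars_subset[OF indep_increments[OF t] I(2)]]) auto
  have D: "distributed P lborel (\<lambda>\<omega>. c i * increment f t i \<omega>)
     (normal_density (c i * (drift f (t (Suc i)) - drift f (t i))) (?s i))" if "i \<in> I" for i
    using normal_density_affine[OF distributed_increment[OF t, of i], of "c i" 0] that dt[of i] eps
    by (auto simp: I_def)
  have "distributed P lborel (\<lambda>\<omega>. \<Sum>i\<in>I. c i * increment f t i \<omega>)
    (normal_density (\<Sum>i\<in>I. c i * (drift f (t (Suc i)) - drift f (t i))) (sqrt (\<Sum>i\<in>I. (?s i)\<^sup>2)))"
    using \<open>I \<noteq> {}\<close> dt eps by (intro sum_indep_normal I ind D) (auto simp: I_def)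
  moreover have "(\<Sum>i\<in>I. u i) = (\<Sum>i<n. u i)" if "\<And>i. c i = 0 \<Longrightarrow> u i = 0" for u :: "nat \<Rightarrow> real"
    using that by (intro sum.mono_neutral_left) (auto simp: I_def)
  moreover have "sqrt (\<Sum>i<n. (?s i)\<^sup>2) = \<epsilon> * sqrt v"
  proof -
    have "(\<Sum>i<n. (?s i)\<^sup>2) = \<epsilon>\<^sup>2 * v"
      unfolding v sum_distrib_left using dt by (intro sum.cong) (auto simp: power_mult_distrib less_imp_le)
    then show ?thesis using eps by (simp add: real_sqrt_mult)
  qed
  ultimately show ?thesis by simp
qed

text \<open>With the cell averages of \<open>f - g\<close> as weights, \<open>S\<close> is the
  log-likelihood ratio of the increments up to an affine map. Its means under \<open>f\<close> and
  \<open>g\<close> differ by \<open>v\<close> and its variance is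
  \<open>\<epsilon>\<^sup>2 * v\<close>, so that with a threshold halfway an error requires a
  deviation of \<open>v/2\<close> from the mean.\<close>

lemma exists_two_point_test:
  assumes f: "bounded_measurable f" and g: "bounded_measurable g"
    and t: "strict_mono_on {..n} t" "t ` {..n} \<subseteq> {0..1}"
    and v: "v = (\<Sum>i<n. (drift (\<lambda>x. f x - g x) (t (Suc i)) - drift (\<lambda>x. f x - g x) (t i))\<^sup>2 / (t (Suc i) - t i))"
  shows "\<exists>E\<in>estimators. max (risk P W \<epsilon> T E f) (risk P W \<epsilon> T E g)
    \<le> ennreal (1/2 * \<bar>T f - T g\<bar> * exp (- v / (8 * \<epsilon>\<^sup>2)))"
proof -
  define h where "h = (\<lambda>x. f x - g x)"
  let ?d = "\<lambda>i. t (Suc i) - t i"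
  let ?D = "\<lambda>f i. drift f (t (Suc i)) - drift f (t i)"
  have d: "0 < ?d i" if "i < n" for i using t(1) that by (auto simp: strict_mono_on_def)
  have t01: "t i \<in> {0..1}" if "i \<le> n" for i using t(2) that by auto
  have v': "v = (\<Sum>i<n. (?D h i)\<^sup>2 / ?d i)" using v by (simp add: h_def)
  have v0: "0 \<le> v" unfolding v' by (intro sum_nonneg divide_nonneg_pos) (auto dest: d)
  show ?thesis
  proof (cases "v = 0")
    case True
    \<comment> \<open>The grid does not separate the drifts; the midpoint errs by half the gap under
      both.\<close>
    define E :: "(real \<Rightarrow> real) \<Rightarrow> real" where "E = (\<lambda>_. (T f + T g) / 2)"
    have "\<bar>(T f + T g) / 2 - T f\<bar> = 1/2 * \<bar>T f - T g\<bar>" "\<bar>(T f + T g) / 2 - T g\<bar> = 1/2 * \<bar>T f - T g\<bar>"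
      by (auto simp: field_simps abs_if)
    then have "risk P W \<epsilon> T E f = ennreal (1/2 * \<bar>T f - T g\<bar>)" "risk P W \<epsilon> T E g = ennreal (1/2 * \<bar>T f - T g\<bar>)"
      by (simp_all add: risk_def E_def emeasure_space_1)
    then show ?thesis using True by (intro bexI[of _ E]) (auto simp: E_def estimators_def)
  next
    case False
    then have vpos: "0 < v" using v0 by simp
    define c where "c = (\<lambda>i. ?D h i / ?d i)"
    have v1: "v = (\<Sum>i<n. (c i)\<^sup>2 * ?d i)"
      unfolding v' by (intro sum.cong) (auto simp: c_def power2_eq_square dest!: d)
    have v2: "v = (\<Sum>i<n. c i * ?D f i) - (\<Sum>i<n. c i * ?D g i)"
    proof -
      have "c i * ?D f i - c i * ?D g i = (?D h i)\<^sup>2 / ?d i" if "i < n" for i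
      proof -
        have "?D h i = ?D f i - ?D g i" using t01[of i] t01[of "Suc i"] that
          unfolding h_def by (simp add: drift_diff f g)
        then have "c i * ?D f i - c i * ?D g i = c i * ?D h i"
          by (simp only: right_diff_distrib[symmetric])
        then show ?thesis by (simp add: c_def power2_eq_square)
      qed
      then show ?thesis unfolding v' sum_subtractf[symmetric] by (intro sum.cong) auto
    qed
    define S where "S = (\<lambda>y::real \<Rightarrow> real. \<Sum>i<n. c i * (y (t (Suc i)) - y (t i)))"
    have S[measurable]: "S \<in> borel_measurable (\<Pi>\<^sub>M t\<in>{0..1}. borel)"
      unfolding S_def
    proof (intro borel_measurable_sum borel_measurable_times borel_measurable_diff borel_measurable_const)
      fix i assume "i \<in> {..<n}"
      then have "t i \<in> {0..1}" "t (Suc i) \<in> {0..1}" using t01 by auto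
      then show "(\<lambda>y. y (t (Suc i))) \<in> borel_measurable (\<Pi>\<^sub>M t\<in>{0..1}. borel)"
        "(\<lambda>y. y (t i)) \<in> borel_measurable (\<Pi>\<^sub>M t\<in>{0..1}. borel)"
        by (auto intro: measurable_component_singleton)
    qed
    define \<mu> where "\<mu> = (\<lambda>f. \<Sum>i<n. c i * ?D f i)"
    have D: "distributed P lborel (\<lambda>\<omega>. S (observation W \<epsilon> f \<omega>)) (normal_density (\<mu> f) (\<epsilon> * sqrt v))" for f
      using distributed_contrast[OF t v1 vpos, of f] by (simp add: S_def \<mu>_def increment_def)
    have D': "distributed P lborel (\<lambda>\<omega>. - S (observation W \<epsilon> f \<omega>)) (normal_density (- \<mu> f) (\<epsilon> * sqrt v))" for f
      using normal_density_affine[OF D, of "-1" 0 f] eps vpos by simp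
    have \<sigma>: "0 < \<epsilon> * sqrt v" using eps vpos by simp
    have tail: "1/2 * exp (- (v/2)\<^sup>2 / (2 * (\<epsilon> * sqrt v)\<^sup>2)) = 1/2 * exp (- v / (8 * \<epsilon>\<^sup>2))"
    proof -
      have "(\<epsilon> * sqrt v)\<^sup>2 = \<epsilon>\<^sup>2 * v" using vpos by (simp add: power_mult_distrib)
      then show ?thesis using vpos eps by (simp add: power2_eq_square[of v] power_divide)
    qed
    define m where "m = \<mu> f - v/2"
    have m: "m = \<mu> g + v/2" using v2 unfolding m_def \<mu>_def by linarith
    define E where "E = (\<lambda>y. if m < S y then T f else T g)"
    have E: "E \<in> estimators" unfolding estimators_def E_def by measurable
    have So[measurable]: "(\<lambda>\<omega>. S (observation W \<epsilon> f \<omega>)) \<in> borel_measurable P" for f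
      using measurable_compose[OF measurable_observation S] .
    have rf: "risk P W \<epsilon> T E f \<le> ennreal (1/2 * \<bar>T f - T g\<bar> * exp (- v / (8 * \<epsilon>\<^sup>2)))"
    proof -
      have "risk P W \<epsilon> T E f = (\<integral>\<^sup>+\<omega>. ennreal \<bar>T f - T g\<bar> * indicator {\<omega>\<in>space P. S (observation W \<epsilon> f \<omega>) \<le> \<mu> f - v/2} \<omega> \<partial>P)"
        unfolding risk_def by (intro nn_integral_cong) (auto simp: E_def m_def indicator_def abs_minus_commute)
      also have "\<dots> = ennreal \<bar>T f - T g\<bar> * ennreal (prob {\<omega>\<in>space P. S (observation W \<epsilon> f \<omega>) \<le> \<mu> f - v/2})"
        by (subst nn_integral_cmult_indicator) (auto simp: emeasure_eq_measure)
      also have "\<dots> \<le> ennreal \<bar>T f - T g\<bar> * ennreal (1/2 * exp (- v / (8 * \<epsilon>\<^sup>2)))"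
        using normal_lower_tail[OF D \<sigma>, of "v/2" f] v0 unfolding tail
        by (intro mult_left_mono ennreal_leI) auto
      finally show ?thesis by (simp add: mult_ac flip: ennreal_mult)
    qed
    have rg: "risk P W \<epsilon> T E g \<le> ennreal (1/2 * \<bar>T f - T g\<bar> * exp (- v / (8 * \<epsilon>\<^sup>2)))"
    proof -
      have "risk P W \<epsilon> T E g \<le> (\<integral>\<^sup>+\<omega>. ennreal \<bar>T f - T g\<bar> * indicator {\<omega>\<in>space P. - S (observation W \<epsilon> g \<omega>) \<le> - \<mu> g - v/2} \<omega> \<partial>P)"
        unfolding risk_def by (intro nn_integral_mono) (auto simp: E_def m indicator_def)
      also have "\<dots> = ennreal \<bar>T f - T g\<bar> * ennreal (prob {\<omega>\<in>space P. - S (observation W \<epsilon> g \<omega>) \<le> - \<mu> g - v/2})"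
        by (subst nn_integral_cmult_indicator) (auto simp: emeasure_eq_measure)
      also have "\<dots> \<le> ennreal \<bar>T f - T g\<bar> * ennreal (1/2 * exp (- v / (8 * \<epsilon>\<^sup>2)))"
        using normal_lower_tail[OF D' \<sigma>, of "v/2" g] v0 unfolding tail
        by (intro mult_left_mono ennreal_leI) auto
      finally show ?thesis by (simp add: mult_ac flip: ennreal_mult)
    qed
    show ?thesis using E rf rg by (intro bexI[of _ E]) auto
  qed
qed

text \<open>The left-hand side does not depend on the grid, so the loss \<open>r n\<close> from
  replacing \<open>f - g\<close> by a step function disappears in the limit of uniform
  grids.\<close>

lemma two_point_upper_bound:
  assumes f: "f \<in> convex_class" and g: "g \<in> convex_class"
  shows "(INF E\<in>estimators. max (risk P W \<epsilon> T E f) (risk P W \<epsilon> T E g))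
    \<le> ennreal (1/2 * \<bar>T f - T g\<bar> * exp (- l2_dist_sq f g / (8 * \<epsilon>\<^sup>2)))" (is "?R \<le> _")
proof -
  define h where "h = (\<lambda>x. f x - g x)"
  have bf: "bounded_measurable f" and bg: "bounded_measurable g"
    using f g by (auto intro: convex_class_bounded_measurable)
  have h: "bounded_measurable h" unfolding h_def by (intro bounded_measurable_intros bf bg)
  have "continuous_on {0<..<1} u" if "u \<in> convex_class" for u
    by (rule convex_on_continuous[OF _ convex_on_subset[OF convex_class_minimizer(1)[OF that]]]) auto
  then have cont: "continuous_on {0<..<1} h" unfolding h_def using f g by (intro continuous_on_diff) auto
  define r where "r = (\<lambda>n. \<integral>x. (h x - (\<Sum>i<n. h (real (Suc i) / real n) *
      indicator {real i / real n<..real (Suc i) / real n} x))\<^sup>2 \<partial>unit_lborel)"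
  have r: "r \<longlonglongrightarrow> 0"
    unfolding r_def by (rule integral_uniform_step_residual_tendsto_0[OF h cont])
  have bound: "?R \<le> ennreal (1/2 * \<bar>T f - T g\<bar> * exp (- (l2_dist_sq f g - r n) / (8 * \<epsilon>\<^sup>2)))" if n: "0 < n" for n
  proof -
    define t where "t = (\<lambda>i. real i / real n)"
    have t: "strict_mono_on {..n} t" "t ` {..n} \<subseteq> {0..1}"
      using n by (auto simp: t_def strict_mono_on_def divide_strict_right_mono)
    define v where "v = (\<Sum>i<n. (drift h (t (Suc i)) - drift h (t i))\<^sup>2 / (t (Suc i) - t i))"
    obtain E where E: "E \<in> estimators" "max (risk P W \<epsilon> T E f) (risk P W \<epsilon> T E g)
        \<le> ennreal (1/2 * \<bar>T f - T g\<bar> * exp (- v / (8 * \<epsilon>\<^sup>2)))"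
      using exists_two_point_test[OF bf bg t, of v T] by (auto simp: v_def h_def)
    have "l2_dist_sq f g - r n \<le> v"
      using sum_drift_increments_le(1)[OF h t, of "\<lambda>i. h (t (Suc i))"]
      by (simp add: v_def r_def l2_dist_sq_def h_def t_def)
    then have "- v / (8 * \<epsilon>\<^sup>2) \<le> - (l2_dist_sq f g - r n) / (8 * \<epsilon>\<^sup>2)" by (intro divide_right_mono) auto
    then have "1/2 * \<bar>T f - T g\<bar> * exp (- v / (8 * \<epsilon>\<^sup>2)) \<le> 1/2 * \<bar>T f - T g\<bar> * exp (- (l2_dist_sq f g - r n) / (8 * \<epsilon>\<^sup>2))"
      by (intro mult_left_mono) auto
    then have "ennreal (1/2 * \<bar>T f - T g\<bar> * exp (- v / (8 * \<epsilon>\<^sup>2))) \<le> ennreal (1/2 * \<bar>T f - T g\<bar> * exp (- (l2_dist_sq f g - r n) / (8 * \<epsilon>\<^sup>2)))"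
      by (rule ennreal_leI)
    then show ?thesis using E by (meson INF_lower2 order.trans)
  qed
  have lim: "(\<lambda>n. ennreal (1/2 * \<bar>T f - T g\<bar> * exp (- (l2_dist_sq f g - r n) / (8 * \<epsilon>\<^sup>2))))
    \<longlonglongrightarrow> ennreal (1/2 * \<bar>T f - T g\<bar> * exp (- (l2_dist_sq f g - 0) / (8 * \<epsilon>\<^sup>2)))"
    using eps by (intro tendsto_intros r) auto
  have ev: "\<forall>\<^sub>F n in sequentially. ?R \<le> ennreal (1/2 * \<bar>T f - T g\<bar> * exp (- (l2_dist_sq f g - r n) / (8 * \<epsilon>\<^sup>2)))"
    using eventually_gt_at_top[of 0] by eventually_elim (rule bound)
  from tendsto_lowerbound[OF lim ev] show ?thesis by simp
qed

lemma benchmark_le: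
  assumes f: "f \<in> convex_class"
    and b: "\<And>g. g \<in> convex_class \<Longrightarrow> 1/2 * \<bar>T f - T g\<bar> * exp (- l2_dist_sq f g / (8 * \<epsilon>\<^sup>2)) \<le> b"
  shows "benchmark P W T \<epsilon> f \<le> ennreal b"
  unfolding benchmark_def
proof (rule SUP_least)
  fix g assume g: "g \<in> convex_class"
  show "(INF E\<in>estimators. max (risk P W \<epsilon> T E f) (risk P W \<epsilon> T E g)) \<le> ennreal b"
    using two_point_upper_bound[OF f g, of T] ennreal_leI[OF b[OF g]] by (rule order.trans)
qed

text \<open>The bound \<open>b\<close> turns the hypothesis into an absolute bound on the risk at
  \<open>f\<close>, and the bound \<open>c\<close> turns the resulting lower bound at
  \<open>g\<close> into a multiple of its benchmark. Both benchmarks thus enter through upper bounds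
  only.\<close>

lemma superefficiency_penalty:
  assumes f: "f \<in> convex_class" and g: "g \<in> convex_class" and E: "E \<in> estimators"
    and \<gamma>: "0 \<le> \<gamma>" and r: "risk P W \<epsilon> T E f \<le> ennreal \<gamma> * benchmark P W T \<epsilon> f"
    and bf: "benchmark P W T \<epsilon> f \<le> ennreal b" "0 \<le> b"
    and bg: "benchmark P W T \<epsilon> g \<le> ennreal c" and k: "0 \<le> k"
    and ne: "T g \<noteq> T f"
    and \<rho>: "0 \<le> \<rho>" "exp (l2_dist_sq f g / \<epsilon>\<^sup>2) * (\<gamma> * b) \<le> \<rho>\<^sup>2 * \<bar>T g - T f\<bar>"
    and le: "k * c \<le> \<bar>T g - T f\<bar> * (1 - \<rho>)"
  shows "ennreal k * benchmark P W T \<epsilon> g \<le> risk P W \<epsilon> T E g"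
proof -
  have "risk P W \<epsilon> T E f \<le> ennreal \<gamma> * ennreal b" using r bf(1) by (meson mult_left_mono order.trans zero_le)
  then have "risk P W \<epsilon> T E f \<le> ennreal (\<gamma> * b)" using \<gamma> bf(2) by (simp add: ennreal_mult)
  then have *: "ennreal (\<bar>T g - T f\<bar> * (1 - \<rho>)) \<le> risk P W \<epsilon> T E g"
    using \<gamma> bf(2) by (intro two_point_lower_bound[OF convex_class_bounded_measurable[OF f] convex_class_bounded_measurable[OF g] E ne _ _ \<rho>]) auto
  have "ennreal k * benchmark P W T \<epsilon> g \<le> ennreal k * ennreal c" using bg by (rule mult_left_mono) simp
  also have "\<dots> = ennreal (k * c)" using k by (rule ennreal_mult'[symmetric])
  also have "\<dots> \<le> ennreal (\<bar>T g - T f\<bar> * (1 - \<rho>))" using le by (rule ennreal_leI)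
  also note *
  finally show ?thesis .
qed

end

section \<open>Upper bounds for the benchmarks\<close>

lemma exp_1_ge: "exp 1 \<ge> (2.7::real)"
  using abs_le_D2[OF e_approx_32] by simp

lemma mult_exp_uminus_le: "z * exp (- z) \<le> exp (- 1 :: real)"
proof -
  have "z \<le> exp (z - 1)" using exp_ge_add_one_self[of "z - 1"] by simp
  then have "z * exp (- z) \<le> exp (z - 1) * exp (- z)" by (intro mult_right_mono) auto
  also have "\<dots> = exp (- 1)" by (simp flip: exp_add)
  finally show ?thesis .
qed

lemma exp_minus_1_le: "exp (- 1) \<le> (10/27::real)"
  using exp_1_ge by (simp add: exp_minus field_simps)

text \<open>The maximum, at \<open>d = 2\<close>, is 2 exp (-1/2) = 1.213...; squaring reduces the
  claim to the maximum of \<open>z * exp (- z)\<close>.\<close>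

lemma mult_exp_square_le:
  fixes d :: real
  assumes "0 \<le> d" shows "d * exp (- d\<^sup>2 / 8) \<le> 61/50"
proof (rule power2_le_imp_le)
  have "(d * exp (- d\<^sup>2 / 8))\<^sup>2 = 4 * ((d\<^sup>2 / 4) * exp (- (d\<^sup>2 / 4)))"
    by (simp add: power_mult_distrib flip: exp_of_nat_mult)
  also have "\<dots> \<le> 4 * (10/27)"
    using mult_exp_uminus_le[of "d\<^sup>2 / 4"] exp_minus_1_le by linarith
  finally show "(d * exp (- d\<^sup>2 / 8))\<^sup>2 \<le> (61/50)\<^sup>2" by (simp add: power2_eq_square)
qed simp

text \<open>In the variable \<open>z = \<beta> * y\<close>, the maximum lies at z^3 = 1/3 and is (3
  e)^(-1/3) = 0.496...; cubing reduces it to the maximum of \<open>z * exp (- z)\<close>.\<close>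

lemma mult_exp_cube_le:
  fixes y \<beta> :: real
  assumes "0 \<le> y" "0 < \<beta>" shows "y * exp (- ((\<beta> * y) ^ 3)) \<le> 1 / (2 * \<beta>)"
proof -
  define z where "z = \<beta> * y"
  have "(z * exp (- (z ^ 3))) ^ 3 = (1/3) * ((3 * z ^ 3) * exp (- (3 * z ^ 3)))"
    by (simp add: power_mult_distrib flip: exp_of_nat_mult)
  also have "\<dots> \<le> (1/3) * (10/27)"
    using mult_exp_uminus_le[of "3 * z ^ 3"] exp_minus_1_le by linarith
  also have "\<dots> \<le> (1/2) ^ 3" by (simp add: power3_eq_cube)
  finally have "z * exp (- (z ^ 3)) \<le> 1/2" unfolding numeral_3_eq_3 by (rule power_le_imp_le_base) simp
  then show ?thesis using assms by (simp add: z_def field_simps)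
qed

section \<open>Wedges and displaced minimizers\<close>

lemma convex_on_chord:
  fixes f :: "real \<Rightarrow> real"
  assumes cv: "convex_on S f" and S: "a \<in> S" "c \<in> S" and abc: "a \<le> b" "b \<le> c"
  shows "(c - a) * f b \<le> (c - b) * f a + (b - a) * f c"
proof (cases "a = c")
  case False
  define l where "l = (b - a) / (c - a)"
  have l: "0 \<le> l" "l \<le> 1" "l * (c - a) = b - a" using abc False by (auto simp: l_def)
  then have "(1 - l) *\<^sub>R a + l *\<^sub>R c = b" by (simp add: algebra_simps)
  then have "f b \<le> (1 - l) * f a + l * f c" using convex_onD[OF cv l(1,2) S] by simp
  then have "(c - a) * f b \<le> (c - a) * ((1 - l) * f a + l * f c)" using abc by (intro mult_left_mono) auto
  also have "\<dots> = ((c - a) - l * (c - a)) * f a + (l * (c - a)) * f c" by (simp add: algebra_simps)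
  finally show ?thesis by (simp add: l(3))
qed (use abc in auto)

lemma convex_on_vee: "0 \<le> \<kappa> \<Longrightarrow> convex_on {0..1} (\<lambda>t::real. m + \<kappa> * \<bar>t - p\<bar>)"
proof (rule convex_onI)
  fix u x y :: real assume \<kappa>: "0 \<le> \<kappa>" and u: "0 < u" "u < 1"
  have "(1 - u) *\<^sub>R x + u *\<^sub>R y - p = (1 - u) * (x - p) + u * (y - p)" by (simp add: algebra_simps)
  also have "\<bar>\<dots>\<bar> \<le> \<bar>(1 - u) * (x - p)\<bar> + \<bar>u * (y - p)\<bar>" by (rule abs_triangle_ineq)
  also have "\<dots> = (1 - u) * \<bar>x - p\<bar> + u * \<bar>y - p\<bar>" using u by (simp add: abs_mult)
  finally have "\<kappa> * \<bar>(1 - u) *\<^sub>R x + u *\<^sub>R y - p\<bar> \<le> \<kappa> * ((1 - u) * \<bar>x - p\<bar> + u * \<bar>y - p\<bar>)"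
    using \<kappa> by (rule mult_left_mono)
  then show "m + \<kappa> * \<bar>(1 - u) *\<^sub>R x + u *\<^sub>R y - p\<bar> \<le> (1 - u) * (m + \<kappa> * \<bar>x - p\<bar>) + u * (m + \<kappa> * \<bar>y - p\<bar>)"
    by (simp add: algebra_simps)
qed simp

lemma convex_on_max_real:
  fixes f g :: "real \<Rightarrow> real"
  assumes f: "convex_on S f" and g: "convex_on S g"
  shows "convex_on S (\<lambda>t. max (f t) (g t))"
proof (rule convex_onI)
  fix u x y :: real assume u: "0 < u" "u < 1" and xy: "x \<in> S" "y \<in> S"
  have "(1 - u) * f x + u * f y \<le> (1 - u) * max (f x) (g x) + u * max (f y) (g y)"
    "(1 - u) * g x + u * g y \<le> (1 - u) * max (f x) (g x) + u * max (f y) (g y)"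
    using u by (auto intro!: add_mono mult_left_mono)
  then show "max (f ((1 - u) *\<^sub>R x + u *\<^sub>R y)) (g ((1 - u) *\<^sub>R x + u *\<^sub>R y))
      \<le> (1 - u) * max (f x) (g x) + u * max (f y) (g y)"
    using convex_onD[OF f, of u x y] convex_onD[OF g, of u x y] u xy by auto
qed (rule convex_on_imp_convex[OF f])

definition lift_to_vee :: "(real \<Rightarrow> real) \<Rightarrow> real \<Rightarrow> real \<Rightarrow> real \<Rightarrow> real \<Rightarrow> real" where
  "lift_to_vee f p m \<kappa> t = max (f t) (m + \<kappa> * \<bar>t - p\<bar>)"

text \<open>The wedge alone exceeds \<open>m\<close> off \<open>p\<close>, which makes the minimizer
  unique.\<close>

lemma lift_to_vee:
  assumes "f \<in> convex_class" "p \<in> {0..1}" "f p \<le> m" "0 < \<kappa>"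
  shows "lift_to_vee f p m \<kappa> \<in> convex_class" "minimizer (lift_to_vee f p m \<kappa>) = p"
    "minimum (lift_to_vee f p m \<kappa>) = m"
proof -
  have cv: "convex_on {0..1} (lift_to_vee f p m \<kappa>)"
    unfolding lift_to_vee_def using convex_class_minimizer(1)[OF assms(1)] convex_on_vee[of \<kappa>] assms(4)
    by (intro convex_on_max_real) auto
  have at: "lift_to_vee f p m \<kappa> p = m" using assms(3) by (simp add: lift_to_vee_def)
  have less: "lift_to_vee f p m \<kappa> p < lift_to_vee f p m \<kappa> t" if "t \<noteq> p" for t
    unfolding at using that assms(4) by (simp add: lift_to_vee_def less_max_iff_disj)
  show "lift_to_vee f p m \<kappa> \<in> convex_class" "minimizer (lift_to_vee f p m \<kappa>) = p"
    by (rule convex_classI[OF cv assms(2) less]; simp)+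
  have "minimum (lift_to_vee f p m \<kappa>) = lift_to_vee f p m \<kappa> p"
    by (rule convex_classI[OF cv assms(2) less]; simp)
  then show "minimum (lift_to_vee f p m \<kappa>) = m" by (simp add: at)
qed

text \<open>From the minimizer of \<open>f\<close> towards that of \<open>g\<close>,
  \<open>g\<close> does not rise, while \<open>f\<close> rises with slope at least \<open>A\<close>
  beyond the margin \<open>w\<close>, by convexity. Hence \<open>f - g\<close> expands on this
  stretch. The margin allows for functions whose growth is known only away from the
  minimizer.\<close>

lemma l2_dist_sq_minimizer:
  assumes f: "f \<in> convex_class" and g: "g \<in> convex_class" and A: "0 \<le> A" and w: "0 \<le> w"
    and growth: "\<And>t. t \<in> {0..1} \<Longrightarrow> w \<le> \<bar>t - minimizer f\<bar> \<Longrightarrow> minimum f + A * \<bar>t - minimizer f\<bar> \<le> f t"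
    and far: "w \<le> \<bar>minimizer g - minimizer f\<bar>"
  shows "A\<^sup>2 * (\<bar>minimizer g - minimizer f\<bar> - w) ^ 3 / 12 \<le> l2_dist_sq f g"
proof -
  let ?z = "minimizer f" and ?y = "minimizer g"
  note F = convex_class_minimizer[OF f] and G = convex_class_minimizer[OF g]
  have z: "0 \<le> ?z" "?z \<le> 1" and y: "0 \<le> ?y" "?y \<le> 1" using F(2) G(2) by auto
  define h where "h = (\<lambda>t. f t - g t)"
  have h: "bounded_measurable h"
    unfolding h_def by (intro bounded_measurable_intros convex_class_bounded_measurable f g)
  show ?thesis
  proof (cases "?z \<le> ?y")
    case True
    have "A\<^sup>2 * (?y - (?z + w)) ^ 3 / 12 \<le> (\<integral>t. (h t)\<^sup>2 \<partial>unit_lborel)"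
    proof (rule integral_sq_ge_of_expanding[OF h])
      fix t t' assume t: "?z + w \<le> t" "t < t'" "t' \<le> ?y"
      have t01: "0 \<le> t" "t' \<le> 1" "?z \<le> t" using t w z y by auto
      have "(t' - ?z) * f t \<le> (t' - t) * f ?z + (t - ?z) * f t'"
        using t t01 z by (intro convex_on_chord[OF F(1)]) auto
      moreover have "(t' - t) * (A * (t' - ?z)) \<le> (t' - t) * (f t' - minimum f)"
        using growth[of t'] t t01 z w by (intro mult_left_mono) auto
      ultimately have "(t' - ?z) * (A * (t' - t)) \<le> (t' - ?z) * (f t' - f t)"
        by (simp add: F(3) algebra_simps)
      then have 1: "A * (t' - t) \<le> f t' - f t" using t t01 by (simp add: mult_le_cancel_left_pos)
      have "(?y - t) * g t' \<le> (?y - t') * g t + (t' - t) * g ?y"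
        using t t01 y by (intro convex_on_chord[OF G(1)]) auto
      also have "\<dots> \<le> (?y - t') * g t + (t' - t) * g t"
        using G(4)[of t] t t01 by (intro add_left_mono mult_left_mono) (auto simp: G(3))
      also have "\<dots> = (?y - t) * g t" by (simp add: algebra_simps)
      finally have "g t' \<le> g t" using t by (simp add: mult_le_cancel_left_pos)
      with 1 show "A * (t' - t) \<le> \<bar>h t' - h t\<bar>" by (simp add: h_def)
    qed (use True far w z y A in auto)
    then show ?thesis using True by (simp add: l2_dist_sq_def h_def diff_diff_eq)
  next
    case False
    have "A\<^sup>2 * ((?z - w) - ?y) ^ 3 / 12 \<le> (\<integral>t. (h t)\<^sup>2 \<partial>unit_lborel)"
    proof (rule integral_sq_ge_of_expanding[OF h])
      fix t t' assume t: "?y \<le> t" "t < t'" "t' \<le> ?z - w"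
      have t01: "0 \<le> t" "t' \<le> 1" "t' \<le> ?z" using t w z y by auto
      have "(?z - t) * f t' \<le> (?z - t') * f t + (t' - t) * f ?z"
        using t t01 z by (intro convex_on_chord[OF F(1)]) auto
      moreover have "(t' - t) * (A * (?z - t)) \<le> (t' - t) * (f t - minimum f)"
        using growth[of t] t t01 z w by (intro mult_left_mono) auto
      ultimately have "(?z - t) * (A * (t' - t)) \<le> (?z - t) * (f t - f t')"
        by (simp add: F(3) algebra_simps)
      then have 1: "A * (t' - t) \<le> f t - f t'" using t t01 by (simp add: mult_le_cancel_left_pos)
      have "(t' - ?y) * g t \<le> (t' - t) * g ?y + (t - ?y) * g t'"
        using t t01 y by (intro convex_on_chord[OF G(1)]) auto
      also have "\<dots> \<le> (t' - t) * g t' + (t - ?y) * g t'"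
        using G(4)[of t'] t t01 by (intro add_right_mono mult_left_mono) (auto simp: G(3))
      also have "\<dots> = (t' - ?y) * g t'" by (simp add: algebra_simps)
      finally have "g t \<le> g t'" using t by (simp add: mult_le_cancel_left_pos)
      with 1 show "A * (t' - t) \<le> \<bar>h t' - h t\<bar>" by (simp add: h_def)
    qed (use False far w z y A in auto)
    moreover have "?z - w - ?y = \<bar>?y - ?z\<bar> - w" using False by simp
    ultimately show ?thesis unfolding l2_dist_sq_def h_def by (simp only:)
  qed
qed

context white_noise
begin

text \<open>A displacement \<open>y \<ge> w\<close> contributes at most y/2 exp (- A^2 (y - w)^3 /
  (96 \<epsilon>^2)), where 96 = 12 * 8. Of \<open>y\<close>, the part \<open>w\<close> is kept
  without using the exponential; the part \<open>y - w\<close> is controlled by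
  \<open>mult_exp_cube_le\<close>.\<close>

lemma benchmark_minimizer_le:
  assumes f: "f \<in> convex_class" and A: "0 \<le> A" and w: "0 \<le> w" and \<beta>: "0 < \<beta>" "96 * \<epsilon>\<^sup>2 * \<beta> ^ 3 \<le> A\<^sup>2"
    and growth: "\<And>t. t \<in> {0..1} \<Longrightarrow> w \<le> \<bar>t - minimizer f\<bar> \<Longrightarrow> minimum f + A * \<bar>t - minimizer f\<bar> \<le> f t"
  shows "benchmark P W minimizer \<epsilon> f \<le> ennreal (w / 2 + 1 / (4 * \<beta>))"
proof (rule benchmark_le[OF f])
  fix g assume g: "g \<in> convex_class"
  define y where "y = \<bar>minimizer f - minimizer g\<bar>"
  define e where "e = exp (- l2_dist_sq f g / (8 * \<epsilon>\<^sup>2))"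
  have e: "0 \<le> e" "e \<le> 1" using l2_dist_sq_nonneg[of f g] by (auto simp: e_def)
  have "1/2 * y * e \<le> w / 2 + 1 / (4 * \<beta>)"
  proof (cases "w \<le> y")
    case False
    then have "y * e \<le> w * 1" using e w by (intro mult_mono) auto
    moreover have "0 \<le> 1 / (4 * \<beta>)" using \<beta> by simp
    ultimately show ?thesis by linarith
  next
    case True
    then have far: "w \<le> \<bar>minimizer g - minimizer f\<bar>" by (simp add: y_def abs_minus_commute)
    have "(\<beta> * (y - w)) ^ 3 = (96 * \<epsilon>\<^sup>2 * \<beta> ^ 3) * (y - w) ^ 3 / (96 * \<epsilon>\<^sup>2)"
      using eps by (simp add: power_mult_distrib)
    also have "\<dots> \<le> A\<^sup>2 * (y - w) ^ 3 / (96 * \<epsilon>\<^sup>2)"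
      using True \<beta> by (intro divide_right_mono mult_right_mono) auto
    also have "\<dots> = (A\<^sup>2 * (y - w) ^ 3 / 12) / (8 * \<epsilon>\<^sup>2)" by simp
    also have "\<dots> \<le> l2_dist_sq f g / (8 * \<epsilon>\<^sup>2)"
      using l2_dist_sq_minimizer[OF f g A w growth far]
      by (intro divide_right_mono) (auto simp: y_def abs_minus_commute)
    finally have "e \<le> exp (- ((\<beta> * (y - w)) ^ 3))" by (simp add: e_def)
    then have "(y - w) * e \<le> (y - w) * exp (- ((\<beta> * (y - w)) ^ 3))" using True by (intro mult_left_mono) auto
    also have "\<dots> \<le> 1 / (2 * \<beta>)" using True \<beta> by (intro mult_exp_cube_le) auto
    finally have "(y - w) * e \<le> 1 / (2 * \<beta>)" .
    moreover have "w * e \<le> w" using w e by (simp add: mult_left_le)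
    moreover have "y * e = w * e + (y - w) * e" by (simp add: algebra_simps)
    moreover have "1 / (4 * \<beta>) = (1 / (2 * \<beta>)) / 2" by simp
    ultimately show ?thesis by linarith
  qed
  then show "1/2 * \<bar>minimizer f - minimizer g\<bar> * exp (- l2_dist_sq f g / (8 * \<epsilon>\<^sup>2)) \<le> w / 2 + 1 / (4 * \<beta>)"
    by (simp add: y_def e_def)
qed

text \<open>Here \<open>v\<close> is the quadratic distance in units of \<open>\<epsilon>\<close>,
  and the hypothesis on \<open>fill\<close> says how far the minimum can move within it. Linear
  growth in \<open>v\<close> is beaten by exp (- v^2 / 8). The factor 11/8 is half of the 11/4 lost
  in the comparison with \<open>fill\<close>.\<close>

lemma benchmark_minimum_le:
  assumes f: "f \<in> convex_class" and a: "0 \<le> a" and b: "0 \<le> b"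
    and fill: "\<And>m v. 0 \<le> m \<Longrightarrow> 0 \<le> v \<Longrightarrow> fill f m \<le> (\<epsilon> * v)\<^sup>2 \<Longrightarrow> m \<le> max c (a * v + b)"
    and c: "c \<le> d" "61/50 * a + b \<le> d" "0 \<le> d"
  shows "benchmark P W minimum \<epsilon> f \<le> ennreal (11/8 * d)"
proof (rule benchmark_le[OF f])
  fix g assume g: "g \<in> convex_class"
  define m where "m = 4/11 * \<bar>minimum f - minimum g\<bar>"
  define v where "v = sqrt (l2_dist_sq f g) / \<epsilon>"
  have v: "0 \<le> v" "(\<epsilon> * v)\<^sup>2 = l2_dist_sq f g" "v\<^sup>2 / 8 = l2_dist_sq f g / (8 * \<epsilon>\<^sup>2)"
    using eps l2_dist_sq_nonneg[of f g] by (auto simp: v_def power_divide)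
  have "fill f m \<le> (\<epsilon> * v)\<^sup>2" unfolding v(2) m_def by (rule fill_le_l2_dist_sq[OF f g])
  then have m: "m \<le> max c (a * v + b)" using v by (intro fill) (auto simp: m_def)
  let ?e = "exp (- v\<^sup>2 / 8)"
  have e: "0 \<le> ?e" "?e \<le> 1" by auto
  have "m * ?e \<le> d"
  proof (cases "m \<le> c")
    case True
    have "m * ?e \<le> d * 1" using True c e by (intro mult_mono) auto
    then show ?thesis by simp
  next
    case False
    then have "m * ?e \<le> (a * v + b) * ?e" using m by (intro mult_right_mono) auto
    also have "\<dots> = a * (v * ?e) + b * ?e" by (simp add: algebra_simps)
    also have "\<dots> \<le> a * (61/50) + b * 1"
      using a b e mult_exp_square_le[OF v(1)] by (intro add_mono mult_left_mono) auto
    finally show ?thesis using c by simp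
  qed
  moreover have "- l2_dist_sq f g / (8 * \<epsilon>\<^sup>2) = - v\<^sup>2 / 8" using v(3) by simp
  ultimately have "m * exp (- l2_dist_sq f g / (8 * \<epsilon>\<^sup>2)) \<le> d" by (simp only:)
  then show "1/2 * \<bar>minimum f - minimum g\<bar> * exp (- l2_dist_sq f g / (8 * \<epsilon>\<^sup>2)) \<le> 11/8 * d"
    by (simp add: m_def)
qed

end

section \<open>Superefficiency\<close>

text \<open>
  \<open>x\<close> is nearly the largest distance from the minimizer at which \<open>f\<close> exceeds its minimum by at most
  \<open>sqrt (\<tau> / x)\<close>. That supremum need not be attained, as \<open>f\<close> may jump at \<open>0\<close> and \<open>1\<close>, hence the factor
  \<open>1.02\<^sup>2 = 1.0404\<close>; its power \<open>3/2\<close> is \<open>1.02\<^sup>3 = 1.061208\<close>.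
\<close>

lemma exists_scale:
  assumes f: "f \<in> convex_class" and \<tau>: "0 < \<tau>"
  obtains x p where "0 < x" "p \<in> {0..1}" "\<bar>p - minimizer f\<bar> = x" "f p \<le> minimum f + sqrt (\<tau> / x)"
    "\<And>t. t \<in> {0..1} \<Longrightarrow> (10404/10000) * x \<le> \<bar>t - minimizer f\<bar> \<Longrightarrow>
      minimum f + sqrt (\<tau> / x) / ((1061208/1000000) * x) * \<bar>t - minimizer f\<bar> \<le> f t"
proof -
  let ?z = "minimizer f" and ?m = "minimum f"
  note F = convex_class_minimizer[OF f]
  have z: "0 \<le> ?z" "?z \<le> 1" using F(2) by auto
  define S where "S = {x. 0 < x \<and> (\<exists>t\<in>{0..1}. \<bar>t - ?z\<bar> = x \<and> f t \<le> ?m + sqrt (\<tau> / x))}"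
  obtain B where B: "0 \<le> B" "\<And>t. t \<in> {0..1} \<Longrightarrow> \<bar>f t\<bar> \<le> B"
    using bounded_measurable_bound[OF convex_class_bounded_measurable[OF f]] by blast
  have ne: "\<exists>x. x \<in> S"
  proof -
    \<comment> \<open>As \<open>f\<close> is bounded by \<open>B\<close>, every attainable distance
      with \<open>2 * B \<le> sqrt (\<tau> / x)\<close> belongs to \<open>S\<close>; the summand 1
      guards against \<open>B = 0\<close>, and a distance of at most 1/2 leaves room on one side of
      the minimizer.\<close>
    define x where "x = min (1/2) (\<tau> / (4 * B\<^sup>2 + 1))"
    define t where "t = (if ?z \<le> 1/2 then ?z + x else ?z - x)"
    have pos: "0 < 4 * B\<^sup>2 + 1" by (intro add_nonneg_pos) auto
    have x: "0 < x" using \<tau> pos by (simp add: x_def)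
    have x': "x \<le> 1/2" "x \<le> \<tau> / (4 * B\<^sup>2 + 1)"
      unfolding x_def by (rule min.cobounded1, rule min.cobounded2)
    have t: "t \<in> {0..1}" "\<bar>t - ?z\<bar> = x" using x x' z by (auto simp: t_def)
    have "x * (4 * B\<^sup>2 + 1) \<le> \<tau>" using x'(2) pos by (simp add: pos_le_divide_eq)
    then have "(2 * B)\<^sup>2 * x \<le> \<tau>" using x by (simp add: power_mult_distrib algebra_simps)
    then have "(2 * B)\<^sup>2 \<le> \<tau> / x" using x by (simp add: pos_le_divide_eq)
    then have "2 * B \<le> sqrt (\<tau> / x)" by (rule real_le_rsqrt)
    moreover have "f t \<le> B" "- B \<le> ?m" using B(2)[OF t(1)] B(2)[OF F(2)] by (auto simp: F(3))
    ultimately show ?thesis using t x by (intro exI[of _ x]) (auto simp: S_def)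
  qed
  have S1: "x \<le> 1" if "x \<in> S" for x using that z by (auto simp: S_def)
  have bdd: "bdd_above S" by (rule bdd_aboveI[of _ 1]) (rule S1)
  obtain x0 where x0: "x0 \<in> S" using ne by blast
  have "0 < x0" using x0 by (simp add: S_def)
  also have "x0 \<le> Sup S" using x0 bdd by (rule cSup_upper)
  finally have D: "0 < Sup S" .
  then have "Sup S / (10404/10000) < Sup S" by simp
  then obtain x where x: "x \<in> S" "Sup S / (10404/10000) < x"
    using less_cSupD[of S] x0 by blast
  have xpos: "0 < x" using x by (simp add: S_def)
  obtain p where p: "p \<in> {0..1}" "\<bar>p - ?z\<bar> = x" "f p \<le> ?m + sqrt (\<tau> / x)"
    using x(1) by (auto simp: S_def)
  define w where "w = (10404/10000) * x"
  have w: "0 < w" using xpos by (simp add: w_def)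
  have "w \<notin> S"
  proof
    assume "w \<in> S"
    then have "w \<le> Sup S" using bdd by (rule cSup_upper)
    then show False using x(2) by (simp add: w_def)
  qed
  have sqw: "sqrt (\<tau> / w) = sqrt (\<tau> / x) / (102/100)"
  proof -
    have "sqrt (10404/10000) = sqrt (((102/100))\<^sup>2)" by (simp add: power2_eq_square)
    then have "sqrt (10404/10000) = ((102/100)::real)" by simp
    then show ?thesis by (simp add: w_def real_sqrt_divide real_sqrt_mult)
  qed
  have growth: "?m + sqrt (\<tau> / x) / ((1061208/1000000) * x) * \<bar>t - ?z\<bar> \<le> f t"
    if t: "t \<in> {0..1}" "(10404/10000) * x \<le> \<bar>t - ?z\<bar>" for t
  proof -
    define d where "d = \<bar>t - ?z\<bar>"
    have d: "0 < d" "w \<le> d" using t w by (auto simp: d_def w_def)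
    define u where "u = w / d"
    have u: "0 \<le> u" "u \<le> 1" using w d by (auto simp: u_def)
    \<comment> \<open>\<open>t\<close> is drawn towards the minimizer until its distance is
      \<open>w\<close>. Since \<open>w\<close> is not in \<open>S\<close>, \<open>f\<close> is high
      at that point, and convexity carries the slope on to \<open>t\<close>.\<close>
    define t0 where "t0 = (1 - u) *\<^sub>R ?z + u *\<^sub>R t"
    have t0: "t0 \<in> {0..1}" unfolding t0_def
      using convexD[of "{0..1::real}" ?z t "1 - u" u] F(2) t u by auto
    have "t0 - ?z = u * (t - ?z)" by (simp add: t0_def algebra_simps)
    then have "\<bar>t0 - ?z\<bar> = w" using u d by (simp add: abs_mult d_def[symmetric]) (simp add: u_def)
    then have "?m + sqrt (\<tau> / w) < f t0" using \<open>w \<notin> S\<close> t0 w by (force simp: S_def)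
    also have "f t0 \<le> (1 - u) * ?m + u * f t"
      unfolding t0_def using convex_onD[OF F(1) u F(2) t(1)] by (simp add: F(3))
    finally have "sqrt (\<tau> / w) < u * (f t - ?m)" by (simp add: algebra_simps)
    then have "sqrt (\<tau> / w) * d < u * (f t - ?m) * d" using d by simp
    also have "\<dots> = w * (f t - ?m)" using d by (simp add: u_def)
    finally have "sqrt (\<tau> / w) * d / w < f t - ?m" using w by (simp add: pos_divide_less_eq mult.commute)
    moreover have "sqrt (\<tau> / w) * d / w = sqrt (\<tau> / x) / ((1061208/1000000) * x) * d"
      unfolding sqw unfolding w_def by (simp add: field_simps)
    ultimately show ?thesis by (simp add: d_def)
  qed
  show ?thesis using that[OF xpos p] growth by blast
qed

text \<open>In units of \<open>x\<close> and \<open>\<Delta>\<close>, at distance z from the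
  minimizer, the wedge is at most 4/3 + z/3 above the minimum of \<open>f\<close>, while
  \<open>f\<close> is at least 0 above it and, from z = 1.0404 on, at least 0.9423 z. The gap is
  thus at most 1.6802 up to 1.0404, at most 0.7 up to 2.19, and 0 afterwards. The squares integrate
  to about 7, below 125/16.\<close>

lemma l2_dist_sq_lift_to_vee_le:
  assumes f: "f \<in> convex_class" and x: "0 < x" and p: "p \<in> {0..1}" "\<bar>p - minimizer f\<bar> = x"
    and \<Delta>: "0 < \<Delta>" and fp: "f p \<le> minimum f + \<Delta>"
    and growth: "\<And>t. t \<in> {0..1} \<Longrightarrow> (10404/10000) * x \<le> \<bar>t - minimizer f\<bar> \<Longrightarrow>
      minimum f + \<Delta> / ((1061208/1000000) * x) * \<bar>t - minimizer f\<bar> \<le> f t"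
  shows "l2_dist_sq f (lift_to_vee f p (minimum f + \<Delta>) (\<Delta> / (3 * x))) \<le> 125/16 * (\<Delta>\<^sup>2 * x)"
proof -
  let ?z = "minimizer f" and ?m = "minimum f"
  define g where "g = lift_to_vee f p (?m + \<Delta>) (\<Delta> / (3 * x))"
  have g: "g \<in> convex_class" unfolding g_def using \<Delta> x by (intro lift_to_vee f p fp) auto
  let ?A = "{?z - (219/100) * x..?z + (219/100) * x}" and ?B = "{?z - (10404/10000) * x..?z + (10404/10000) * x}"
  note bm = bounded_measurable_intros bounded_measurable_indicator
    convex_class_bounded_measurable[OF f] convex_class_bounded_measurable[OF g]
  have pw: "(f t - g t)\<^sup>2 \<le> \<Delta>\<^sup>2 * ((49/100) * indicator ?A t + (23331/10000) * indicator ?B t)" if t: "t \<in> {0..1}" for t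
  proof -
    define z where "z = \<bar>t - ?z\<bar> / x"
    have zx: "\<bar>t - ?z\<bar> = z * x" using x by (simp add: z_def)
    have z0: "0 \<le> z" using x by (simp add: z_def)
    define T where "T = max 0 (?m + \<Delta> + \<Delta> / (3 * x) * \<bar>t - p\<bar> - f t)"
    have gT: "\<bar>f t - g t\<bar> = T" by (auto simp: g_def lift_to_vee_def T_def)
    then have eq: "(f t - g t)\<^sup>2 = T\<^sup>2" by (metis power2_abs)
    have "\<bar>t - p\<bar> \<le> z * x + x" using zx p(2) by linarith
    then have "\<Delta> / (3 * x) * \<bar>t - p\<bar> \<le> \<Delta> / (3 * x) * (z * x + x)" using \<Delta> x by (intro mult_left_mono) auto
    also have "\<dots> = \<Delta> * (1/3 + z/3)" using x by (simp add: field_simps)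
    finally have le: "?m + \<Delta> + \<Delta> / (3 * x) * \<bar>t - p\<bar> \<le> ?m + \<Delta> * (4/3 + z/3)" by (simp add: algebra_simps)
    have T0: "0 \<le> T" by (simp add: T_def)
    have inA: "t \<in> ?A" if "z \<le> (219/100)"
    proof -
      have "z * x \<le> (219/100) * x" using that x by (intro mult_right_mono) auto
      then show ?thesis using zx by auto
    qed
    have inB: "t \<in> ?B" if "z \<le> (10404/10000)"
    proof -
      have "z * x \<le> (10404/10000) * x" using that x by (intro mult_right_mono) auto
      then show ?thesis using zx by auto
    qed
    consider "z \<le> (10404/10000)" | "(10404/10000) < z" "z \<le> (219/100)" | "(219/100) < z" by linarith
    then show ?thesis
    proof cases
      case 1
      have "\<Delta> * (4/3 + z/3) \<le> \<Delta> * (16802/10000)" using 1 \<Delta> by (intro mult_left_mono) auto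
      then have "?m + \<Delta> + \<Delta> / (3 * x) * \<bar>t - p\<bar> - f t \<le> \<Delta> * (16802/10000)"
        using le convex_class_minimizer(4)[OF f t] by linarith
      then have "T \<le> \<Delta> * (16802/10000)"
        unfolding T_def by (rule max.boundedI[rotated]) (use \<Delta> in simp)
      then have "T\<^sup>2 \<le> (\<Delta> * (16802/10000))\<^sup>2" using T0 by (intro power_mono)
      also have "\<dots> \<le> \<Delta>\<^sup>2 * (28231/10000)"
        unfolding power_mult_distrib by (intro mult_left_mono) (auto simp: power2_eq_square)
      finally have "T\<^sup>2 \<le> \<Delta>\<^sup>2 * (28231/10000)" .
      moreover have "t \<in> ?A" by (rule inA) (use 1 in linarith)
      moreover have "t \<in> ?B" by (rule inB[OF 1])
      ultimately show ?thesis unfolding eq by simp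
    next
      case 2
      have "\<Delta> * ((9423/10000) * z) \<le> \<Delta> / ((1061208/1000000) * x) * \<bar>t - ?z\<bar>"
        using \<Delta> x z0 unfolding zx by (simp add: field_simps)
      then have "?m + \<Delta> * ((9423/10000) * z) \<le> f t" using growth[OF t] 2 x zx by auto
      then have "T \<le> max 0 (\<Delta> * (4/3 + z/3) - \<Delta> * ((9423/10000) * z))" using le unfolding T_def by linarith
      also have "\<Delta> * (4/3 + z/3) - \<Delta> * ((9423/10000) * z) = \<Delta> * (4/3 + z/3 - (9423/10000) * z)"
        by (simp add: algebra_simps)
      also have "\<Delta> * (4/3 + z/3 - (9423/10000) * z) \<le> \<Delta> * (7/10)" using 2 \<Delta> by (intro mult_left_mono) auto
      finally have "T \<le> \<Delta> * (7/10)" using \<Delta> by simp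
      then have "T\<^sup>2 \<le> (\<Delta> * (7/10))\<^sup>2" using T0 by (intro power_mono)
      also have "\<dots> = \<Delta>\<^sup>2 * (49/100)" by (simp add: power2_eq_square)
      finally have "T\<^sup>2 \<le> \<Delta>\<^sup>2 * (49/100)" .
      also have "\<dots> \<le> \<Delta>\<^sup>2 * ((49/100) * indicator ?A t + (23331/10000) * indicator ?B t)"
        using inA 2 by (intro mult_left_mono) auto
      finally show ?thesis unfolding eq .
    next
      case 3
      have "\<Delta> * ((9423/10000) * z) \<le> \<Delta> / ((1061208/1000000) * x) * \<bar>t - ?z\<bar>"
        using \<Delta> x z0 unfolding zx by (simp add: field_simps)
      then have "?m + \<Delta> * ((9423/10000) * z) \<le> f t" using growth[OF t] 3 x zx by auto
      moreover have "\<Delta> * (4/3 + z/3) \<le> \<Delta> * ((9423/10000) * z)" using 3 \<Delta> by (intro mult_left_mono) auto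
      ultimately have "T = 0" using le by (simp add: T_def)
      then show ?thesis unfolding eq by simp
    qed
  qed
  have "l2_dist_sq f g \<le> (\<integral>t. \<Delta>\<^sup>2 * ((49/100) * indicator ?A t + (23331/10000) * indicator ?B t) \<partial>unit_lborel)"
    unfolding l2_dist_sq_def
    by (intro integral_mono integrable_bounded_measurable bm) (use pw in auto)
  also have "\<dots> = \<Delta>\<^sup>2 * ((49/100) * (\<integral>t. indicator ?A t \<partial>unit_lborel) + (23331/10000) * (\<integral>t. indicator ?B t \<partial>unit_lborel))"
  proof -
    have i: "integrable unit_lborel (indicator ?A :: real \<Rightarrow> real)" "integrable unit_lborel (indicator ?B :: real \<Rightarrow> real)"
      by (intro integrable_bounded_measurable bm; simp)+
    show ?thesis
      unfolding integral_mult_right_zero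
      by (subst Bochner_Integration.integral_add)
        (use i in \<open>auto simp only: integral_mult_right_zero intro!: integrable_mult_right\<close>)
  qed
  also have "\<dots> \<le> \<Delta>\<^sup>2 * ((49/100) * ((?z + (219/100) * x) - (?z - (219/100) * x)) + (23331/10000) * ((?z + (10404/10000) * x) - (?z - (10404/10000) * x)))"
    using x by (intro mult_left_mono add_mono integral_indicator_unit_le) auto
  also have "\<dots> \<le> \<Delta>\<^sup>2 * (125/16 * x)" using x by (intro mult_left_mono) auto
  finally show ?thesis by (simp add: g_def mult_ac)
qed

text \<open>All four rest on \<gamma> < 1/10: the first through ln 10 > 9/4 > 1.31^3, and the two
  products are \<gamma>^(3/4) and \<gamma>^(1/2).\<close>

lemma log_inverse_bounds:
  fixes \<gamma> :: real
  assumes \<gamma>: "0 < \<gamma>" "\<gamma> < 1/10"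
  shows "131/100 \<le> ln (1 / \<gamma>) powr (1/3)" "(ln (1 / \<gamma>) powr (1/3)) ^ 3 = ln (1 / \<gamma>)"
    "exp (ln (1 / \<gamma>) / 4) * \<gamma> \<le> (178/1000)" "exp (ln (1 / \<gamma>) / 2) * \<gamma> \<le> (3163/10000)"
proof -
  define L where "L = ln (1 / \<gamma>)"
  have "exp (9/4 :: real) ^ 4 = exp 1 ^ 9" by (simp flip: exp_of_nat_mult)
  also have "\<dots> \<le> (272/100) ^ 9" using e_less_272 by (intro power_mono) auto
  also have "\<dots> \<le> (10::real) ^ 4" by (simp add: power_divide)
  finally have e: "exp (9/4 :: real) \<le> 10" by (subst (asm) power_mono_iff) auto
  have "10 < 1 / \<gamma>" using \<gamma> by (simp add: field_simps)
  then have "exp (9/4) \<le> 1 / \<gamma>" using e by linarith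
  then have L: "9/4 \<le> L" unfolding L_def using \<gamma> by (subst ln_ge_iff) auto
  show cube: "(ln (1 / \<gamma>) powr (1/3)) ^ 3 = ln (1 / \<gamma>)"
    using L unfolding L_def[symmetric] by (simp add: powr_power)
  have "(131/100) ^ 3 \<le> L" using L by (simp add: power3_eq_cube)
  then have "(131/100) ^ 3 \<le> (ln (1 / \<gamma>) powr (1/3)) ^ 3" by (simp only: cube L_def)
  then show "131/100 \<le> ln (1 / \<gamma>) powr (1/3)" by (subst (asm) power_mono_iff) auto
  have eL: "exp L = 1 / \<gamma>" using \<gamma> by (simp add: L_def)
  have "(exp (L / 4) * \<gamma>) ^ 4 = exp L * \<gamma> ^ 4" by (simp add: power_mult_distrib flip: exp_of_nat_mult)
  also have "\<dots> = \<gamma> ^ 3" using \<gamma> by (simp add: eL power_eq_if)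
  also have "\<dots> \<le> (1/10) ^ 3" using \<gamma> by (intro power_mono) auto
  also have "\<dots> \<le> (178/1000) ^ 4" by (simp add: power_eq_if)
  finally show "exp (ln (1 / \<gamma>) / 4) * \<gamma> \<le> (178/1000)"
    unfolding L_def[symmetric] using \<gamma> by (subst (asm) power_mono_iff) auto
  have "(exp (L / 2) * \<gamma>)\<^sup>2 = exp L * \<gamma>\<^sup>2" by (simp add: power_mult_distrib flip: exp_of_nat_mult)
  also have "\<dots> = \<gamma>" using \<gamma> by (simp add: eL power2_eq_square)
  also have "\<dots> \<le> (3163/10000)\<^sup>2" using \<gamma> by (simp add: power2_eq_square)
  finally show "exp (ln (1 / \<gamma>) / 2) * \<gamma> \<le> (3163/10000)"
    unfolding L_def[symmetric] using \<gamma> by (subst (asm) power_mono_iff) auto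
qed

section \<open>The competitors and the final constants\<close>

context white_noise
begin

lemma minimizer_superefficiency:
  assumes \<gamma>: "0 < \<gamma>" "\<gamma> < 1/10" and E: "E \<in> estimators" and f: "f \<in> convex_class"
    and r: "risk P W \<epsilon> minimizer E f \<le> ennreal \<gamma> * R_z P W \<epsilon> f"
  shows "\<exists>g\<in>convex_class. risk P W \<epsilon> minimizer E g
    \<ge> ennreal (1/40 * ln (1 / \<gamma>) powr (1/3)) * R_z P W \<epsilon> g"
proof -
  define L where "L = ln (1 / \<gamma>)"
  define l where "l = L powr (1/3)"
  note lg = log_inverse_bounds[OF \<gamma>, folded L_def, folded l_def]
  have l: "0 < l" using lg(1) by linarith
  have L: "0 < L" using lg(2) l zero_less_power[of l 3] by simp
  \<comment> \<open>This choice gives \<open>l2_dist_sq f g \<le> \<epsilon>\<^sup>2 L / 4\<close> for the function \<open>g\<close> below.\<close>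
  define \<tau> where "\<tau> = 4/125 * L * \<epsilon>\<^sup>2"
  have \<tau>: "0 < \<tau>" using L eps by (simp add: \<tau>_def)
  obtain x p where x: "0 < x" and p: "p \<in> {0..1}" "\<bar>p - minimizer f\<bar> = x"
    and fp: "f p \<le> minimum f + sqrt (\<tau> / x)"
    and growth: "\<And>t. t \<in> {0..1} \<Longrightarrow> (10404/10000) * x \<le> \<bar>t - minimizer f\<bar> \<Longrightarrow>
      minimum f + sqrt (\<tau> / x) / ((1061208/1000000) * x) * \<bar>t - minimizer f\<bar> \<le> f t"
    using exists_scale[OF f \<tau>] by metis
  define \<Delta> where "\<Delta> = sqrt (\<tau> / x)"
  have \<Delta>: "0 < \<Delta>" "\<Delta>\<^sup>2 = \<tau> / x" using \<tau> x by (auto simp: \<Delta>_def)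
  define g where "g = lift_to_vee f p (minimum f + \<Delta>) (\<Delta> / (3 * x))"
  have g: "g \<in> convex_class" "minimizer g = p" "minimum g = minimum f + \<Delta>"
    unfolding g_def using \<Delta> x fp by (intro lift_to_vee f p; simp add: \<Delta>_def)+
  have d: "l2_dist_sq f g \<le> L / 4 * \<epsilon>\<^sup>2"
  proof -
    have "l2_dist_sq f g \<le> 125/16 * (\<Delta>\<^sup>2 * x)"
      unfolding g_def using \<Delta> fp growth by (intro l2_dist_sq_lift_to_vee_le f x p) (auto simp: \<Delta>_def)
    also have "\<dots> = L / 4 * \<epsilon>\<^sup>2" using x by (simp add: \<Delta> \<tau>_def)
    finally show ?thesis .
  qed
  \<comment> \<open>The wedge holds \<open>g\<close> up from its tip on, so the margin is 0. For its
    slope \<open>\<Delta> / (3 * x)\<close>, the condition on \<beta> becomes an equality at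
    \<open>l / (30 * x)\<close>. The resulting bound is 7.5 x / l, and the factor 1/40 turns it into
    3/16 x, just below x/5.\<close>
  have bg: "benchmark P W minimizer \<epsilon> g \<le> ennreal (0 / 2 + 1 / (4 * (l / (30 * x))))"
  proof (rule benchmark_minimizer_le[OF g(1), where A="\<Delta> / (3 * x)"])
    show "96 * \<epsilon>\<^sup>2 * (l / (30 * x)) ^ 3 \<le> (\<Delta> / (3 * x))\<^sup>2"
      using x by (simp add: power_divide power_mult_distrib \<Delta> lg(2) \<tau>_def)
        (simp add: field_simps power2_eq_square power3_eq_cube)
    show "minimum g + \<Delta> / (3 * x) * \<bar>t - minimizer g\<bar> \<le> g t" for t
      unfolding g(2,3) by (simp add: g_def lift_to_vee_def)
  qed (use \<Delta> x l in auto)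
  \<comment> \<open>For \<open>f\<close>, growth is known only beyond the scale, hence the margin
    1.0404 x. The constant 15.1 is slightly more than the condition on \<beta> demands.\<close>
  have bf: "benchmark P W minimizer \<epsilon> f \<le> ennreal ((10404/10000) * x / 2 + 1 / (4 * (l / ((151/10) * x))))"
  proof (rule benchmark_minimizer_le[OF f, where A="\<Delta> / ((1061208/1000000) * x)"])
    have "96 * \<epsilon>\<^sup>2 * (l / ((151/10) * x)) ^ 3 = (96 / (151/10) ^ 3) * (L * \<epsilon>\<^sup>2 / x ^ 3)"
      by (simp add: power_divide power_mult_distrib lg(2))
    also have "\<dots> \<le> (4/125 / (1061208/1000000)\<^sup>2) * (L * \<epsilon>\<^sup>2 / x ^ 3)"
      using L x by (intro mult_right_mono) (auto simp: power2_eq_square power3_eq_cube)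
    also have "\<dots> = (\<Delta> / ((1061208/1000000) * x))\<^sup>2"
      unfolding power_divide power_mult_distrib \<Delta>(2) \<tau>_def
      using x by (simp add: power2_eq_square power3_eq_cube)
    finally show "96 * \<epsilon>\<^sup>2 * (l / ((151/10) * x)) ^ 3 \<le> (\<Delta> / ((1061208/1000000) * x))\<^sup>2" .
  qed (use \<Delta> x l growth in \<open>auto simp: \<Delta>_def\<close>)
  also have "ennreal ((10404/10000) * x / 2 + 1 / (4 * (l / ((151/10) * x)))) \<le> ennreal ((341/100) * x)"
  proof (rule ennreal_leI)
    have "1 / (4 * (l / ((151/10) * x))) = (3775/1000) * x / l" by simp
    also have "\<dots> \<le> (3775/1000) * x / (131/100)" using lg(1) x by (intro divide_left_mono) auto
    finally show "(10404/10000) * x / 2 + 1 / (4 * (l / ((151/10) * x))) \<le> (341/100) * x" using x by simp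
  qed
  finally have bf': "benchmark P W minimizer \<epsilon> f \<le> ennreal ((341/100) * x)" .
  have "ennreal (1/40 * l) * benchmark P W minimizer \<epsilon> g \<le> risk P W \<epsilon> minimizer E g"
  \<comment> \<open>\<open>\<rho>\<close> is 8/10, because 0.178 * 3.41 is below 0.64; a fifth of
    the gap \<open>x\<close> remains as risk at \<open>g\<close>.\<close>
  proof (rule superefficiency_penalty[OF f g(1) E less_imp_le[OF \<gamma>(1)] r[unfolded R_z_def] bf' _ bg])
    show "minimizer g \<noteq> minimizer f" using p x by (auto simp: g)
    have "exp (l2_dist_sq f g / \<epsilon>\<^sup>2) \<le> exp (L / 4)" using d eps by (simp add: pos_divide_le_eq)
    then have "exp (l2_dist_sq f g / \<epsilon>\<^sup>2) * (\<gamma> * ((341/100) * x)) \<le> exp (L / 4) * (\<gamma> * ((341/100) * x))"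
      using \<gamma> x by (intro mult_right_mono) auto
    also have "\<dots> = (exp (L / 4) * \<gamma>) * ((341/100) * x)" by simp
    also have "\<dots> \<le> (178/1000) * ((341/100) * x)" using lg(3) x by (intro mult_right_mono) auto
    also have "\<dots> \<le> (8/10)\<^sup>2 * x" using x by (simp add: power2_eq_square)
    finally show "exp (l2_dist_sq f g / \<epsilon>\<^sup>2) * (\<gamma> * ((341/100) * x)) \<le> (8/10)\<^sup>2 * \<bar>minimizer g - minimizer f\<bar>"
      using p by (simp add: g)
    have "1/40 * l * (0 / 2 + 1 / (4 * (l / (30 * x)))) = 3/16 * x" using l by simp
    also have "\<dots> \<le> x * (1 - (8/10))" using x by simp
    finally show "1/40 * l * (0 / 2 + 1 / (4 * (l / (30 * x)))) \<le> \<bar>minimizer g - minimizer f\<bar> * (1 - (8/10))"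
      using p by (simp add: g)
  qed (use x l in auto)
  then show ?thesis using g(1) by (intro bexI[of _ g]) (simp_all add: R_z_def l_def L_def)
qed

lemma minimum_superefficiency:
  assumes \<gamma>: "0 < \<gamma>" "\<gamma> < 1/10" and E: "E \<in> estimators" and f: "f \<in> convex_class"
    and r: "risk P W \<epsilon> minimum E f \<le> ennreal \<gamma> * R_m P W \<epsilon> f"
  shows "\<exists>g\<in>convex_class. risk P W \<epsilon> minimum E g
    \<ge> ennreal (1/8 * ln (1 / \<gamma>) powr (1/3)) * R_m P W \<epsilon> g"
proof -
  define L where "L = ln (1 / \<gamma>)"
  define l where "l = L powr (1/3)"
  note lg = log_inverse_bounds[OF \<gamma>, folded L_def, folded l_def]
  have l: "0 < l" using lg(1) by linarith
  have L: "0 < L" using lg(2) l zero_less_power[of l 3] by simp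
  \<comment> \<open>\<open>s\<close> bounds the distance between \<open>f\<close> and the competitor
    in units of \<open>\<epsilon>\<close>; \<open>D\<close> is the level whose filling has exactly
    this cost.\<close>
  define s where "s = sqrt (L / 2)"
  have s2: "s\<^sup>2 = L / 2" using L by (simp add: s_def)
  \<comment> \<open>Here the exponent 1/2 is weakened to 1/3: \<open>s = l * sqrt (l / 2)\<close>,
    and \<open>l\<close> is at least 1.31.\<close>
  have ls: "(809/1000) * l \<le> s"
  proof (rule power2_le_imp_le)
    have "((809/1000) * l)\<^sup>2 = (654481/1000000) * l\<^sup>2" by (simp add: power2_eq_square)
    also have "\<dots> \<le> (l / 2) * l\<^sup>2" using lg(1) by (intro mult_right_mono) auto
    also have "\<dots> = s\<^sup>2" unfolding s2 lg(2)[symmetric] by (simp add: power2_eq_square power3_eq_cube)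
    finally show "((809/1000) * l)\<^sup>2 \<le> s\<^sup>2" .
  qed (use L in \<open>simp add: s_def\<close>)
  then have s: "(10597/10000) \<le> s" using lg(1) by linarith
  obtain D where D: "0 < D" "fill f D = (s * \<epsilon>)\<^sup>2"
    using exists_fill_eq[OF f, of "(s * \<epsilon>)\<^sup>2"] s eps by auto
  \<comment> \<open>The slope \<open>\<eta>\<close> only serves to make the minimizer of \<open>g\<close> unique.\<close>
  define \<eta> where "\<eta> = D / (100 * s)"
  have \<eta>: "0 < \<eta>" "\<eta> \<le> D / 100" using D s by (auto simp: \<eta>_def divide_le_eq)
  let ?m = "minimum f" and ?z = "minimizer f"
  note F = convex_class_minimizer[OF f]
  \<comment> \<open>The tip is lowered by \<open>\<eta>\<close>, so that the wedge stays below the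
    level \<open>?m + D\<close> on all of [0,1].\<close>
  define g where "g = lift_to_vee f ?z (?m + (D - \<eta>)) \<eta>"
  have g: "g \<in> convex_class" "minimum g = ?m + (D - \<eta>)"
    unfolding g_def using \<eta> D by (intro lift_to_vee f F; simp add: F(3))+
  have up: "\<bar>f t - g t\<bar> \<le> max 0 (?m + D - f t)" "g t \<le> max (f t) (?m + D)" if t: "t \<in> {0..1}" for t
  proof -
    have "\<bar>t - ?z\<bar> \<le> 1" using t F(2) by auto
    then have "\<eta> * \<bar>t - ?z\<bar> \<le> \<eta>" using \<eta> by (simp add: mult_left_le)
    then show "\<bar>f t - g t\<bar> \<le> max 0 (?m + D - f t)" "g t \<le> max (f t) (?m + D)"
      by (auto simp: g_def lift_to_vee_def)
  qed
  note bm = bounded_measurable_intros convex_class_bounded_measurable[OF f]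
    convex_class_bounded_measurable[OF g(1)]
  have "l2_dist_sq f g \<le> fill f D"
    unfolding l2_dist_sq_def fill_def
  proof (intro integral_mono integrable_bounded_measurable bm)
    fix t assume "t \<in> space unit_lborel"
    then have "\<bar>f t - g t\<bar>\<^sup>2 \<le> (max 0 (?m + D - f t))\<^sup>2" using up by (intro power_mono) auto
    then show "(f t - g t)\<^sup>2 \<le> (max 0 (?m + D - f t))\<^sup>2" by simp
  qed
  then have d: "l2_dist_sq f g \<le> L / 2 * \<epsilon>\<^sup>2" by (simp add: D(2) power_mult_distrib s2)
  \<comment> \<open>For \<open>m\<close> beyond \<open>D\<close>, \<open>fill_scale\<close> bounds
    \<open>fill f m\<close> from below by \<open>(m / D)\<^sup>2\<close> times the cost
    \<open>(s * \<epsilon>)\<^sup>2\<close> of the level \<open>D\<close>.\<close>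
  have bf: "benchmark P W minimum \<epsilon> f \<le> ennreal (11/8 * ((11513/10000) * D))"
  proof (rule benchmark_minimum_le[OF f, where a="D / s" and b=0 and c=D])
    fix m v :: real assume m: "0 \<le> m" and v: "0 \<le> v" and le: "fill f m \<le> (\<epsilon> * v)\<^sup>2"
    show "m \<le> max D (D / s * v + 0)"
    proof (cases "m \<le> D")
      case False
      then have "(m / D)\<^sup>2 * fill f D \<le> fill f (m / D * D)" using D by (intro fill_scale f) auto
      also have "\<dots> \<le> (\<epsilon> * v)\<^sup>2" using le D by simp
      finally have "(m / D * (s * \<epsilon>))\<^sup>2 \<le> (\<epsilon> * v)\<^sup>2" by (simp add: D(2) power_mult_distrib power_divide)
      then have "m / D * (s * \<epsilon>) \<le> \<epsilon> * v" by (rule power2_le_imp_le) (use eps v in auto)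
      moreover have "m / D * (s * \<epsilon>) = \<epsilon> * (m / D * s)" by simp
      ultimately have "m / D * s \<le> v" using mult_le_cancel_left_pos[OF eps] by metis
      then have "m \<le> D / s * v" using D s by (simp add: field_simps)
      then show ?thesis by simp
    qed simp
  next
    have "61/50 * (D / s) \<le> 61/50 * (D / (10597/10000))" using D s by (intro mult_left_mono divide_left_mono) auto
    then show "61/50 * (D / s) + 0 \<le> (11513/10000) * D" using D by simp
  qed (use D s in auto)
  have bg: "benchmark P W minimum \<epsilon> g \<le> ennreal (11/8 * ((123/100) * D / s))"
  proof (rule benchmark_minimum_le[OF g(1), where a="D / s" and b=\<eta> and c=\<eta>])
    fix m v :: real assume m: "0 \<le> m" and v: "0 \<le> v" and le: "fill g m \<le> (\<epsilon> * v)\<^sup>2"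
    show "m \<le> max \<eta> (D / s * v + \<eta>)"
    proof (cases "m \<le> \<eta>")
      case False
      \<comment> \<open>Where \<open>f\<close> lies below the level \<open>?m + D\<close>,
        \<open>g\<close> is within \<open>\<eta>\<close> of its minimum, so that raising this
        minimum by \<open>m\<close> fills at least \<open>m - \<eta>\<close>, while the deficit of
        \<open>f\<close> is at most \<open>D\<close>. The flat bottom of \<open>g\<close> is
        therefore as expensive to move as the filling of \<open>f\<close>, scaled.\<close>
      have "((m - \<eta>) / D)\<^sup>2 * fill f D = (\<integral>t. ((m - \<eta>) / D * max 0 (?m + D - f t))\<^sup>2 \<partial>unit_lborel)"
        unfolding fill_def power_mult_distrib by simp
      also have "\<dots> \<le> fill g m"
        unfolding fill_def
      proof (intro integral_mono integrable_bounded_measurable bm power_mono)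
        fix t assume "t \<in> space unit_lborel"
        then have t: "t \<in> {0..1}" by simp
        show "(m - \<eta>) / D * max 0 (?m + D - f t) \<le> max 0 (minimum g + m - g t)"
        proof (cases "f t \<le> ?m + D")
          case True
          have "(m - \<eta>) / D * max 0 (?m + D - f t) \<le> (m - \<eta>) / D * D"
            using True False D F(4)[OF t] by (intro mult_left_mono) auto
          also have "\<dots> = m - \<eta>" using D by simp
          also have "\<dots> \<le> minimum g + m - g t" using up(2)[OF t] True by (simp add: g)
          finally show ?thesis by simp
        qed (use False in simp)
        show "0 \<le> (m - \<eta>) / D * max 0 (?m + D - f t)" using False D by simp
      qed
      also note le
      finally have "((m - \<eta>) / D * (s * \<epsilon>))\<^sup>2 \<le> (\<epsilon> * v)\<^sup>2" by (simp add: D(2) power_mult_distrib power_divide)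
      then have "(m - \<eta>) / D * (s * \<epsilon>) \<le> \<epsilon> * v" by (rule power2_le_imp_le) (use eps v in auto)
      moreover have "(m - \<eta>) / D * (s * \<epsilon>) = \<epsilon> * ((m - \<eta>) / D * s)" by simp
      ultimately have "(m - \<eta>) / D * s \<le> v" using mult_le_cancel_left_pos[OF eps] by metis
      then have "m - \<eta> \<le> D / s * v" using D s by (simp add: field_simps)
      then show ?thesis by simp
    qed simp
  next
    have "\<eta> = (1/100) * (D / s)" using s by (simp add: \<eta>_def)
    moreover have "(123/100) * D / s = (123/100) * (D / s)" by simp
    moreover have "0 \<le> D / s" using D s by simp
    ultimately show "\<eta> \<le> (123/100) * D / s" "61/50 * (D / s) + \<eta> \<le> (123/100) * D / s"
      by linarith+
  qed (use D s \<eta> in auto)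
  have \<delta>: "\<bar>minimum g - ?m\<bar> = D - \<eta>" "(99/100) * D \<le> D - \<eta>" using \<eta> D by (auto simp: g)
  have "ennreal (1/8 * l) * benchmark P W minimum \<epsilon> g \<le> risk P W \<epsilon> minimum E g"
  proof (rule superefficiency_penalty[OF f g(1) E less_imp_le[OF \<gamma>(1)] r[unfolded R_m_def] bf _ bg])
    show "minimum g \<noteq> minimum f" using \<delta> D by auto
    have "exp (l2_dist_sq f g / \<epsilon>\<^sup>2) \<le> exp (L / 2)" using d eps by (simp add: pos_divide_le_eq)
    then have "exp (l2_dist_sq f g / \<epsilon>\<^sup>2) * (\<gamma> * (11/8 * ((11513/10000) * D))) \<le> exp (L / 2) * (\<gamma> * (11/8 * ((11513/10000) * D)))"
      using \<gamma> D by (intro mult_right_mono) auto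
    also have "\<dots> = (exp (L / 2) * \<gamma>) * (11/8 * ((11513/10000) * D))" by simp
    also have "\<dots> \<le> (3163/10000) * (11/8 * ((11513/10000) * D))" using lg(4) D by (intro mult_right_mono) auto
    also have "\<dots> \<le> (72/100)\<^sup>2 * ((99/100) * D)" using D by (simp add: power2_eq_square)
    also have "\<dots> \<le> (72/100)\<^sup>2 * \<bar>minimum g - ?m\<bar>" using \<delta> by (intro mult_left_mono) auto
    finally show "exp (l2_dist_sq f g / \<epsilon>\<^sup>2) * (\<gamma> * (11/8 * ((11513/10000) * D))) \<le> (72/100)\<^sup>2 * \<bar>minimum g - ?m\<bar>" .
    \<comment> \<open>The bound at \<open>g\<close> is of the order \<open>D / s\<close>, and
      \<open>l / s\<close> is bounded. This compares about 0.261 D with 0.99 * 0.28 D, about 0.277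
      D, which leaves room for the factor 1/8.\<close>
    have "1/8 * l * (11/8 * ((123/100) * D / s)) = (11/64 * (123/100) * D) * (l / s)" by simp
    also have "\<dots> \<le> (11/64 * (123/100) * D) * (1 / (809/1000))"
      using ls l s D by (intro mult_left_mono) (auto simp: field_simps)
    also have "\<dots> \<le> ((99/100) * D) * (1 - (72/100))" using D by simp
    also have "\<dots> \<le> \<bar>minimum g - ?m\<bar> * (1 - (72/100))" using \<delta> by (intro mult_right_mono) auto
    finally show "1/8 * l * (11/8 * ((123/100) * D / s)) \<le> \<bar>minimum g - ?m\<bar> * (1 - (72/100))" .
  qed (use D l in auto)
  then show ?thesis using g(1) by (intro bexI[of _ g]) (simp_all add: R_m_def l_def L_def)
qed

end

theorem theorem2p3:
  fixes P :: "'w measure" and W :: "real \<Rightarrow> 'w \<Rightarrow> real" and \<epsilon> \<gamma> :: real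
  assumes "standard_brownian_motion P W"
    and "\<epsilon> > 0" and "0 < \<gamma>" and "\<gamma> < 1 / 10"
  shows "(\<forall>Zhat\<in>estimators. \<forall>f0\<in>convex_class.
            risk P W \<epsilon> minimizer Zhat f0 \<le> ennreal \<gamma> * R_z P W \<epsilon> f0 \<longrightarrow>
            (\<exists>f1\<in>convex_class.
               risk P W \<epsilon> minimizer Zhat f1
                 \<ge> ennreal (1 / 40 * ln (1 / \<gamma>) powr (1 / 3)) * R_z P W \<epsilon> f1)) \<and>
         (\<forall>Mhat\<in>estimators. \<forall>f0\<in>convex_class.
            risk P W \<epsilon> minimum Mhat f0 \<le> ennreal \<gamma> * R_m P W \<epsilon> f0 \<longrightarrow>
            (\<exists>f1\<in>convex_class.
               risk P W \<epsilon> minimum Mhat f1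
                 \<ge> ennreal (1 / 8 * ln (1 / \<gamma>) powr (1 / 3)) * R_m P W \<epsilon> f1))"
proof -
  interpret white_noise P W \<epsilon> using assms by unfold_locales
  show ?thesis
    using minimizer_superefficiency[OF assms(3,4)] minimum_superefficiency[OF assms(3,4)] by blast
qed

end
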